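(* Assume that $f\colon M\to \mathbb{Q}^4_c$ is the composition of an umbilic-free oriented surface $F\colon M\to \mathbb{Q}^3_{\tilde c}$, $\tilde c\geq c$, with a totally umbilical inclusion $j\colon \mathbb{Q}^3_{\tilde c}\to \mathbb{Q}^4_c$. Then $\Omega^-=\Omega^+=2\Omega$, where $\Omega^\pm$ are the mixed connection forms of $f$ and $\Omega$ is the principal connection form of $F$.
   Context: $\mathbb{Q}^n_c$ is the complete simply-connected oriented $n$-dimensional Riemannian manifold of constant sectional curvature $c$. $M$ is a connected, oriented 2-dimensional Riemannian manifold; surfaces are isometric immersions. **Principal connection form.** Let $F\colon M\to\mathbb{Q}^3_{\tilde c}$ be umbilic-free with shape operator $A$ and principal curvatures $k_1>k_2$. A principal frame field is a positively oriented local orthonormal frame $\{e_1,e_2\}$ of $TM$ with $Ae_l=k_le_l$, $l=1,2$; it exists locally and is unique up to sign. The principal connection form of $F$ is the global 1-form $\Omega$ on $M$ given locally by $\Omega=\omega_{12}=\langle\nabla e_1,e_2\rangle$ for any principal frame field. **Mixed connection forms.** For $f\colon M\to\mathbb{Q}^4_c$, let $\alpha$ be the second fundamental form, $H=\frac12\mathrm{trace}\,\alpha$, $K$ the Gaussian curvature, $\nabla^\perp$ the normal connection, $K_N=\langle R^\perp(e_1,e_2)e_4,e_3\rangle$ the normal curvature (positively oriented orthonormal frames of $TM$, $N_fM$), $J^\perp$ the rotation by $+\pi/2$ in the oriented normal bundle $N_fM$, and $M_0^\pm(f)=\{p:\|H\|^2-(K-c)=|K_N|,\ \pm K_N\ge0\}$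 (empty for $f$ as in the claim). For a positively oriented local orthonormal frame $\{e_1,e_2\}$ off $M_0^\pm(f)$, with $\alpha_{kl}=\alpha(e_k,e_l)$, the field $\frac{\alpha_{11}-\alpha_{22}}2\pm J^\perp\alpha_{12}$ is nowhere zero; let $e_3^\pm$ be its normalization, $e_4^\pm=J^\perp e_3^\pm$, $\omega_{12}=\langle\nabla e_1,e_2\rangle$, $\omega_{34}^\pm=\langle\nabla^\perp e_3^\pm,e_4^\pm\rangle$. The mixed connection form is $\Omega^\pm=2\omega_{12}\pm\omega_{34}^\pm$; it is independent of the frame and globally defined on $M\smallsetminus M_0^\pm(f)$. *)

theory Defs
  imports "HOL-Analysis.Analysis"
begin

section \<open>Smooth maps between open subsets of normed spaces\<close>

abbreviation dd :: "('a::real_normed_vector \<Rightarrow> 'b::real_normed_vector) \<Rightarrow> 'a \<Rightarrow> 'a \<Rightarrow> 'b" where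
  "dd f x \<equiv> frechet_derivative f (at x)"

text \<open>Only meant for open \<open>S\<close>.\<close>

primrec Ck_on :: "nat \<Rightarrow> 'a::real_normed_vector set \<Rightarrow> ('a \<Rightarrow> 'b::real_normed_vector) \<Rightarrow> bool" where
  "Ck_on 0 S f \<longleftrightarrow> continuous_on S f"
| "Ck_on (Suc k) S f \<longleftrightarrow>
     (\<forall>x\<in>S. f differentiable (at x)) \<and> (\<forall>v. Ck_on k S (\<lambda>x. dd f x v))"

definition smooth_on :: "'a::real_normed_vector set \<Rightarrow> ('a \<Rightarrow> 'b::real_normed_vector) \<Rightarrow> bool" where
  "smooth_on S f \<longleftrightarrow> (\<forall>k. Ck_on k S f)"


section \<open>Riemannian geometry in coordinates\<close>

text \<open>A metric in coordinates is a function \<open>g\<close> with \<open>g x u v\<close> the inner product at the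
  coordinate point \<open>x\<close> of the vectors with components \<open>u\<close> and \<open>v\<close>.  The Levi-Civita connection
  is \<open>\<nabla>\<^sub>u V = dV(u) + \<Gamma>(u, V)\<close>, with \<open>\<Gamma>\<close> given by the Koszul formula for constant
  coefficient (hence commuting) fields.\<close>

type_synonym 'e cmetric = "'e \<Rightarrow> 'e \<Rightarrow> 'e \<Rightarrow> real"

definition christoffel :: "'e::euclidean_space cmetric \<Rightarrow> 'e \<Rightarrow> 'e \<Rightarrow> 'e \<Rightarrow> 'e" where
  "christoffel g x u v = (THE w. \<forall>z. 2 * g x w z =
     dd (\<lambda>y. g y v z) x u + dd (\<lambda>y. g y u z) x v - dd (\<lambda>y. g y u v) x z)"

text \<open>Covariant derivative at \<open>x\<close>, in direction \<open>u\<close>, of a vector field \<open>V\<close> along the map \<open>h\<close>;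
  for \<open>h = id\<close> this is the Levi-Civita connection of \<open>g\<close> itself.\<close>

definition cov_deriv ::
  "'e::euclidean_space cmetric \<Rightarrow> ('a::real_normed_vector \<Rightarrow> 'e) \<Rightarrow> ('a \<Rightarrow> 'e) \<Rightarrow> 'a \<Rightarrow> 'a \<Rightarrow> 'e" where
  "cov_deriv g h V x u = dd V x u + christoffel g (h x) (dd h x u) (V x)"

text \<open>\<open>R(u,v)w = \<nabla>\<^sub>u\<nabla>\<^sub>v w - \<nabla>\<^sub>v\<nabla>\<^sub>u w - \<nabla>\<^bsub>[u,v]\<^esub> w\<close>; the bracket vanishes for constant
  coefficient fields.\<close>

definition curv :: "'e::euclidean_space cmetric \<Rightarrow> 'e \<Rightarrow> 'e \<Rightarrow> 'e \<Rightarrow> 'e \<Rightarrow> 'e" where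
  "curv g x u v w =
     cov_deriv g id (\<lambda>y. cov_deriv g id (\<lambda>_. w) y v) x u
   - cov_deriv g id (\<lambda>y. cov_deriv g id (\<lambda>_. w) y u) x v"

definition sec_curv :: "'e::euclidean_space cmetric \<Rightarrow> 'e \<Rightarrow> 'e \<Rightarrow> 'e \<Rightarrow> real" where
  "sec_curv g x u v = g x (curv g x u v v) u / (g x u u * g x v v - (g x u v)\<^sup>2)"

definition gauss_curv :: "(real^2) cmetric \<Rightarrow> real^2 \<Rightarrow> real" where
  "gauss_curv g x = sec_curv g x (axis 1 1) (axis 2 1)"

text \<open>Charts will be positively oriented, so orientation in coordinates is the standard one.\<close>

definition pos_onb :: "(real^2) cmetric \<Rightarrow> real^2 \<Rightarrow> real^2 \<Rightarrow> real^2 \<Rightarrow> bool" where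
  "pos_onb g x u v \<longleftrightarrow>
     g x u u = 1 \<and> g x v v = 1 \<and> g x u v = 0 \<and> det (vector [u, v] :: real^2^2) > 0"

definition pos_frame ::
  "(real^2) cmetric \<Rightarrow> (real^2) set \<Rightarrow> (real^2 \<Rightarrow> real^2) \<Rightarrow> (real^2 \<Rightarrow> real^2) \<Rightarrow> bool" where
  "pos_frame g W e1 e2 \<longleftrightarrow> open W \<and> smooth_on W e1 \<and> smooth_on W e2 \<and>
     (\<forall>x\<in>W. pos_onb g x (e1 x) (e2 x))"

definition conn_form ::
  "(real^2) cmetric \<Rightarrow> (real^2 \<Rightarrow> real^2) \<Rightarrow> (real^2 \<Rightarrow> real^2) \<Rightarrow> real^2 \<Rightarrow> real^2 \<Rightarrow> real" where
  "conn_form g e1 e2 x v = g x (cov_deriv g id e1 x v) (e2 x)"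


subsection \<open>Immersions in coordinates\<close>

text \<open>Here \<open>h\<close> is the coordinate expression of an immersion, \<open>gN\<close> the metric of the target and
  \<open>gM\<close> that of the source.\<close>

definition normal_space ::
  "'e::euclidean_space cmetric \<Rightarrow> ('a::euclidean_space \<Rightarrow> 'e) \<Rightarrow> 'a \<Rightarrow> 'e set" where
  "normal_space gN h x = {\<xi>. \<forall>w. gN (h x) \<xi> (dd h x w) = 0}"

definition normal_part ::
  "'e::euclidean_space cmetric \<Rightarrow> ('a::euclidean_space \<Rightarrow> 'e) \<Rightarrow> 'a \<Rightarrow> 'e \<Rightarrow> 'e" where
  "normal_part gN h x z = (THE \<xi>. \<xi> \<in> normal_space gN h x \<and> z - \<xi> \<in> range (dd h x))"

text \<open>Second fundamental form: \<open>\<alpha>(u,v)\<close> is the normal component of the ambient derivative of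
  \<open>h\<^sub>* v\<close> for the extension of \<open>v\<close> with constant coefficients.\<close>

definition sff ::
  "'e::euclidean_space cmetric \<Rightarrow> ('a::euclidean_space \<Rightarrow> 'e) \<Rightarrow> 'a \<Rightarrow> 'a \<Rightarrow> 'a \<Rightarrow> 'e" where
  "sff gN h x u v = normal_part gN h x (cov_deriv gN h (\<lambda>y. dd h y v) x u)"

definition normal_conn ::
  "'e::euclidean_space cmetric \<Rightarrow> ('a::euclidean_space \<Rightarrow> 'e) \<Rightarrow> ('a \<Rightarrow> 'e) \<Rightarrow> 'a \<Rightarrow> 'a \<Rightarrow> 'e" where
  "normal_conn gN h \<xi> x u = normal_part gN h x (cov_deriv gN h \<xi> x u)"

definition umbilic_at ::
  "'a::euclidean_space cmetric \<Rightarrow> 'e::euclidean_space cmetric \<Rightarrow> ('a \<Rightarrow> 'e) \<Rightarrow> 'a \<Rightarrow> bool" where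
  "umbilic_at gM gN h x \<longleftrightarrow> (\<exists>\<eta>. \<forall>u v. sff gN h x u v = gM x u v *\<^sub>R \<eta>)"


subsection \<open>Surfaces in 3-manifolds\<close>

definition unit_normal :: "(real^3) cmetric \<Rightarrow> (real^2 \<Rightarrow> real^3) \<Rightarrow> real^2 \<Rightarrow> real^3" where
  "unit_normal gN h x = (THE \<nu>. \<nu> \<in> normal_space gN h x \<and> gN (h x) \<nu> \<nu> = 1 \<and>
     det (vector [dd h x (axis 1 1), dd h x (axis 2 1), \<nu>] :: real^3^3) > 0)"

definition shape_op ::
  "(real^2) cmetric \<Rightarrow> (real^3) cmetric \<Rightarrow> (real^2 \<Rightarrow> real^3) \<Rightarrow> real^2 \<Rightarrow> real^2 \<Rightarrow> real^2" where
  "shape_op gM gN h x u =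
     (THE w. \<forall>v. gM x w v = gN (h x) (sff gN h x u v) (unit_normal gN h x))"

definition principal_frame ::
  "(real^2) cmetric \<Rightarrow> (real^3) cmetric \<Rightarrow> (real^2 \<Rightarrow> real^3) \<Rightarrow> (real^2) set \<Rightarrow>
   (real^2 \<Rightarrow> real^2) \<Rightarrow> (real^2 \<Rightarrow> real^2) \<Rightarrow> bool" where
  "principal_frame gM gN h W e1 e2 \<longleftrightarrow> pos_frame gM W e1 e2 \<and>
     (\<forall>x\<in>W. \<exists>k1 k2. k1 > k2 \<and>
        shape_op gM gN h x (e1 x) = k1 *\<^sub>R e1 x \<and> shape_op gM gN h x (e2 x) = k2 *\<^sub>R e2 x)"


subsection \<open>Surfaces in 4-manifolds\<close>

text \<open>Orientation of the normal plane: a tangent basis followed by a normal basis is positive in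
  the ambient space iff both are positive or both are negative.\<close>

definition pos_normal_onb ::
  "(real^4) cmetric \<Rightarrow> (real^2 \<Rightarrow> real^4) \<Rightarrow> real^2 \<Rightarrow> real^4 \<Rightarrow> real^4 \<Rightarrow> bool" where
  "pos_normal_onb gN h x \<xi> \<zeta> \<longleftrightarrow>
     \<xi> \<in> normal_space gN h x \<and> \<zeta> \<in> normal_space gN h x \<and>
     gN (h x) \<xi> \<xi> = 1 \<and> gN (h x) \<zeta> \<zeta> = 1 \<and> gN (h x) \<xi> \<zeta> = 0 \<and>
     det (vector [dd h x (axis 1 1), dd h x (axis 2 1), \<xi>, \<zeta>] :: real^4^4) > 0"

definition pos_normal_frame ::
  "(real^4) cmetric \<Rightarrow> (real^2 \<Rightarrow> real^4) \<Rightarrow> (real^2) set \<Rightarrow>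
   (real^2 \<Rightarrow> real^4) \<Rightarrow> (real^2 \<Rightarrow> real^4) \<Rightarrow> bool" where
  "pos_normal_frame gN h W e3 e4 \<longleftrightarrow> open W \<and> smooth_on W e3 \<and> smooth_on W e4 \<and>
     (\<forall>x\<in>W. pos_normal_onb gN h x (e3 x) (e4 x))"

definition J_perp ::
  "(real^4) cmetric \<Rightarrow> (real^2 \<Rightarrow> real^4) \<Rightarrow> real^2 \<Rightarrow> real^4 \<Rightarrow> real^4" where
  "J_perp gN h x \<xi> = (THE \<zeta>. \<zeta> \<in> normal_space gN h x \<and>
     gN (h x) \<xi> \<zeta> = 0 \<and> gN (h x) \<zeta> \<zeta> = gN (h x) \<xi> \<xi> \<and>
     (\<xi> \<noteq> 0 \<longrightarrow>
       det (vector [dd h x (axis 1 1), dd h x (axis 2 1), \<xi>, \<zeta>] :: real^4^4) > 0))"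

definition mean_curv ::
  "(real^2) cmetric \<Rightarrow> (real^4) cmetric \<Rightarrow> (real^2 \<Rightarrow> real^4) \<Rightarrow> real^2 \<Rightarrow> real^4" where
  "mean_curv gM gN h x = (THE \<eta>. \<forall>u v. pos_onb gM x u v \<longrightarrow>
     \<eta> = (1/2) *\<^sub>R (sff gN h x u u + sff gN h x v v))"

definition normal_curv_op ::
  "(real^4) cmetric \<Rightarrow> (real^2 \<Rightarrow> real^4) \<Rightarrow> (real^2 \<Rightarrow> real^4) \<Rightarrow>
   real^2 \<Rightarrow> real^2 \<Rightarrow> real^2 \<Rightarrow> real^4" where
  "normal_curv_op gN h \<xi> x u v =
     normal_conn gN h (\<lambda>y. normal_conn gN h \<xi> y v) x u
   - normal_conn gN h (\<lambda>y. normal_conn gN h \<xi> y u) x v"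

text \<open>\<open>K\<^sub>N = \<langle>R\<^sup>\<perp>(e\<^sub>1,e\<^sub>2)e\<^sub>4, e\<^sub>3\<rangle>\<close>, for any positively oriented orthonormal frames.\<close>

definition normal_curv ::
  "(real^2) cmetric \<Rightarrow> (real^4) cmetric \<Rightarrow> (real^2 \<Rightarrow> real^4) \<Rightarrow> real^2 \<Rightarrow> real" where
  "normal_curv gM gN h x = (THE r. \<forall>u v W e3 e4.
     pos_onb gM x u v \<and> pos_normal_frame gN h W e3 e4 \<and> x \<in> W \<longrightarrow>
     r = gN (h x) (normal_curv_op gN h e4 x u v) (e3 x))"

text \<open>From here on \<open>s \<in> {1, -1}\<close> is the sign in \<open>M\<^sub>0\<^sup>\<plusminus>\<close> and \<open>\<Omega>\<^sup>\<plusminus>\<close>.\<close>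

definition M0_at ::
  "real \<Rightarrow> real \<Rightarrow> (real^2) cmetric \<Rightarrow> (real^4) cmetric \<Rightarrow> (real^2 \<Rightarrow> real^4) \<Rightarrow> real^2 \<Rightarrow> bool" where
  "M0_at c s gM gN h x \<longleftrightarrow>
     gN (h x) (mean_curv gM gN h x) (mean_curv gM gN h x) - (gauss_curv gM x - c)
       = \<bar>normal_curv gM gN h x\<bar> \<and> s * normal_curv gM gN h x \<ge> 0"

definition mixed_field ::
  "real \<Rightarrow> (real^4) cmetric \<Rightarrow> (real^2 \<Rightarrow> real^4) \<Rightarrow>
   (real^2 \<Rightarrow> real^2) \<Rightarrow> (real^2 \<Rightarrow> real^2) \<Rightarrow> real^2 \<Rightarrow> real^4" where
  "mixed_field s gN h e1 e2 x =
     (1/2) *\<^sub>R (sff gN h x (e1 x) (e1 x) - sff gN h x (e2 x) (e2 x))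
     + s *\<^sub>R J_perp gN h x (sff gN h x (e1 x) (e2 x))"

definition mixed_e3 ::
  "real \<Rightarrow> (real^4) cmetric \<Rightarrow> (real^2 \<Rightarrow> real^4) \<Rightarrow>
   (real^2 \<Rightarrow> real^2) \<Rightarrow> (real^2 \<Rightarrow> real^2) \<Rightarrow> real^2 \<Rightarrow> real^4" where
  "mixed_e3 s gN h e1 e2 x =
     mixed_field s gN h e1 e2 x /\<^sub>R
       sqrt (gN (h x) (mixed_field s gN h e1 e2 x) (mixed_field s gN h e1 e2 x))"

definition mixed_e4 ::
  "real \<Rightarrow> (real^4) cmetric \<Rightarrow> (real^2 \<Rightarrow> real^4) \<Rightarrow>
   (real^2 \<Rightarrow> real^2) \<Rightarrow> (real^2 \<Rightarrow> real^2) \<Rightarrow> real^2 \<Rightarrow> real^4" where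
  "mixed_e4 s gN h e1 e2 x = J_perp gN h x (mixed_e3 s gN h e1 e2 x)"

definition normal_conn_form ::
  "(real^4) cmetric \<Rightarrow> (real^2 \<Rightarrow> real^4) \<Rightarrow>
   (real^2 \<Rightarrow> real^4) \<Rightarrow> (real^2 \<Rightarrow> real^4) \<Rightarrow> real^2 \<Rightarrow> real^2 \<Rightarrow> real" where
  "normal_conn_form gN h e3 e4 x v = gN (h x) (normal_conn gN h e3 x v) (e4 x)"


section \<open>Oriented Riemannian manifolds\<close>

text \<open>The underlying manifold is the whole type.  A chart is a domain together with a coordinate
  map.  An orientation is encoded by an atlas all of whose transition maps have positive
  Jacobian determinant.  Tangent vectors at \<open>p\<close> are given by their components in a
  chart around \<open>p\<close>, so tensors are families indexed by charts.\<close>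

type_synonym ('m, 'n) chart = "'m set \<times> ('m \<Rightarrow> real^'n)"

record ('m, 'n) riem =
  atlas :: "('m, 'n) chart set"
  riem_metric :: "('m, 'n) chart \<Rightarrow> (real^'n) cmetric"

definition overlap ::
  "('m, 'n) chart \<Rightarrow> ('q, 'k) chart \<Rightarrow> ('m \<Rightarrow> 'q) \<Rightarrow> (real^'n) set" where
  "overlap \<kappa> \<mu> f = snd \<kappa> ` (fst \<kappa> \<inter> f -` fst \<mu>)"

definition loc_rep ::
  "('m, 'n) chart \<Rightarrow> ('q, 'k) chart \<Rightarrow> ('m \<Rightarrow> 'q) \<Rightarrow> real^'n \<Rightarrow> real^'k" where
  "loc_rep \<kappa> \<mu> f = snd \<mu> \<circ> f \<circ> inv_into (fst \<kappa>) (snd \<kappa>)"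

definition oriented_atlas ::
  "('m::topological_space, 'n::finite) chart set \<Rightarrow> bool" where
  "oriented_atlas A \<longleftrightarrow>
     \<Union> (fst ` A) = UNIV \<and>
     (\<forall>(U, \<phi>)\<in>A. open U \<and> open (\<phi> ` U) \<and> homeomorphism U (\<phi> ` U) \<phi> (inv_into U \<phi>)) \<and>
     (\<forall>\<kappa>\<in>A. \<forall>\<mu>\<in>A. smooth_on (overlap \<kappa> \<mu> id) (loc_rep \<kappa> \<mu> id) \<and>
        (\<forall>x\<in>overlap \<kappa> \<mu> id. det (matrix (dd (loc_rep \<kappa> \<mu> id) x)) > 0))"

definition oriented_riemannian ::
  "('m::{t2_space,second_countable_topology}, 'n::finite) riem \<Rightarrow> bool" where
  "oriented_riemannian M \<longleftrightarrow> oriented_atlas (atlas M) \<and>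
     (\<forall>\<kappa>\<in>atlas M. \<forall>x\<in>snd \<kappa> ` fst \<kappa>.
        bilinear (riem_metric M \<kappa> x) \<and>
        (\<forall>u v. riem_metric M \<kappa> x u v = riem_metric M \<kappa> x v u) \<and>
        (\<forall>u. u \<noteq> 0 \<longrightarrow> riem_metric M \<kappa> x u u > 0)) \<and>
     (\<forall>\<kappa>\<in>atlas M. \<forall>u v. smooth_on (snd \<kappa> ` fst \<kappa>) (\<lambda>x. riem_metric M \<kappa> x u v)) \<and>
     (\<forall>\<kappa>\<in>atlas M. \<forall>\<mu>\<in>atlas M. \<forall>x\<in>overlap \<kappa> \<mu> id. \<forall>u v.
        riem_metric M \<kappa> x u v =
        riem_metric M \<mu> (loc_rep \<kappa> \<mu> id x) (dd (loc_rep \<kappa> \<mu> id) x u) (dd (loc_rep \<kappa> \<mu> id) x v))"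

definition complete_geodesic ::
  "('m::topological_space, 'n::finite) riem \<Rightarrow> (real \<Rightarrow> 'm) \<Rightarrow> bool" where
  "complete_geodesic M \<gamma> \<longleftrightarrow> continuous_on UNIV \<gamma> \<and>
     (\<forall>\<kappa>\<in>atlas M. smooth_on (\<gamma> -` fst \<kappa>) (snd \<kappa> \<circ> \<gamma>) \<and>
        (\<forall>t\<in>\<gamma> -` fst \<kappa>.
           cov_deriv (riem_metric M \<kappa>) (snd \<kappa> \<circ> \<gamma>) (\<lambda>s. dd (snd \<kappa> \<circ> \<gamma>) s 1) t 1 = 0))"

definition geodesically_complete ::
  "('m::topological_space, 'n::finite) riem \<Rightarrow> bool" where
  "geodesically_complete M \<longleftrightarrow> (\<forall>\<kappa>\<in>atlas M. \<forall>p\<in>fst \<kappa>. \<forall>v.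
     \<exists>\<gamma>. complete_geodesic M \<gamma> \<and> \<gamma> 0 = p \<and> dd (snd \<kappa> \<circ> \<gamma>) 0 1 = v)"

definition constant_curvature ::
  "real \<Rightarrow> ('m, 'n::finite) riem \<Rightarrow> bool" where
  "constant_curvature c M \<longleftrightarrow> (\<forall>\<kappa>\<in>atlas M. \<forall>x\<in>snd \<kappa> ` fst \<kappa>. \<forall>u v.
     u \<noteq> v \<and> independent {u, v} \<longrightarrow> sec_curv (riem_metric M \<kappa>) x u v = c)"

text \<open>\<open>Q\<close> is a copy of \<open>\<rat>\<^sup>n\<^sub>c\<close> with \<open>n = CARD('n)\<close> (in the library,
  \<open>simply_connected\<close> includes path-connected).\<close>

definition space_form ::
  "real \<Rightarrow> ('m::{t2_space,second_countable_topology}, 'n::finite) riem \<Rightarrow> bool" where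
  "space_form c Q \<longleftrightarrow> oriented_riemannian Q \<and> simply_connected (UNIV :: 'm set) \<and>
     geodesically_complete Q \<and> constant_curvature c Q"


subsection \<open>Isometric immersions\<close>

text \<open>Preservation of the metric forces the differential to be injective.\<close>

definition isometric_immersion ::
  "('m::topological_space, 'n::finite) riem \<Rightarrow> ('q::topological_space, 'k::finite) riem \<Rightarrow>
   ('m \<Rightarrow> 'q) \<Rightarrow> bool" where
  "isometric_immersion M N f \<longleftrightarrow> continuous_on UNIV f \<and>
     (\<forall>\<kappa>\<in>atlas M. \<forall>\<mu>\<in>atlas N. smooth_on (overlap \<kappa> \<mu> f) (loc_rep \<kappa> \<mu> f) \<and>
        (\<forall>x\<in>overlap \<kappa> \<mu> f. \<forall>u v.
           riem_metric M \<kappa> x u v =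
           riem_metric N \<mu> (loc_rep \<kappa> \<mu> f x) (dd (loc_rep \<kappa> \<mu> f) x u) (dd (loc_rep \<kappa> \<mu> f) x v)))"

definition umbilic_free ::
  "('m, 'n::finite) riem \<Rightarrow> ('q, 'k::finite) riem \<Rightarrow> ('m \<Rightarrow> 'q) \<Rightarrow> bool" where
  "umbilic_free M N f \<longleftrightarrow> (\<forall>\<kappa>\<in>atlas M. \<forall>\<mu>\<in>atlas N. \<forall>x\<in>overlap \<kappa> \<mu> f.
     \<not> umbilic_at (riem_metric M \<kappa>) (riem_metric N \<mu>) (loc_rep \<kappa> \<mu> f) x)"

definition totally_umbilical ::
  "('m, 'n::finite) riem \<Rightarrow> ('q, 'k::finite) riem \<Rightarrow> ('m \<Rightarrow> 'q) \<Rightarrow> bool" where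
  "totally_umbilical M N f \<longleftrightarrow> (\<forall>\<kappa>\<in>atlas M. \<forall>\<mu>\<in>atlas N. \<forall>x\<in>overlap \<kappa> \<mu> f.
     umbilic_at (riem_metric M \<kappa>) (riem_metric N \<mu>) (loc_rep \<kappa> \<mu> f) x)"


subsection \<open>Principal and mixed connection forms\<close>

text \<open>A 1-form takes a chart, a point of its domain and the components of a tangent vector.
  Both forms below are the common value given by all admissible local frames and all
  charts of the ambient space.\<close>

definition principal_conn_form ::
  "('m, 2) riem \<Rightarrow> ('q, 3) riem \<Rightarrow> ('m \<Rightarrow> 'q) \<Rightarrow> ('m, 2) chart \<Rightarrow> 'm \<Rightarrow> real^2 \<Rightarrow> real" where
  "principal_conn_form M N F \<kappa> p v = (THE r. \<forall>\<mu>\<in>atlas N. \<forall>W e1 e2.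
     W \<subseteq> overlap \<kappa> \<mu> F \<and> snd \<kappa> p \<in> W \<and>
     principal_frame (riem_metric M \<kappa>) (riem_metric N \<mu>) (loc_rep \<kappa> \<mu> F) W e1 e2 \<longrightarrow>
     r = conn_form (riem_metric M \<kappa>) e1 e2 (snd \<kappa> p) v)"

definition M0 ::
  "real \<Rightarrow> real \<Rightarrow> ('m, 2) riem \<Rightarrow> ('q, 4) riem \<Rightarrow> ('m \<Rightarrow> 'q) \<Rightarrow> 'm set" where
  "M0 c s M N f = {p. \<exists>\<kappa>\<in>atlas M. \<exists>\<mu>\<in>atlas N. p \<in> fst \<kappa> \<and> f p \<in> fst \<mu> \<and>
     M0_at c s (riem_metric M \<kappa>) (riem_metric N \<mu>) (loc_rep \<kappa> \<mu> f) (snd \<kappa> p)}"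

text \<open>Only meaningful for \<open>p \<notin> M0 c s M N f\<close>, as frames are only used off that set.\<close>

definition mixed_conn_form ::
  "real \<Rightarrow> real \<Rightarrow> ('m, 2) riem \<Rightarrow> ('q, 4) riem \<Rightarrow> ('m \<Rightarrow> 'q) \<Rightarrow>
   ('m, 2) chart \<Rightarrow> 'm \<Rightarrow> real^2 \<Rightarrow> real" where
  "mixed_conn_form c s M N f \<kappa> p v = (THE r. \<forall>\<mu>\<in>atlas N. \<forall>W e1 e2.
     W \<subseteq> overlap \<kappa> \<mu> f \<and> W \<inter> snd \<kappa> ` (fst \<kappa> \<inter> M0 c s M N f) = {} \<and> snd \<kappa> p \<in> W \<and>
     pos_frame (riem_metric M \<kappa>) W e1 e2 \<longrightarrow>
     r = 2 * conn_form (riem_metric M \<kappa>) e1 e2 (snd \<kappa> p) v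
       + s * normal_conn_form (riem_metric N \<mu>) (loc_rep \<kappa> \<mu> f)
           (mixed_e3 s (riem_metric N \<mu>) (loc_rep \<kappa> \<mu> f) e1 e2)
           (mixed_e4 s (riem_metric N \<mu>) (loc_rep \<kappa> \<mu> f) e1 e2) (snd \<kappa> p) v)"

end

theory Submission
  imports Defs
begin

text \<open>Let \<open>\<nu>\<close> be the image under \<open>j\<close> of the unit normal of \<open>F\<close>, and \<open>\<zeta>\<close> the unit normal of \<open>f\<close> completing \<open>\<nu>\<close> to
  a positive frame.  Since \<open>j\<close> is umbilical, \<open>\<nu>\<close> and hence \<open>\<zeta>\<close> are parallel in the normal bundle, and
  \<open>\<alpha> = II \<cdot> \<nu> + g \<cdot> \<eta>\<close> with \<open>\<eta>\<close> orthogonal to \<open>\<nu>\<close>.  For a frame put \<open>p = (II\<^sub>1\<^sub>1 - II\<^sub>2\<^sub>2)/2\<close>, \<open>q = II\<^sub>1\<^sub>2\<close>.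
  Then \<open>K\<^sub>N = 0\<close> and, by the Gauss equation, \<open>\<parallel>H\<parallel>\<^sup>2 - (K - c) = p\<^sup>2 + q\<^sup>2 > 0\<close>, so \<open>M\<^sub>0\<close> is empty.  The normalized field is
  \<open>e\<^sub>3 = (p \<nu> \<plusminus> q \<zeta>)/|p + iq|\<close>, so \<open>\<plusminus>\<omega>\<^sub>3\<^sub>4 = (p dq - q dp)/(p\<^sup>2 + q\<^sup>2)\<close> for both signs.  Comparing with a principal
  frame, where \<open>q = 0\<close>, gives \<open>\<Omega>\<^sup>\<plusminus> = 2\<Omega>\<close>.  Only one chart of \<open>M\<close> is involved at a time, and the identity, valid for
  every pair of charts of the two ambient spaces, already forces independence of those charts: no
  coordinate changes are needed.\<close>

section \<open>Smooth maps\<close>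

text \<open>The obstacle is that the geometric notions are definite descriptions and Frechet
  derivatives, which mean nothing until existence, uniqueness and differentiability are shown. Hence
  Christoffel symbols, unit normals and the normal partner \<open>\<zeta>\<close> are obtained as
  smooth solutions of nondegenerate linear systems, and the descriptions are then identified with
  these solutions. No angle function is ever chosen: a rotation is a pair (a, b) with a^2 + b^2 = 1,
  its differential is a db - b da, and (p dq - q dp) / (p^2 + q^2) is the differential of the
  argument of p + iq. The factor 2 in the claim reflects that p + iq, the trace-free part of a
  quadratic form, turns twice as fast as the frame. The sign drops out because the component along
  \<open>\<zeta>\<close> and the factor in front of the normal connection form each carry it once. A
  principal frame must moreover exist near every point, since otherwise the description of
  \<open>principal_conn_form\<close> would not determine a value.\<close>

lemma dd_eqI: "(f has_derivative f') (at x) \<Longrightarrow> dd f x = f'"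
  by (rule frechet_derivative_at[symmetric])

lemma dd_works: "f differentiable (at x) \<Longrightarrow> (f has_derivative dd f x) (at x)"
  by (simp add: frechet_derivative_works)

text \<open>Agreement near \<open>x\<close> gives both maps the same set of derivatives, so the
  choice operator inside \<open>frechet_derivative\<close> picks the same one, also when that set is
  empty.\<close>

lemma dd_cong:
  assumes "open S" "x \<in> S" "\<And>y. y \<in> S \<Longrightarrow> f y = g y"
  shows "dd f x = dd g x"
proof -
  have "(f has_derivative F) (at x) \<longleftrightarrow> (g has_derivative F) (at x)" for F
    using has_derivative_transform_within_open[of f F x UNIV S g]
      has_derivative_transform_within_open[of g F x UNIV S f] assms by auto
  then show ?thesis unfolding frechet_derivative_def by simp
qed

lemma differentiable_cong_open:
  assumes "open S" "x \<in> S" "\<And>y. y \<in> S \<Longrightarrow> f y = g y" "f differentiable (at x)"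
  shows "g differentiable (at x)"
  using assms unfolding differentiable_def by (metis has_derivative_transform_within_open)

section \<open>Closure of the classes C^k under sums, products, reciprocals, roots and
  composition\<close>

lemma Ck_on_cong:
  assumes "open S" "\<And>x. x \<in> S \<Longrightarrow> f x = g x" "Ck_on k S f"
  shows "Ck_on k S g"
  using assms(2,3)
proof (induction k arbitrary: f g)
  case 0
  then show ?case by (simp cong: continuous_on_cong)
next
  case (Suc k)
  show ?case unfolding Ck_on.simps
  proof (intro conjI ballI allI)
    fix x assume "x \<in> S"
    then show "g differentiable (at x)"
      using differentiable_cong_open[OF assms(1), of x f g] Suc.prems by auto
  next
    fix v
    show "Ck_on k S (\<lambda>x. dd g x v)"
    proof (rule Suc.IH[of "\<lambda>x. dd f x v"])
      show "dd f x v = dd g x v" if "x \<in> S" for x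
        using dd_cong[OF assms(1) that, of f g] Suc.prems by auto
    qed (use Suc.prems in auto)
  qed
qed

lemma Ck_on_SucD: "Ck_on (Suc k) S f \<Longrightarrow> Ck_on k S f"
proof (induction k arbitrary: f)
  case 0
  then show ?case
    by (auto intro!: continuous_at_imp_continuous_on differentiable_imp_continuous_within)
next
  case (Suc k)
  from Suc.prems have "\<forall>x\<in>S. f differentiable (at x)" "\<forall>v. Ck_on (Suc k) S (\<lambda>x. dd f x v)"
    by (auto simp only: Ck_on.simps(2)[of "Suc k"])
  then show ?case using Suc.IH by (simp only: Ck_on.simps(2)) blast
qed

lemma Ck_on_subset: "Ck_on k S f \<Longrightarrow> T \<subseteq> S \<Longrightarrow> Ck_on k T f"
  by (induction k arbitrary: f) (auto intro: continuous_on_subset)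

lemma Ck_on_const: "Ck_on k S (\<lambda>x. c)"
  by (induction k arbitrary: c) auto

lemma Ck_on_id: "Ck_on k S (\<lambda>x. x)"
  by (cases k) (auto simp: Ck_on_const)

lemma Ck_on_bounded_linear:
  assumes "bounded_linear L" "open S" "Ck_on k S f"
  shows "Ck_on k S (\<lambda>x. L (f x))"
  using assms(3)
proof (induction k arbitrary: f)
  case 0
  then show ?case
    using bounded_linear.continuous_on[OF assms(1)] by simp
next
  case (Suc k)
  have der: "((\<lambda>x. L (f x)) has_derivative (\<lambda>v. L (dd f x v))) (at x)" if "x \<in> S" for x
    by (rule bounded_linear.has_derivative[OF assms(1) dd_works]) (use Suc.prems that in auto)
  show ?case unfolding Ck_on.simps
  proof (intro conjI ballI allI)
    show "(\<lambda>x. L (f x)) differentiable (at x)" if "x \<in> S" for x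
      using der[OF that] differentiableI by blast
    show "Ck_on k S (\<lambda>x. dd (\<lambda>x. L (f x)) x v)" for v
      by (rule Ck_on_cong[OF assms(2) _ Suc.IH[of "\<lambda>x. dd f x v"]])
        (use Suc.prems in \<open>auto simp: dd_eqI[OF der]\<close>)
  qed
qed

lemma Ck_on_add:
  assumes "open S" "Ck_on k S f" "Ck_on k S g"
  shows "Ck_on k S (\<lambda>x. f x + g x)"
  using assms(2,3)
proof (induction k arbitrary: f g)
  case 0
  then show ?case by (simp add: continuous_on_add)
next
  case (Suc k)
  have der: "((\<lambda>x. f x + g x) has_derivative (\<lambda>v. dd f x v + dd g x v)) (at x)" if "x \<in> S" for x
    by (rule has_derivative_add[OF dd_works dd_works]) (use Suc.prems that in auto)
  show ?case unfolding Ck_on.simps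
  proof (intro conjI ballI allI)
    show "(\<lambda>x. f x + g x) differentiable (at x)" if "x \<in> S" for x
      using der[OF that] differentiableI by blast
    show "Ck_on k S (\<lambda>x. dd (\<lambda>x. f x + g x) x v)" for v
      by (rule Ck_on_cong[OF assms(1) _ Suc.IH[of "\<lambda>x. dd f x v" "\<lambda>x. dd g x v"]])
        (use Suc.prems in \<open>auto simp: dd_eqI[OF der]\<close>)
  qed
qed

text \<open>One Leibniz rule for products, scalar multiples and inner products. The undifferentiated
  factor of each summand must be of class k as well, which is where \<open>Ck_on_SucD\<close> comes
  in.\<close>

lemma Ck_on_bilinear:
  assumes "bounded_bilinear pr" "open S" "Ck_on k S f" "Ck_on k S g"
  shows "Ck_on k S (\<lambda>x. pr (f x) (g x))"
  using assms(3,4)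
proof (induction k arbitrary: f g)
  case 0
  then show ?case using bounded_bilinear.continuous_on[OF assms(1)] by simp
next
  case (Suc k)
  have der: "((\<lambda>x. pr (f x) (g x)) has_derivative (\<lambda>v. pr (f x) (dd g x v) + pr (dd f x v) (g x))) (at x)"
    if "x \<in> S" for x
    by (rule bounded_bilinear.FDERIV[OF assms(1) dd_works dd_works]) (use Suc.prems that in auto)
  show ?case unfolding Ck_on.simps
  proof (intro conjI ballI allI)
    show "(\<lambda>x. pr (f x) (g x)) differentiable (at x)" if "x \<in> S" for x
      using der[OF that] differentiableI by blast
    have "Ck_on k S (\<lambda>x. pr (f x) (dd g x v) + pr (dd f x v) (g x))" for v
      using Suc.prems Ck_on_SucD[OF Suc.prems(1)] Ck_on_SucD[OF Suc.prems(2)]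
      by (intro Ck_on_add assms Suc.IH) auto
    then show "Ck_on k S (\<lambda>x. dd (\<lambda>x. pr (f x) (g x)) x v)" for v
      by (rule Ck_on_cong[OF assms(2), rotated]) (auto simp: dd_eqI[OF der])
  qed
qed

text \<open>The derivative of 1/f contains 1/f again, so the induction bootstraps: class k of the
  reciprocal, together with class k of the derivative of \<open>f\<close>, gives class k +
  1.\<close>

lemma Ck_on_inverse:
  fixes f :: "'a::real_normed_vector \<Rightarrow> real"
  assumes "open S" "\<And>x. x \<in> S \<Longrightarrow> f x \<noteq> 0" "Ck_on k S f"
  shows "Ck_on k S (\<lambda>x. inverse (f x))"
  using assms(3)
proof (induction k)
  case 0
  then show ?case using assms(2) by (simp add: continuous_on_inverse)
next
  case (Suc k)
  have der: "((\<lambda>x. inverse (f x)) has_derivative (\<lambda>v. - (inverse (f x) * dd f x v * inverse (f x)))) (at x)"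
    if "x \<in> S" for x
    by (rule Deriv.has_derivative_inverse[OF _ dd_works]) (use Suc.prems that assms(2) in auto)
  have 1: "Ck_on k S (\<lambda>x. inverse (f x))" by (rule Suc.IH[OF Ck_on_SucD[OF Suc.prems]])
  show ?case unfolding Ck_on.simps
  proof (intro conjI ballI allI)
    show "(\<lambda>x. inverse (f x)) differentiable (at x)" if "x \<in> S" for x
      using der[OF that] differentiableI by blast
    have "Ck_on k S (\<lambda>x. - (inverse (f x) * dd f x v * inverse (f x)))" for v
      using Suc.prems
      by (intro Ck_on_bounded_linear[OF bounded_linear_minus[OF bounded_linear_ident]]
          Ck_on_bilinear[OF bounded_bilinear_mult] 1 assms(1)) auto
    then show "Ck_on k S (\<lambda>x. dd (\<lambda>x. inverse (f x)) x v)" for v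
      by (rule Ck_on_cong[OF assms(1), rotated]) (auto simp: dd_eqI[OF der])
  qed
qed

lemma Ck_on_sqrt:
  fixes f :: "'a::real_normed_vector \<Rightarrow> real"
  assumes "open S" "\<And>x. x \<in> S \<Longrightarrow> f x > 0" "Ck_on k S f"
  shows "Ck_on k S (\<lambda>x. sqrt (f x))"
  using assms(3)
proof (induction k)
  case 0
  then show ?case by (simp add: continuous_on_real_sqrt)
next
  case (Suc k)
  have half: "inverse (sqrt y) / 2 = inverse (2 * sqrt y)" for y
    by (simp add: field_simps)
  have der: "((\<lambda>x. sqrt (f x)) has_derivative (\<lambda>v. inverse (2 * sqrt (f x)) * dd f x v)) (at x)"
    if "x \<in> S" for x
  proof -
    have 1: "(f has_derivative dd f x) (at x)"
      using Suc.prems that by (simp add: dd_works)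
    have 2: "(sqrt has_derivative (\<lambda>t. inverse (2 * sqrt (f x)) * t)) (at (f x))"
      using DERIV_real_sqrt[OF assms(2)[OF that]] by (simp only: has_field_derivative_def half)
    show ?thesis by (rule has_derivative_compose[OF 1 2])
  qed
  have 1: "Ck_on k S (\<lambda>x. sqrt (f x))" by (rule Suc.IH[OF Ck_on_SucD[OF Suc.prems]])
  have 2: "Ck_on k S (\<lambda>x. 2 * sqrt (f x))"
    by (rule Ck_on_bilinear[OF bounded_bilinear_mult assms(1) Ck_on_const 1])
  have 3: "Ck_on k S (\<lambda>x. inverse (2 * sqrt (f x)))"
    using assms(2) by (intro Ck_on_inverse[OF assms(1) _ 2]) (simp add: less_imp_neq[THEN not_sym])
  show ?case unfolding Ck_on.simps
  proof (intro conjI ballI allI)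
    show "(\<lambda>x. sqrt (f x)) differentiable (at x)" if "x \<in> S" for x
      using der[OF that] differentiableI by blast
    have "Ck_on k S (\<lambda>x. inverse (2 * sqrt (f x)) * dd f x v)" for v
      using Suc.prems by (intro Ck_on_bilinear[OF bounded_bilinear_mult assms(1) 3]) auto
    then show "Ck_on k S (\<lambda>x. dd (\<lambda>x. sqrt (f x)) x v)" for v
      by (rule Ck_on_cong[OF assms(1), rotated]) (auto simp: dd_eqI[OF der])
  qed
qed

lemma Ck_on_sum:
  assumes "open S" "\<And>i. i \<in> I \<Longrightarrow> Ck_on k S (f i)"
  shows "Ck_on k S (\<lambda>x. \<Sum>i\<in>I. f i x)"
  using assms(2)
  by (induction I rule: infinite_finite_induct) (auto intro: Ck_on_const Ck_on_add[OF assms(1)])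

lemma linear_expand:
  fixes L :: "'a::euclidean_space \<Rightarrow> 'b::real_vector"
  assumes "linear L"
  shows "L v = (\<Sum>b\<in>Basis. (v \<bullet> b) *\<^sub>R L b)"
  by (metis (no_types, lifting) assms euclidean_representation linear_cmul linear_sum sum.cong)

text \<open>The chain rule applies \<open>dd h (f x)\<close> to a vector that itself depends on
  \<open>x\<close>. Expanding this vector in a basis leaves derivatives of \<open>h\<close> in fixed
  directions, to which the induction hypothesis applies; hence the generalization over
  \<open>h\<close> and the Euclidean middle space.\<close>

lemma Ck_on_compose:
  fixes f :: "'a::real_normed_vector \<Rightarrow> 'e::euclidean_space"
  assumes "open S" "open T" "f ` S \<subseteq> T" "Ck_on k S f" "Ck_on k T h"
  shows "Ck_on k S (\<lambda>x. h (f x))"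
  using assms(4,5)
proof (induction k arbitrary: h)
  case 0
  then show ?case
    using assms(3) continuous_on_compose2 by (metis Ck_on.simps(1))
next
  case (Suc k)
  have der: "((\<lambda>x. h (f x)) has_derivative (\<lambda>v. dd h (f x) (dd f x v))) (at x)" if "x \<in> S" for x
    by (rule has_derivative_compose[OF dd_works dd_works]) (use Suc.prems that assms(3) in auto)
  have lin: "linear (dd h (f x))" if "x \<in> S" for x
    using Suc.prems that assms(3) by (auto intro!: linear_frechet_derivative)
  show ?case unfolding Ck_on.simps
  proof (intro conjI ballI allI)
    show "(\<lambda>x. h (f x)) differentiable (at x)" if "x \<in> S" for x
      using der[OF that] differentiableI by blast
    have "Ck_on k S (\<lambda>x. \<Sum>b\<in>Basis. (dd f x v \<bullet> b) *\<^sub>R dd h (f x) b)" for v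
      using Suc.prems Ck_on_SucD[OF Suc.prems(1)]
      by (intro Ck_on_sum Ck_on_bilinear[OF bounded_bilinear_scaleR] assms
          Ck_on_bounded_linear[OF bounded_linear_inner_left] Suc.IH) auto
    then show "Ck_on k S (\<lambda>x. dd (\<lambda>x. h (f x)) x v)" for v
      by (rule Ck_on_cong[OF assms(1), rotated])
        (use lin in \<open>auto simp: dd_eqI[OF der] linear_expand[symmetric]\<close>)
  qed
qed

section \<open>Calculus of smooth maps, inherited from all classes C^k\<close>

lemma smooth_on_cong: "open S \<Longrightarrow> (\<And>x. x \<in> S \<Longrightarrow> f x = g x) \<Longrightarrow> smooth_on S f \<Longrightarrow> smooth_on S g"
  unfolding smooth_on_def using Ck_on_cong by blast

lemma smooth_on_subset: "smooth_on S f \<Longrightarrow> T \<subseteq> S \<Longrightarrow> smooth_on T f"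
  unfolding smooth_on_def using Ck_on_subset by blast

lemma smooth_on_differentiable: "smooth_on S f \<Longrightarrow> x \<in> S \<Longrightarrow> f differentiable (at x)"
  unfolding smooth_on_def by (metis Ck_on.simps(2))

lemma smooth_on_dd_works: "smooth_on S f \<Longrightarrow> x \<in> S \<Longrightarrow> (f has_derivative dd f x) (at x)"
  by (simp add: dd_works smooth_on_differentiable)

lemma smooth_on_linear_dd: "smooth_on S f \<Longrightarrow> x \<in> S \<Longrightarrow> linear (dd f x)"
  by (simp add: linear_frechet_derivative smooth_on_differentiable)

lemma smooth_on_continuous: "smooth_on S f \<Longrightarrow> continuous_on S f"
  unfolding smooth_on_def by (metis Ck_on.simps(1))

lemma smooth_on_dd: "smooth_on S f \<Longrightarrow> smooth_on S (\<lambda>x. dd f x v)"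
  unfolding smooth_on_def by (metis Ck_on.simps(2))

lemma smooth_on_const: "smooth_on S (\<lambda>x. c)"
  and smooth_on_id: "smooth_on S (\<lambda>x. x)"
  by (simp_all add: smooth_on_def Ck_on_const Ck_on_id)

context
  fixes S :: "'a::real_normed_vector set"
  assumes S: "open S"
begin

lemma smooth_on_bounded_linear: "bounded_linear L \<Longrightarrow> smooth_on S f \<Longrightarrow> smooth_on S (\<lambda>x. L (f x))"
  and smooth_on_add: "smooth_on S f \<Longrightarrow> smooth_on S h \<Longrightarrow> smooth_on S (\<lambda>x. f x + h x)"
  and smooth_on_bilinear: "bounded_bilinear pr \<Longrightarrow> smooth_on S a \<Longrightarrow> smooth_on S b \<Longrightarrow>
    smooth_on S (\<lambda>x. pr (a x) (b x))"
  and smooth_on_inverse: "smooth_on S r \<Longrightarrow> (\<And>x. x \<in> S \<Longrightarrow> r x \<noteq> 0) \<Longrightarrow> smooth_on S (\<lambda>x. inverse (r x :: real))"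
  and smooth_on_sqrt: "smooth_on S r \<Longrightarrow> (\<And>x. x \<in> S \<Longrightarrow> r x > 0) \<Longrightarrow> smooth_on S (\<lambda>x. sqrt (r x))"
  and smooth_on_sum: "(\<And>i. i \<in> I \<Longrightarrow> smooth_on S (k i)) \<Longrightarrow> smooth_on S (\<lambda>x. \<Sum>i\<in>I. k i x)"
  by (simp_all add: smooth_on_def Ck_on_bounded_linear Ck_on_add Ck_on_bilinear Ck_on_inverse
      Ck_on_sqrt Ck_on_sum S)

lemma smooth_on_minus: "smooth_on S f \<Longrightarrow> smooth_on S (\<lambda>x. - f x)"
  by (rule smooth_on_bounded_linear[OF bounded_linear_minus[OF bounded_linear_ident]])

lemma smooth_on_diff: "smooth_on S f \<Longrightarrow> smooth_on S h \<Longrightarrow> smooth_on S (\<lambda>x. f x - h x)"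
  using smooth_on_add[of f "\<lambda>x. - h x"] smooth_on_minus[of h] by simp

lemma smooth_on_mult: "smooth_on S f \<Longrightarrow> smooth_on S h \<Longrightarrow> smooth_on S (\<lambda>x. f x * h x :: real)"
  by (rule smooth_on_bilinear[OF bounded_bilinear_mult])

lemma smooth_on_scaleR: "smooth_on S f \<Longrightarrow> smooth_on S h \<Longrightarrow> smooth_on S (\<lambda>x. f x *\<^sub>R h x)"
  by (rule smooth_on_bilinear[OF bounded_bilinear_scaleR])

lemma smooth_on_divide:
  "smooth_on S f \<Longrightarrow> smooth_on S h \<Longrightarrow> (\<And>x. x \<in> S \<Longrightarrow> h x \<noteq> 0) \<Longrightarrow> smooth_on S (\<lambda>x. f x / h x :: real)"
  unfolding divide_inverse by (intro smooth_on_mult smooth_on_inverse)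

lemma smooth_on_power: "smooth_on S f \<Longrightarrow> smooth_on S (\<lambda>x. f x ^ n :: real)"
  by (induction n) (auto intro: smooth_on_const smooth_on_mult)

lemma smooth_on_prod:
  "(\<And>i. i \<in> I \<Longrightarrow> smooth_on S (f i)) \<Longrightarrow> smooth_on S (\<lambda>x. \<Prod>i\<in>I. f i x :: real)"
  by (induction I rule: infinite_finite_induct) (auto intro: smooth_on_const smooth_on_mult)

lemma smooth_on_vec_nth: "smooth_on S f \<Longrightarrow> smooth_on S (\<lambda>x. f x $ i)"
  by (rule smooth_on_bounded_linear[OF bounded_linear_vec_nth])

lemma smooth_on_inner: "smooth_on S f \<Longrightarrow> smooth_on S h \<Longrightarrow> smooth_on S (\<lambda>x. f x \<bullet> h x)"
  by (rule smooth_on_bilinear[OF bounded_bilinear_inner])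

lemma smooth_on_vec_lambda:
  fixes f :: "'a \<Rightarrow> 'n::finite \<Rightarrow> real"
  assumes "\<And>i. smooth_on S (\<lambda>x. f x i)"
  shows "smooth_on S (\<lambda>x. \<chi> i. f x i)"
proof (rule smooth_on_cong[OF S])
  show "smooth_on S (\<lambda>x. \<Sum>i\<in>UNIV. f x i *\<^sub>R axis i (1::real))"
    by (rule smooth_on_sum, rule smooth_on_scaleR[OF assms smooth_on_const])
  show "(\<Sum>i\<in>UNIV. f x i *\<^sub>R axis i 1) = (\<chi> i. f x i)" for x
    using basis_expansion[of "\<chi> i. f x i"] by (simp add: scalar_mult_eq_scaleR)
qed

lemma smooth_on_det:
  fixes A :: "'a \<Rightarrow> real^'n^'n"
  assumes "\<And>i k. smooth_on S (\<lambda>x. A x $ i $ k)"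
  shows "smooth_on S (\<lambda>x. det (A x))"
  unfolding det_def by (intro smooth_on_sum smooth_on_mult smooth_on_const smooth_on_prod assms)

lemma smooth_on_compose:
  fixes f :: "'a \<Rightarrow> 'e::euclidean_space"
  assumes "open T" "f ` S \<subseteq> T" "smooth_on S f" "smooth_on T h"
  shows "smooth_on S (\<lambda>x. h (f x))"
  using assms(3,4) Ck_on_compose[OF S assms(1,2)] unfolding smooth_on_def by blast

lemma smooth_on_dd_compose:
  fixes f :: "'a \<Rightarrow> 'e::euclidean_space"
  assumes "open T" "f ` S \<subseteq> T" "smooth_on S f" "smooth_on T h" "smooth_on S V"
  shows "smooth_on S (\<lambda>x. dd h (f x) (V x))"
proof (rule smooth_on_cong[OF S])
  show "smooth_on S (\<lambda>x. \<Sum>b\<in>Basis. (V x \<bullet> b) *\<^sub>R dd h (f x) b)"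
    by (rule smooth_on_sum, rule smooth_on_scaleR[OF smooth_on_inner[OF assms(5) smooth_on_const]
          smooth_on_compose[OF assms(1,2,3) smooth_on_dd[OF assms(4)]]])
  show "(\<Sum>b\<in>Basis. (V x \<bullet> b) *\<^sub>R dd h (f x) b) = dd h (f x) (V x)" if "x \<in> S" for x
    using assms(2,4) that smooth_on_linear_dd[of T h "f x"] linear_expand by (metis image_subset_iff)
qed

end

text \<open>Riesz representation with smooth dependence on the point: positivity makes the Gram
  matrix invertible, and Cramer's rule writes the representing vector as a quotient of determinants
  with smooth entries. Christoffel symbols and normal fields are obtained from it.\<close>

lemma smooth_riesz:
  fixes A :: "'a::real_normed_vector \<Rightarrow> real^'n \<Rightarrow> real^'n \<Rightarrow> real"
  assumes S: "open S"
    and bil: "\<And>x. x \<in> S \<Longrightarrow> bilinear (A x)"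
    and pos: "\<And>x u. x \<in> S \<Longrightarrow> u \<noteq> 0 \<Longrightarrow> A x u u > 0"
    and sA: "\<And>u v. smooth_on S (\<lambda>x. A x u v)"
    and lin: "\<And>x. x \<in> S \<Longrightarrow> linear (L x)"
    and sL: "\<And>z. smooth_on S (\<lambda>x. L x z)"
  shows "\<exists>w. smooth_on S w \<and> (\<forall>x\<in>S. \<forall>z. A x (w x) z = L x z)"
proof -
  define G where "G x = (\<chi> i j. A x (axis j 1) (axis i 1))" for x
  define b where "b x = (\<chi> i. L x (axis i 1))" for x
  define w where "w x = (\<chi> k. det (\<chi> i j. if j = k then b x $ i else G x $ i $ j) / det (G x))" for x
  have Gv: "(G x *v u) $ i = A x u (axis i 1)" if "x \<in> S" for x u i
  proof -
    have "linear (\<lambda>u. A x u (axis i 1))" using bil[OF that] by (simp add: bilinear_def)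
    then have "A x (\<Sum>j\<in>UNIV. u $ j *\<^sub>R axis j 1) (axis i 1) = (\<Sum>j\<in>UNIV. u $ j *\<^sub>R A x (axis j 1) (axis i 1))"
      using linear_sum[of "\<lambda>u. A x u (axis i 1)" "\<lambda>j. u $ j *\<^sub>R axis j 1" UNIV]
        linear_cmul[of "\<lambda>u. A x u (axis i 1)"] by simp
    moreover have "(\<Sum>j\<in>UNIV. u $ j *\<^sub>R axis j 1) = u"
      using basis_expansion[of u] by (simp add: scalar_mult_eq_scaleR)
    ultimately show ?thesis
      by (simp add: G_def matrix_vector_mult_def mult.commute)
  qed
  have ext: "L1 z = L2 z" if "linear L1" "linear L2" "\<And>i. L1 (axis i 1) = L2 (axis i 1)"
    for L1 L2 :: "real^'n \<Rightarrow> real" and z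
  proof (rule linear_eq_on_span[OF that(1,2), of Basis])
    show "L1 b = L2 b" if "b \<in> Basis" for b
      using that \<open>\<And>i. L1 (axis i 1) = L2 (axis i 1)\<close> by (auto simp: Basis_vec_def)
  qed simp
  have det: "det (G x) \<noteq> 0" if "x \<in> S" for x
  proof -
    have "u = 0" if "G x *v u = 0" for u
    proof (rule ccontr)
      assume "u \<noteq> 0"
      have "A x u (axis i 1) = 0" for i using Gv[OF \<open>x \<in> S\<close>, of u i] that by simp
      then have "A x u u = 0"
        using bil[OF \<open>x \<in> S\<close>] ext[of "A x u" "\<lambda>z. 0" u] by (simp add: bilinear_def linear_zero)
      with pos[OF \<open>x \<in> S\<close> \<open>u \<noteq> 0\<close>] show False by simp
    qed
    then have "\<exists>B. B ** G x = mat 1" by (simp add: matrix_left_invertible_ker)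
    then show ?thesis by (metis invertible_left_inverse invertible_det_nz)
  qed
  have "smooth_on S (\<lambda>x. G x $ i $ j)" "smooth_on S (\<lambda>x. b x $ i)" for i j
    by (simp_all add: G_def b_def sA sL)
  then have "smooth_on S (\<lambda>x. G x $ i $ j)" for i j by blast
  moreover have "smooth_on S (\<lambda>x. if j = k then b x $ i else G x $ i $ j)" for i j k
    using \<open>\<And>i j. smooth_on S (\<lambda>x. G x $ i $ j)\<close> \<open>\<And>i. smooth_on S (\<lambda>x. b x $ i)\<close> by (cases "j = k") auto
  ultimately have "smooth_on S w"
    unfolding w_def
    by (intro smooth_on_vec_lambda smooth_on_divide smooth_on_det S det) auto
  moreover have "A x (w x) z = L x z" if "x \<in> S" for x z
  proof (rule ext[of "A x (w x)" "L x"])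
    have "G x *v w x = b x" using cramer[OF det[OF that]] by (simp add: w_def)
    then show "A x (w x) (axis i 1) = L x (axis i 1)" for i
      using Gv[OF that, of "w x" i] by (simp add: b_def)
  qed (use bil[OF that] lin[OF that] in \<open>simp_all add: bilinear_def\<close>)
  ultimately show ?thesis by blast
qed

text \<open>The second difference of \<open>f\<close> over a small parallelogram is, by two applications of the mean
  value theorem, a mixed second derivative at an intermediate point, in either order.\<close>

lemma second_difference:
  fixes f :: "'a::real_normed_vector \<Rightarrow> real"
  assumes sm: "smooth_on S f" and r: "r > 0"
    and S: "\<And>a b. 0 \<le> a \<Longrightarrow> a \<le> r \<Longrightarrow> 0 \<le> b \<Longrightarrow> b \<le> r \<Longrightarrow> x + a *\<^sub>R u + b *\<^sub>R v \<in> S"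
  obtains a b where "0 < a" "a < r" "0 < b" "b < r"
    "f (x + r *\<^sub>R u + r *\<^sub>R v) - f (x + r *\<^sub>R u) - f (x + r *\<^sub>R v) + f x
      = r * r * dd (\<lambda>y. dd f y u) (x + a *\<^sub>R u + b *\<^sub>R v) v"
proof -
  define G where "G a = f (x + a *\<^sub>R u + r *\<^sub>R v) - f (x + a *\<^sub>R u)" for a
  have S0: "x + a *\<^sub>R u \<in> S" if "0 \<le> a" "a \<le> r" for a
    using S[of a 0] that r by simp
  have dG: "DERIV G a :> dd f (x + a *\<^sub>R u + r *\<^sub>R v) u - dd f (x + a *\<^sub>R u) u"
    if "0 \<le> a" "a \<le> r" for a
  proof -
    have 1: "((\<lambda>a. f (x + a *\<^sub>R u + b *\<^sub>R v)) has_derivative (\<lambda>t. dd f (x + a *\<^sub>R u + b *\<^sub>R v) (t *\<^sub>R u))) (at a)"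
      if "0 \<le> b" "b \<le> r" for b
      by (rule has_derivative_compose[of "\<lambda>a. x + a *\<^sub>R u + b *\<^sub>R v", OF _ smooth_on_dd_works[OF sm S]])
        (auto intro!: derivative_eq_intros simp: that \<open>0 \<le> a\<close> \<open>a \<le> r\<close>)
    have lin: "dd f (x + a *\<^sub>R u + b *\<^sub>R v) (t *\<^sub>R u) = t * dd f (x + a *\<^sub>R u + b *\<^sub>R v) u"
      if "0 \<le> b" "b \<le> r" for b t
      using linear_cmul[OF smooth_on_linear_dd[OF sm S[of a b]]] that \<open>0 \<le> a\<close> \<open>a \<le> r\<close> by simp
    show ?thesis
      unfolding has_field_derivative_def G_def
      by (rule has_derivative_eq_rhs[OF has_derivative_diff[OF 1[of r] 1[of 0], simplified]])
        (use lin[of r] lin[of 0] r in \<open>auto simp: fun_eq_iff algebra_simps\<close>)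
  qed
  obtain a where a: "0 < a" "a < r"
    "G r - G 0 = (r - 0) * (dd f (x + a *\<^sub>R u + r *\<^sub>R v) u - dd f (x + a *\<^sub>R u) u)"
    using MVT2[OF r dG] by auto
  define k where "k b = dd f (x + a *\<^sub>R u + b *\<^sub>R v) u" for b
  have dk: "DERIV k b :> dd (\<lambda>y. dd f y u) (x + a *\<^sub>R u + b *\<^sub>R v) v" if "0 \<le> b" "b \<le> r" for b
  proof -
    have p: "x + a *\<^sub>R u + b *\<^sub>R v \<in> S" using S[of a b] that a by simp
    have "((\<lambda>b. dd f (x + a *\<^sub>R u + b *\<^sub>R v) u) has_derivative
        (\<lambda>t. dd (\<lambda>y. dd f y u) (x + a *\<^sub>R u + b *\<^sub>R v) (t *\<^sub>R v))) (at b)"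
      by (rule has_derivative_compose[of "\<lambda>b. x + a *\<^sub>R u + b *\<^sub>R v", OF _ smooth_on_dd_works[OF smooth_on_dd[OF sm] p]])
        (auto intro!: derivative_eq_intros)
    moreover have "dd (\<lambda>y. dd f y u) (x + a *\<^sub>R u + b *\<^sub>R v) (t *\<^sub>R v)
        = t * dd (\<lambda>y. dd f y u) (x + a *\<^sub>R u + b *\<^sub>R v) v" for t
      using linear_cmul[OF smooth_on_linear_dd[OF smooth_on_dd[OF sm] p]] by simp
    ultimately show ?thesis
      unfolding has_field_derivative_def k_def
      by (auto elim!: has_derivative_eq_rhs simp: fun_eq_iff mult.commute)
  qed
  obtain b where b: "0 < b" "b < r"
    "k r - k 0 = (r - 0) * dd (\<lambda>y. dd f y u) (x + a *\<^sub>R u + b *\<^sub>R v) v"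
    using MVT2[OF r dk] by auto
  show ?thesis
    by (rule that[OF a(1,2) b(1,2)]) (use a(3) b(3) in \<open>simp add: G_def k_def algebra_simps\<close>)
qed

lemma symmetric_second_derivative_real:
  fixes f :: "'a::real_normed_vector \<Rightarrow> real"
  assumes S: "open S" "x \<in> S" and sm: "smooth_on S f"
  shows "dd (\<lambda>y. dd f y u) x v = dd (\<lambda>y. dd f y v) x u"
proof -
  define P where "P u v y = dd (\<lambda>y. dd f y u) y v" for u v y
  have cont: "continuous_on S (P u v)" for u v
    unfolding P_def by (intro smooth_on_continuous smooth_on_dd sm)
  have "\<bar>P u v x - P v u x\<bar> < 2 * e" if e: "e > 0" for e
  proof -
    have near: "\<exists>d>0. ball x d \<subseteq> S \<and> (\<forall>y\<in>ball x d. \<bar>P u v y - P u v x\<bar> < e)" for u v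
    proof -
      obtain d1 where d1: "d1 > 0" "ball x d1 \<subseteq> S" using S openE by blast
      obtain d2 where d2: "d2 > 0" "\<And>y. y \<in> S \<Longrightarrow> dist y x < d2 \<Longrightarrow> dist (P u v y) (P u v x) < e"
        using cont[of u v] S(2) e unfolding continuous_on_iff by blast
      show ?thesis
      proof (intro exI[of _ "min d1 d2"] conjI ballI)
        show "\<bar>P u v y - P u v x\<bar> < e" if "y \<in> ball x (min d1 d2)" for y
          using d1 d2(2)[of y] that by (auto simp: dist_real_def dist_commute)
      qed (use d1 d2 in auto)
    qed
    obtain d1 where d1: "d1 > 0" "ball x d1 \<subseteq> S" "\<And>y. y \<in> ball x d1 \<Longrightarrow> \<bar>P u v y - P u v x\<bar> < e"
      using near by blast
    obtain d2 where d2: "d2 > 0" "\<And>y. y \<in> ball x d2 \<Longrightarrow> \<bar>P v u y - P v u x\<bar> < e"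
      using near by blast
    define d where "d = min d1 d2"
    \<comment> \<open>Small enough to keep the parallelogram with sides \<open>r *\<^sub>R u\<close>
      and \<open>r *\<^sub>R v\<close> inside the ball of radius \<open>d\<close>; the summand 1
      covers the case that both vectors vanish.\<close>
    define r where "r = d / (2 * (norm u + norm v + 1))"
    have dpos: "d > 0" using d1 d2 by (simp add: d_def)
    have npos: "norm u + norm v + 1 > 0" by (smt (verit) norm_ge_zero)
    have r: "r > 0" using dpos npos by (simp add: r_def)
    have small: "x + a *\<^sub>R u + b *\<^sub>R v \<in> ball x d" if "0 \<le> a" "a \<le> r" "0 \<le> b" "b \<le> r" for a b
    proof -
      have "norm (a *\<^sub>R u + b *\<^sub>R v) \<le> a * norm u + b * norm v"
        using that by (metis abs_of_nonneg norm_scaleR norm_triangle_ineq)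
      also have "\<dots> \<le> r * norm u + r * norm v"
        using that by (intro add_mono mult_right_mono) auto
      also have "\<dots> \<le> r * (norm u + norm v + 1)" using r by (simp add: algebra_simps)
      also have "\<dots> = d / 2"
        using npos by (simp add: r_def field_split_simps)
      also have "\<dots> < d" using dpos by simp
      finally have "dist x (x + (a *\<^sub>R u + b *\<^sub>R v)) < d" by (metis add_diff_cancel_left' dist_commute dist_norm)
      then show ?thesis by (simp add: add.assoc)
    qed
    have inS: "x + a *\<^sub>R u + b *\<^sub>R v \<in> S" "x + b *\<^sub>R v + a *\<^sub>R u \<in> S"
      if "0 \<le> a" "a \<le> r" "0 \<le> b" "b \<le> r" for a b
      using small[OF that] d1(2) by (auto simp: d_def algebra_simps)
    obtain a b where ab: "0 < a" "a < r" "0 < b" "b < r"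
      "f (x + r *\<^sub>R u + r *\<^sub>R v) - f (x + r *\<^sub>R u) - f (x + r *\<^sub>R v) + f x
        = r * r * P u v (x + a *\<^sub>R u + b *\<^sub>R v)"
      by (rule second_difference[OF sm r inS(1), folded P_def]) blast+
    obtain a' b' where ab': "0 < a'" "a' < r" "0 < b'" "b' < r"
      "f (x + r *\<^sub>R v + r *\<^sub>R u) - f (x + r *\<^sub>R v) - f (x + r *\<^sub>R u) + f x
        = r * r * P v u (x + b' *\<^sub>R v + a' *\<^sub>R u)"
      by (rule second_difference[OF sm r inS(2), folded P_def]) blast+
    have "r * r * P u v (x + a *\<^sub>R u + b *\<^sub>R v) = r * r * P v u (x + b' *\<^sub>R v + a' *\<^sub>R u)"
      using ab(5) ab'(5) by (simp add: algebra_simps)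
    then have "P u v (x + a *\<^sub>R u + b *\<^sub>R v) = P v u (x + a' *\<^sub>R u + b' *\<^sub>R v)"
      using r by (simp add: algebra_simps)
    moreover have "\<bar>P u v (x + a *\<^sub>R u + b *\<^sub>R v) - P u v x\<bar> < e"
      using small[of a b] ab by (intro d1(3)) (auto simp: d_def)
    moreover have "\<bar>P v u (x + a' *\<^sub>R u + b' *\<^sub>R v) - P v u x\<bar> < e"
      using small[of a' b'] ab' by (intro d2(2)) (auto simp: d_def)
    ultimately show ?thesis by linarith
  qed
  \<comment> \<open>With half of a positive difference as \<open>e\<close>, the bound would say that
    the difference is smaller than itself.\<close>
  from this[of "\<bar>P u v x - P v u x\<bar> / 2"] have "P u v x = P v u x" by force
  then show ?thesis by (simp add: P_def)
qed

lemma dd_bounded_linear: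
  "bounded_linear L \<Longrightarrow> f differentiable (at x) \<Longrightarrow> dd (\<lambda>y. L (f y)) x = (\<lambda>v. L (dd f x v))"
  by (rule dd_eqI, rule bounded_linear.has_derivative, assumption, rule dd_works)

lemma symmetric_second_derivative:
  fixes f :: "'a::real_normed_vector \<Rightarrow> 'b::euclidean_space"
  assumes S: "open S" "x \<in> S" and sm: "smooth_on S f"
  shows "dd (\<lambda>y. dd f y u) x v = dd (\<lambda>y. dd f y v) x u"
proof (rule euclidean_eqI)
  fix b :: 'b assume "b \<in> Basis"
  have 1: "dd (\<lambda>z. f z \<bullet> b) y w = dd f y w \<bullet> b" if "y \<in> S" for y w
    by (simp add: dd_bounded_linear[OF bounded_linear_inner_left smooth_on_differentiable[OF sm that]])
  have 2: "dd (\<lambda>y. dd (\<lambda>z. f z \<bullet> b) y u) x v = dd (\<lambda>y. dd f y u) x v \<bullet> b" for u v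
  proof -
    have "dd (\<lambda>y. dd (\<lambda>z. f z \<bullet> b) y u) x = dd (\<lambda>y. dd f y u \<bullet> b) x"
      by (rule dd_cong[OF S]) (simp add: 1)
    then show ?thesis
      using dd_bounded_linear[OF bounded_linear_inner_left smooth_on_differentiable[OF smooth_on_dd[OF sm] S(2)]]
      by simp
  qed
  show "dd (\<lambda>y. dd f y u) x v \<bullet> b = dd (\<lambda>y. dd f y v) x u \<bullet> b"
    using symmetric_second_derivative_real[OF S smooth_on_bounded_linear[OF S(1) bounded_linear_inner_left sm]]
    by (simp flip: 2)
qed

section \<open>Metrics and isometric immersions in coordinates\<close>

lemma bilinear_expand:
  fixes B :: "'a::euclidean_space \<Rightarrow> 'b::euclidean_space \<Rightarrow> 'c::real_vector"
  assumes "bilinear B"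
  shows "B v w = (\<Sum>a\<in>Basis. \<Sum>b\<in>Basis. ((v \<bullet> a) * (w \<bullet> b)) *\<^sub>R B a b)"
proof -
  have "B v w = (\<Sum>a\<in>Basis. (v \<bullet> a) *\<^sub>R B a w)"
    using assms by (intro linear_expand[of "\<lambda>v. B v w"]) (simp add: bilinear_def)
  moreover have "B a w = (\<Sum>b\<in>Basis. (w \<bullet> b) *\<^sub>R B a b)" for a
    using assms by (intro linear_expand[of "B a"]) (simp add: bilinear_def)
  ultimately show ?thesis by (simp add: scaleR_sum_right)
qed

text \<open>Metric, Christoffel symbols and second fundamental form are all instances. Smoothness is
  required for constant arguments only; expansion in bases extends it, with a three-term Leibniz
  rule, to arguments that vary.\<close>

locale bilinear_family =
  fixes B :: "'e::euclidean_space \<Rightarrow> 'a::euclidean_space \<Rightarrow> 'b::euclidean_space \<Rightarrow> 'c::real_normed_vector"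
    and S :: "'e set"
  assumes open_S: "open S"
    and bil: "\<And>x. x \<in> S \<Longrightarrow> bilinear (B x)"
    and smooth_const: "\<And>v w. smooth_on S (\<lambda>x. B x v w)"
begin

text \<open>Needed to reassemble the basis expansion of the derivative in \<open>dd_family\<close>
  and to see the linearity of the Koszul expression.\<close>

lemma bilinear_dd:
  assumes x: "x \<in> S"
  shows "bilinear (\<lambda>v w. dd (\<lambda>y. B y v w) x u)"
proof -
  have add: "dd (\<lambda>y. B y v w + B y v' w') x u = dd (\<lambda>y. B y v w) x u + dd (\<lambda>y. B y v' w') x u" for v w v' w'
    by (simp add: dd_eqI[OF has_derivative_add[OF smooth_on_dd_works[OF smooth_const x]
            smooth_on_dd_works[OF smooth_const x]]])
  have scale: "dd (\<lambda>y. r *\<^sub>R B y v w) x u = r *\<^sub>R dd (\<lambda>y. B y v w) x u" for r v w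
    by (simp add: dd_eqI[OF has_derivative_scaleR_right[OF smooth_on_dd_works[OF smooth_const x]]])
  have 1: "dd (\<lambda>y. B y (v + v') w) x = dd (\<lambda>y. B y v w + B y v' w) x"
    "dd (\<lambda>y. B y v (w + w')) x = dd (\<lambda>y. B y v w + B y v w') x"
    "dd (\<lambda>y. B y (r *\<^sub>R v) w) x = dd (\<lambda>y. r *\<^sub>R B y v w) x"
    "dd (\<lambda>y. B y v (r *\<^sub>R w)) x = dd (\<lambda>y. r *\<^sub>R B y v w) x" for v v' w w' r
    by (rule dd_cong[OF open_S x],
        simp add: bilinear_ladd[OF bil] bilinear_radd[OF bil] bilinear_lmul[OF bil] bilinear_rmul[OF bil])+
  show ?thesis unfolding bilinear_def by (auto intro!: linearI simp: 1 add scale)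
qed

context
  fixes U :: "'d::real_normed_vector set" and h :: "'d \<Rightarrow> 'e" and V :: "'d \<Rightarrow> 'a" and W :: "'d \<Rightarrow> 'b"
  assumes U: "open U" and hU: "h ` U \<subseteq> S"
    and sm: "smooth_on U h" "smooth_on U V" "smooth_on U W"
begin

lemma smooth: "smooth_on U (\<lambda>x. B (h x) (V x) (W x))"
proof (rule smooth_on_cong[OF U])
  show "smooth_on U (\<lambda>x. \<Sum>a\<in>Basis. \<Sum>b\<in>Basis. ((V x \<bullet> a) * (W x \<bullet> b)) *\<^sub>R B (h x) a b)"
    by (rule smooth_on_sum[OF U], rule smooth_on_sum[OF U],
        rule smooth_on_scaleR[OF U smooth_on_mult[OF U smooth_on_inner[OF U sm(2) smooth_on_const]
            smooth_on_inner[OF U sm(3) smooth_on_const]]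
          smooth_on_compose[OF U open_S hU sm(1) smooth_const]])
  show "(\<Sum>a\<in>Basis. \<Sum>b\<in>Basis. ((V x \<bullet> a) * (W x \<bullet> b)) *\<^sub>R B (h x) a b) = B (h x) (V x) (W x)"
    if "x \<in> U" for x
    by (rule bilinear_expand[OF bil, symmetric]) (use hU that in auto)
qed

lemma dd_family:
  assumes x: "x \<in> U"
  shows "dd (\<lambda>y. B (h y) (V y) (W y)) x u = dd (\<lambda>y. B y (V x) (W x)) (h x) (dd h x u)
    + B (h x) (dd V x u) (W x) + B (h x) (V x) (dd W x u)"
proof -
  let ?P = "\<lambda>a b y. ((V y \<bullet> a) * (W y \<bullet> b)) *\<^sub>R B (h y) a b"
  let ?P' = "\<lambda>a b u. ((V x \<bullet> a) * (W x \<bullet> b)) *\<^sub>R dd (\<lambda>y. B y a b) (h x) (dd h x u)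
     + ((V x \<bullet> a) * (dd W x u \<bullet> b) + (dd V x u \<bullet> a) * (W x \<bullet> b)) *\<^sub>R B (h x) a b"
  have hx: "h x \<in> S" using hU x by auto
  note dV = bounded_linear.has_derivative[OF bounded_linear_inner_left smooth_on_dd_works[OF sm(2) x]]
  note dW = bounded_linear.has_derivative[OF bounded_linear_inner_left smooth_on_dd_works[OF sm(3) x]]
  have dB: "((\<lambda>y. B (h y) a b) has_derivative (\<lambda>u. dd (\<lambda>y. B y a b) (h x) (dd h x u))) (at x)" for a b
    using has_derivative_compose[OF smooth_on_dd_works[OF sm(1) x] smooth_on_dd_works[OF smooth_const hx, of a b]]
    by simp
  have "(?P a b has_derivative ?P' a b) (at x)" for a b
    by (rule has_derivative_scaleR[OF has_derivative_mult[OF dV dW] dB])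
  then have "((\<lambda>y. \<Sum>a\<in>Basis. \<Sum>b\<in>Basis. ?P a b y) has_derivative
      (\<lambda>u. \<Sum>a\<in>Basis. \<Sum>b\<in>Basis. ?P' a b u)) (at x)"
    by (intro has_derivative_sum) auto
  then have "dd (\<lambda>y. \<Sum>a\<in>Basis. \<Sum>b\<in>Basis. ?P a b y) x u = (\<Sum>a\<in>Basis. \<Sum>b\<in>Basis. ?P' a b u)"
    by (simp add: dd_eqI)
  moreover have "dd (\<lambda>y. B (h y) (V y) (W y)) x = dd (\<lambda>y. \<Sum>a\<in>Basis. \<Sum>b\<in>Basis. ?P a b y) x"
    using hU by (intro dd_cong[OF U x] bilinear_expand[OF bil]) auto
  moreover have "(\<Sum>a\<in>Basis. \<Sum>b\<in>Basis. ?P' a b u) = dd (\<lambda>y. B y (V x) (W x)) (h x) (dd h x u)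
    + B (h x) (dd V x u) (W x) + B (h x) (V x) (dd W x u)"
    unfolding bilinear_expand[OF bilinear_dd[OF hx, of "dd h x u"], of "V x" "W x"]
      bilinear_expand[OF bil[OF hx], of "dd V x u" "W x"] bilinear_expand[OF bil[OF hx], of "V x" "dd W x u"]
    by (simp add: sum.distrib scaleR_add_left algebra_simps)
  ultimately show ?thesis by simp
qed

end

end

text \<open>The derivative of \<open>f\<close> has a single linear slot; a scalar slot, finally
  filled with the constant 1, turns it into a bilinear family.\<close>

lemma dd_linear_family:
  fixes h :: "'d::real_normed_vector \<Rightarrow> 'e::euclidean_space" and f :: "'e \<Rightarrow> 'c::real_normed_vector"
  assumes U: "open U" "h ` U \<subseteq> S" "smooth_on U h" "smooth_on U V"
    and S: "open S" "smooth_on S f" and x: "x \<in> U"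
  shows "dd (\<lambda>y. dd f (h y) (V y)) x u = dd (\<lambda>y. dd f y (V x)) (h x) (dd h x u) + dd f (h x) (dd V x u)"
proof -
  interpret bilinear_family "\<lambda>y (r::real) v. r *\<^sub>R dd f y v" S
  proof
    show "bilinear (\<lambda>r v. r *\<^sub>R dd f x v)" if "x \<in> S" for x
      using smooth_on_linear_dd[OF S(2) that]
      by (auto simp: bilinear_def linear_iff scaleR_add_left scaleR_add_right)
    show "smooth_on S (\<lambda>x. r *\<^sub>R dd f x w)" for r :: real and w
      by (rule smooth_on_scaleR[OF S(1) smooth_on_const smooth_on_dd[OF S(2)]])
  qed (rule S)
  show ?thesis
    using dd_family[OF U(1-3) smooth_on_const U(4) x, of 1 u] by simp
qed

lemma cov_deriv_cong:
  assumes "open U" "x \<in> U" "\<And>y. y \<in> U \<Longrightarrow> V y = W y" "\<And>y. y \<in> U \<Longrightarrow> h y = k y"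
  shows "cov_deriv g h V x u = cov_deriv g k W x u"
  using dd_cong[OF assms(1,2,3)] dd_cong[OF assms(1,2,4)] assms by (simp add: cov_deriv_def)

section \<open>The Levi-Civita connection of a metric on a coordinate domain\<close>

locale riem_patch =
  fixes g :: "(real^'n) cmetric" and S :: "(real^'n) set"
  assumes open_S: "open S"
    and bil: "\<And>x. x \<in> S \<Longrightarrow> bilinear (g x)"
    and sym: "\<And>x u v. x \<in> S \<Longrightarrow> g x u v = g x v u"
    and pos: "\<And>x u. x \<in> S \<Longrightarrow> u \<noteq> 0 \<Longrightarrow> g x u u > 0"
    and smooth_g: "\<And>u v. smooth_on S (\<lambda>x. g x u v)"
begin

sublocale g: bilinear_family g S
  by standard (fact open_S bil smooth_g)+

lemmas lin = bilinear_ladd[OF bil] bilinear_radd[OF bil] bilinear_lmul[OF bil] bilinear_rmul[OF bil]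
  bilinear_lneg[OF bil] bilinear_rneg[OF bil] bilinear_lzero[OF bil] bilinear_rzero[OF bil]
  bilinear_lsub[OF bil] bilinear_rsub[OF bil]

lemma g_zero_iff: "x \<in> S \<Longrightarrow> g x u u = 0 \<longleftrightarrow> u = 0"
  by (metis less_irrefl pos bilinear_lzero[OF bil])

lemma nondegenerate:
  assumes "x \<in> S" "\<And>z. g x u z = g x v z"
  shows "u = v"
proof -
  have "g x (u - v) (u - v) = 0" using assms by (simp add: lin)
  then show ?thesis using g_zero_iff assms(1) by auto
qed

text \<open>Twice the Christoffel symbol of the first kind, the right-hand side in the definition of
  \<open>christoffel\<close>.\<close>

definition koszul :: "real^'n \<Rightarrow> real^'n \<Rightarrow> real^'n \<Rightarrow> real^'n \<Rightarrow> real" where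
  "koszul x u v z = dd (\<lambda>y. g y v z) x u + dd (\<lambda>y. g y u z) x v - dd (\<lambda>y. g y u v) x z"

text \<open>The Koszul expression is linear in \<open>z\<close>, so a smooth field represents half
  of it; nondegeneracy identifies this field with the description in \<open>christoffel\<close>.
  Both claims are read off from it, hence the joint proof.\<close>

lemma christoffel_smooth_koszul:
  shows smooth_christoffel: "smooth_on S (\<lambda>x. christoffel g x u v)"
    and christoffel: "x \<in> S \<Longrightarrow> 2 * g x (christoffel g x u v) z = koszul x u v z"
proof -
  have lin1: "linear (\<lambda>z. dd (\<lambda>y. g y v z) x u)" if "x \<in> S" for x u v
    using g.bilinear_dd[OF that] by (simp add: bilinear_def)
  have "linear (\<lambda>z. koszul x u v z / 2)" if "x \<in> S" for x
    unfolding koszul_def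
    using linear_compose_scale_right[OF linear_compose_sub[OF linear_compose_add[OF lin1[OF that, of v u]
            lin1[OF that, of u v]] smooth_on_linear_dd[OF smooth_g that, of u v]], of "1/2"]
    by simp
  moreover have "smooth_on S (\<lambda>x. koszul x u v z / 2)" for z
    unfolding koszul_def
    by (rule smooth_on_divide[OF open_S smooth_on_diff[OF open_S smooth_on_add[OF open_S]] smooth_on_const])
      (simp_all add: smooth_on_dd[OF smooth_g])
  ultimately obtain w where w: "smooth_on S w" "\<And>x z. x \<in> S \<Longrightarrow> g x (w x) z = koszul x u v z / 2"
    using smooth_riesz[OF open_S bil pos smooth_g, of "\<lambda>x z. koszul x u v z / 2"] by auto
  have eq: "christoffel g x u v = w x" if x: "x \<in> S" for x
    unfolding christoffel_def koszul_def[symmetric]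
  proof (rule the_equality)
    have "2 * g x (w x) z = koszul x u v z" for z using w(2)[OF x, of z] by linarith
    then show "\<forall>z. 2 * g x (w x) z = koszul x u v z" by blast
    show "w' = w x" if "\<forall>z. 2 * g x w' z = koszul x u v z" for w'
    proof (rule nondegenerate[OF x])
      show "g x w' z = g x (w x) z" for z
        using that[rule_format, of z] w(2)[OF x, of z] by simp
    qed
  qed
  show "smooth_on S (\<lambda>x. christoffel g x u v)"
    by (rule smooth_on_cong[OF open_S _ w(1)]) (simp add: eq)
  show "2 * g x (christoffel g x u v) z = koszul x u v z" if "x \<in> S"
    by (simp add: eq[OF that] w(2)[OF that])
qed

lemma christoffel_sym: "x \<in> S \<Longrightarrow> christoffel g x u v = christoffel g x v u"
proof (rule nondegenerate)
  assume x: "x \<in> S"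
  have "dd (\<lambda>y. g y u v) x = dd (\<lambda>y. g y v u) x"
    by (rule dd_cong[OF open_S x]) (rule sym)
  then show "g x (christoffel g x u v) z = g x (christoffel g x v u) z" for z
    using christoffel[OF x, of u v z] christoffel[OF x, of v u z] by (simp add: koszul_def)
qed

lemma christoffel_bilinear:
  assumes x: "x \<in> S"
  shows "bilinear (christoffel g x)"
proof -
  have 1: "linear (christoffel g x u)" for u
  proof (rule linearI)
    note l = bilinear_ladd[OF g.bilinear_dd[OF x]] bilinear_radd[OF g.bilinear_dd[OF x]]
      bilinear_lmul[OF g.bilinear_dd[OF x]] bilinear_rmul[OF g.bilinear_dd[OF x]]
      linear_add[OF smooth_on_linear_dd[OF smooth_g x]] linear_cmul[OF smooth_on_linear_dd[OF smooth_g x]]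
    show "christoffel g x u (v + w) = christoffel g x u v + christoffel g x u w" for v w
    proof (rule nondegenerate[OF x])
      fix z
      have "koszul x u (v + w) z = koszul x u v z + koszul x u w z"
        by (simp add: koszul_def l)
      then show "g x (christoffel g x u (v + w)) z = g x (christoffel g x u v + christoffel g x u w) z"
        using christoffel[OF x, of u v z] christoffel[OF x, of u w z] christoffel[OF x, of u "v + w" z]
        by (simp add: lin x)
    qed
    show "christoffel g x u (r *\<^sub>R v) = r *\<^sub>R christoffel g x u v" for v r
    proof (rule nondegenerate[OF x])
      fix z
      have "koszul x u (r *\<^sub>R v) z = r * koszul x u v z"
        by (simp add: koszul_def l algebra_simps)
      then have "2 * g x (christoffel g x u (r *\<^sub>R v)) z = r * (2 * g x (christoffel g x u v) z)"
        by (simp only: christoffel[OF x])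
      then show "g x (christoffel g x u (r *\<^sub>R v)) z = g x (r *\<^sub>R christoffel g x u v) z"
        by (simp add: lin x)
    qed
  qed
  moreover have "linear (\<lambda>u. christoffel g x u v)" for v
    using 1[of v] by (simp add: christoffel_sym[OF x, of _ v])
  ultimately show ?thesis by (simp add: bilinear_def)
qed

sublocale chr: bilinear_family "christoffel g" S
  by standard (fact open_S christoffel_bilinear smooth_christoffel)+

lemmas chr_lin = bilinear_ladd[OF christoffel_bilinear] bilinear_radd[OF christoffel_bilinear]
  bilinear_lmul[OF christoffel_bilinear] bilinear_rmul[OF christoffel_bilinear]
  bilinear_lneg[OF christoffel_bilinear] bilinear_rneg[OF christoffel_bilinear]
  bilinear_lzero[OF christoffel_bilinear] bilinear_rzero[OF christoffel_bilinear]
  bilinear_lsub[OF christoffel_bilinear] bilinear_rsub[OF christoffel_bilinear]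

text \<open>Compatibility with the metric for constant fields: adding the Koszul formula and the one
  with \<open>v\<close> and \<open>w\<close> exchanged cancels four of the six terms.\<close>

lemma koszul_metric:
  assumes x: "x \<in> S"
  shows "dd (\<lambda>y. g y v w) x u = g x (christoffel g x u v) w + g x v (christoffel g x u w)"
proof -
  have s: "dd (\<lambda>y. g y a b) x c = dd (\<lambda>y. g y b a) x c" for a b c
    by (rule fun_cong[OF dd_cong[OF open_S x]]) (rule sym)
  show ?thesis
    using christoffel[OF x, of u v w] christoffel[OF x, of u w v] s[of u v w] s[of u w v] s[of v w u]
      sym[OF x, of v "christoffel g x u w"]
    by (simp add: koszul_def)
qed

end

section \<open>Covariant differentiation of vector fields along a map\<close>

locale field_along = riem_patch g S for g :: "(real^'n) cmetric" and S +
  fixes U :: "'d::euclidean_space set" and h :: "'d \<Rightarrow> real^'n"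
  assumes open_U: "open U" and hU: "h ` U \<subseteq> S" and smooth_h: "smooth_on U h"
begin

lemma h_in: "x \<in> U \<Longrightarrow> h x \<in> S"
  using hU by auto

lemma metric_compat:
  assumes "smooth_on U V" "smooth_on U W" and x: "x \<in> U"
  shows "dd (\<lambda>y. g (h y) (V y) (W y)) x u
    = g (h x) (cov_deriv g h V x u) (W x) + g (h x) (V x) (cov_deriv g h W x u)"
  unfolding g.dd_family[OF open_U hU smooth_h assms] koszul_metric[OF h_in[OF x]] cov_deriv_def
  by (simp add: lin h_in[OF x])

lemma smooth_cov_deriv: "smooth_on U V \<Longrightarrow> smooth_on U (\<lambda>x. cov_deriv g h V x u)"
  unfolding cov_deriv_def
  by (rule smooth_on_add[OF open_U smooth_on_dd chr.smooth[OF open_U hU smooth_h smooth_on_dd[OF smooth_h]]])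

lemma cov_deriv_add:
  assumes "smooth_on U V" "smooth_on U W" "x \<in> U"
  shows "cov_deriv g h (\<lambda>y. V y + W y) x u = cov_deriv g h V x u + cov_deriv g h W x u"
  using dd_eqI[OF has_derivative_add[OF smooth_on_dd_works[OF assms(1,3)] smooth_on_dd_works[OF assms(2,3)]]]
  by (simp add: cov_deriv_def chr_lin h_in[OF assms(3)])

lemma cov_deriv_scaleR:
  assumes "smooth_on U a" "smooth_on U V" "x \<in> U"
  shows "cov_deriv g h (\<lambda>y. a y *\<^sub>R V y) x u = dd a x u *\<^sub>R V x + a x *\<^sub>R cov_deriv g h V x u"
  using dd_eqI[OF has_derivative_scaleR[OF smooth_on_dd_works[OF assms(1,3)] smooth_on_dd_works[OF assms(2,3)]]]
  by (simp add: cov_deriv_def chr_lin h_in[OF assms(3)] algebra_simps)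

lemma cov_deriv_linear:
  assumes "smooth_on U V" "x \<in> U"
  shows "linear (cov_deriv g h V x)"
proof -
  note l = smooth_on_linear_dd[OF assms] smooth_on_linear_dd[OF smooth_h assms(2)]
  show ?thesis
    unfolding cov_deriv_def
    by (rule linearI) (simp_all add: linear_add[OF l(1)] linear_add[OF l(2)] linear_cmul[OF l(1)]
        linear_cmul[OF l(2)] chr_lin h_in[OF assms(2)] algebra_simps)
qed

lemma torsion_free:
  assumes x: "x \<in> U"
  shows "cov_deriv g h (\<lambda>y. dd h y v) x u = cov_deriv g h (\<lambda>y. dd h y u) x v"
  unfolding cov_deriv_def
  using symmetric_second_derivative[OF open_U x smooth_h] christoffel_sym[OF h_in[OF x]] by simp

text \<open>Written out in coordinates, the second derivatives of \<open>V\<close> and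
  \<open>h\<close> and the sum of the two terms with a first derivative of \<open>V\<close> are
  symmetric in \<open>u\<close> and \<open>v\<close>. What survives is the coordinate formula of
  \<open>curv\<close> for the pushed vectors.\<close>

lemma curv_commutator:
  assumes V: "smooth_on U V" and x: "x \<in> U"
  shows "cov_deriv g h (\<lambda>y. cov_deriv g h V y v) x u - cov_deriv g h (\<lambda>y. cov_deriv g h V y u) x v
    = curv g (h x) (dd h x u) (dd h x v) (V x)"
proof -
  have 1: "cov_deriv g h (\<lambda>y. cov_deriv g h V y v) x u
    = dd (\<lambda>y. dd V y v) x u
    + dd (\<lambda>y. christoffel g y (dd h x v) (V x)) (h x) (dd h x u)
    + christoffel g (h x) (dd (\<lambda>y. dd h y v) x u) (V x)
    + christoffel g (h x) (dd h x v) (dd V x u)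
    + christoffel g (h x) (dd h x u) (dd V x v)
    + christoffel g (h x) (dd h x u) (christoffel g (h x) (dd h x v) (V x))" for u v
  proof -
    have "dd (\<lambda>y. cov_deriv g h V y v) x u = dd (\<lambda>y. dd V y v) x u
      + dd (\<lambda>y. christoffel g (h y) (dd h y v) (V y)) x u"
      unfolding cov_deriv_def
      by (simp add: dd_eqI[OF has_derivative_add[OF smooth_on_dd_works[OF smooth_on_dd[OF V] x]
              smooth_on_dd_works[OF chr.smooth[OF open_U hU smooth_h smooth_on_dd[OF smooth_h] V] x]]])
    then show ?thesis
      unfolding chr.dd_family[OF open_U hU smooth_h smooth_on_dd[OF smooth_h] V x]
      by (simp add: cov_deriv_def chr_lin h_in[OF x])
  qed
  have 2: "cov_deriv g id (\<lambda>y. cov_deriv g id (\<lambda>_. w) y b) p a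
    = dd (\<lambda>y. christoffel g y b w) p a + christoffel g p a (christoffel g p b w)" if "p \<in> S" for a b w p
    by (simp add: cov_deriv_def)
  show ?thesis
    unfolding 1 curv_def 2[OF h_in[OF x]]
    using symmetric_second_derivative[OF open_U x smooth_h, of u v]
      symmetric_second_derivative[OF open_U x V, of u v]
    by (simp add: algebra_simps)
qed

end

context riem_patch
begin

lemma field_along_id: "open U \<Longrightarrow> U \<subseteq> S \<Longrightarrow> field_along g S U id"
  by unfold_locales (auto simp: smooth_on_id id_def)

end

section \<open>Isometric immersions: second fundamental form and Gauss equation\<close>

locale isometric_patch = src: riem_patch g S + tgt: riem_patch g' T
  for g :: "(real^'m) cmetric" and S and g' :: "(real^'n) cmetric" and T +
  fixes \<phi> :: "real^'m \<Rightarrow> real^'n"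
  assumes smooth_\<phi>: "smooth_on S \<phi>" and \<phi>S: "\<phi> ` S \<subseteq> T"
    and iso: "\<And>x u v. x \<in> S \<Longrightarrow> g x u v = g' (\<phi> x) (dd \<phi> x u) (dd \<phi> x v)"
begin

sublocale f: field_along g' T S \<phi>
  by unfold_locales (fact src.open_S \<phi>S smooth_\<phi>)+

lemma linear_dd: "x \<in> S \<Longrightarrow> linear (dd \<phi> x)"
  by (rule smooth_on_linear_dd[OF smooth_\<phi>])

lemma dd_inj: "x \<in> S \<Longrightarrow> dd \<phi> x u = dd \<phi> x v \<longleftrightarrow> u = v"
proof
  assume x: "x \<in> S" and eq: "dd \<phi> x u = dd \<phi> x v"
  have "g x (u - v) (u - v) = 0"
    using eq x by (simp add: iso linear_diff[OF linear_dd] f.h_in tgt.lin)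
  then show "u = v" using src.g_zero_iff[OF x, of "u - v"] by simp
qed auto

text \<open>The full ambient derivative of the pushed constant field. The Hessian in the invariant
  sense is this minus its tangential part, and that difference is \<open>sff\<close>.\<close>

definition hess :: "real^'m \<Rightarrow> real^'m \<Rightarrow> real^'m \<Rightarrow> real^'n" where
  "hess x u v = cov_deriv g' \<phi> (\<lambda>y. dd \<phi> y v) x u"

lemma hess_sym: "x \<in> S \<Longrightarrow> hess x u v = hess x v u"
  unfolding hess_def by (rule f.torsion_free)

text \<open>Uniqueness of the Levi-Civita connection: differentiating the isometry relation writes
  each derivative of \<open>g\<close> as two \<open>hess\<close> terms, and in the Koszul
  combination the symmetry of \<open>hess\<close> leaves only one of them, twice.\<close>

lemma hess_tangential:
  assumes x: "x \<in> S"
  shows "g' (\<phi> x) (hess x u v) (dd \<phi> x z) = g x (christoffel g x u v) z"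
proof -
  have 1: "dd (\<lambda>y. g y v z) x u = g' (\<phi> x) (hess x u v) (dd \<phi> x z) + g' (\<phi> x) (hess x u z) (dd \<phi> x v)"
    for u v z
  proof -
    have "dd (\<lambda>y. g y v z) x = dd (\<lambda>y. g' (\<phi> y) (dd \<phi> y v) (dd \<phi> y z)) x"
      by (rule dd_cong[OF src.open_S x]) (rule iso)
    then show ?thesis
      using f.metric_compat[OF smooth_on_dd[OF smooth_\<phi>] smooth_on_dd[OF smooth_\<phi>] x, of v z u]
        tgt.sym[OF f.h_in[OF x], of "dd \<phi> x v" "hess x u z"] by (simp add: hess_def)
  qed
  show ?thesis
    using src.christoffel[OF x, of u v z] 1[of v z u] 1[of u z v] 1[of u v z]
      hess_sym[OF x, of u v] hess_sym[OF x, of u z] hess_sym[OF x, of v z]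
    by (simp add: src.koszul_def)
qed

text \<open>Evaluates the description in \<open>normal_part\<close>: the difference of two
  candidates is both tangent and normal, hence of length zero.\<close>

lemma normal_part_eq:
  assumes x: "x \<in> S" and n: "\<xi> \<in> normal_space g' \<phi> x"
  shows "normal_part g' \<phi> x (dd \<phi> x t + \<xi>) = \<xi>"
  unfolding normal_part_def
proof (rule the_equality)
  show "\<xi> \<in> normal_space g' \<phi> x \<and> dd \<phi> x t + \<xi> - \<xi> \<in> range (dd \<phi> x)"
    using n by simp
  fix \<zeta> assume *: "\<zeta> \<in> normal_space g' \<phi> x \<and> dd \<phi> x t + \<xi> - \<zeta> \<in> range (dd \<phi> x)"
  then obtain s where "dd \<phi> x t + \<xi> - \<zeta> = dd \<phi> x s" by auto
  then have d: "\<xi> - \<zeta> = dd \<phi> x (s - t)" by (simp add: linear_diff[OF linear_dd[OF x]] algebra_simps)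
  have "g' (\<phi> x) (\<xi> - \<zeta>) (\<xi> - \<zeta>) = 0"
    by (subst (2) d) (use n * in \<open>simp add: normal_space_def tgt.lin f.h_in[OF x]\<close>)
  then show "\<zeta> = \<xi>" using tgt.g_zero_iff[OF f.h_in[OF x], of "\<xi> - \<zeta>"] by simp
qed

lemma hess_normal: "x \<in> S \<Longrightarrow> hess x u v - dd \<phi> x (christoffel g x u v) \<in> normal_space g' \<phi> x"
  by (simp add: normal_space_def tgt.lin f.h_in hess_tangential iso)

lemma sff_eq: "x \<in> S \<Longrightarrow> sff g' \<phi> x u v = hess x u v - dd \<phi> x (christoffel g x u v)"
  using normal_part_eq[OF _ hess_normal[of x u v], of "christoffel g x u v"]
  by (simp add: sff_def hess_def)

lemma sff_normal: "x \<in> S \<Longrightarrow> g' (\<phi> x) (sff g' \<phi> x u v) (dd \<phi> x z) = 0"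
  using hess_normal[of x u v] by (simp add: normal_space_def sff_eq)

lemma sff_normal': "x \<in> S \<Longrightarrow> g' (\<phi> x) (dd \<phi> x z) (sff g' \<phi> x u v) = 0"
  using sff_normal[of x u v z] tgt.sym[OF f.h_in, of x] by simp

lemma sff_sym: "x \<in> S \<Longrightarrow> sff g' \<phi> x u v = sff g' \<phi> x v u"
  by (simp add: sff_eq hess_sym src.christoffel_sym)

lemma sff_bilinear:
  assumes x: "x \<in> S"
  shows "bilinear (sff g' \<phi> x)"
proof -
  have "linear (\<lambda>u. sff g' \<phi> x u v)" for v
    unfolding sff_eq[OF x] hess_def
    by (rule linear_compose_sub[OF f.cov_deriv_linear[OF smooth_on_dd[OF smooth_\<phi>] x]])
      (rule linearI, simp_all add: src.chr_lin x linear_add[OF linear_dd] linear_cmul[OF linear_dd])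
  then show ?thesis
    using sff_sym[OF x] by (simp add: bilinear_def)
qed

lemma smooth_sff: "smooth_on S (\<lambda>x. sff g' \<phi> x u v)"
proof (rule smooth_on_cong[OF src.open_S])
  have "(\<lambda>x. x) ` S \<subseteq> S" by simp
  from smooth_on_dd_compose[OF src.open_S src.open_S this smooth_on_id smooth_\<phi> src.smooth_christoffel]
  show "smooth_on S (\<lambda>x. hess x u v - dd \<phi> x (christoffel g x u v))"
    unfolding hess_def
    by (intro smooth_on_diff[OF src.open_S f.smooth_cov_deriv[OF smooth_on_dd[OF smooth_\<phi>]]])
qed (simp add: sff_eq)

sublocale II: bilinear_family "sff g' \<phi>" S
  by standard (fact src.open_S sff_bilinear smooth_sff)+

lemmas sff_lin = bilinear_ladd[OF sff_bilinear] bilinear_radd[OF sff_bilinear]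
  bilinear_lmul[OF sff_bilinear] bilinear_rmul[OF sff_bilinear]
  bilinear_lneg[OF sff_bilinear] bilinear_rneg[OF sff_bilinear]

text \<open>Stated along a map \<open>h\<close> into the source, so that it serves both for the
  identity, in the Gauss equation, and for a surface lying in the hypersurface that
  \<open>\<phi>\<close> immerses.\<close>

lemma gauss_formula:
  assumes h: "open U" "h ` U \<subseteq> S" "smooth_on U h" "smooth_on U V" and x: "x \<in> U"
  shows "cov_deriv g' (\<lambda>y. \<phi> (h y)) (\<lambda>y. dd \<phi> (h y) (V y)) x u
    = dd \<phi> (h x) (cov_deriv g h V x u) + sff g' \<phi> (h x) (dd h x u) (V x)"
proof -
  have hx: "h x \<in> S" using h x by auto
  have "dd (\<lambda>y. \<phi> (h y)) x = (\<lambda>u. dd \<phi> (h x) (dd h x u))"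
    using dd_eqI[OF has_derivative_compose[OF smooth_on_dd_works[OF h(3) x] smooth_on_dd_works[OF smooth_\<phi> hx]]]
    by simp
  then show ?thesis
    using dd_linear_family[OF h src.open_S smooth_\<phi> x]
    by (simp add: sff_eq[OF hx] cov_deriv_def hess_def linear_add[OF linear_dd[OF hx]] algebra_simps)
qed

end

context isometric_patch
begin

text \<open>After one derivative of a pushed constant field, its tangent part contributes the
  intrinsic second derivative and its normal part a product of second fundamental forms.
  Antisymmetrizing turns the left side into the ambient curvature by
  \<open>curv_commutator\<close>.\<close>

lemma gauss_equation:
  assumes x: "x \<in> S"
  shows "g' (\<phi> x) (curv g' (\<phi> x) (dd \<phi> x u) (dd \<phi> x v) (dd \<phi> x v)) (dd \<phi> x u)
    = g x (curv g x u v v) u - g' (\<phi> x) (sff g' \<phi> x u u) (sff g' \<phi> x v v)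
      + g' (\<phi> x) (sff g' \<phi> x u v) (sff g' \<phi> x u v)"
proof -
  have \<phi>x: "\<phi> x \<in> T" using f.h_in x .
  have 1: "g' (\<phi> x) (cov_deriv g' \<phi> (\<lambda>y. cov_deriv g' \<phi> (\<lambda>y. dd \<phi> y v) y b) x a) (dd \<phi> x u)
    = g x (cov_deriv g id (\<lambda>y. cov_deriv g id (\<lambda>_. v) y b) x a) u
      - g' (\<phi> x) (sff g' \<phi> x b v) (sff g' \<phi> x a u)" for a b
  proof -
    let ?X = "\<lambda>y. christoffel g y b v" and ?n = "\<lambda>y. sff g' \<phi> y b v"
    have "cov_deriv g' \<phi> (\<lambda>y. cov_deriv g' \<phi> (\<lambda>y. dd \<phi> y v) y b) x a
      = cov_deriv g' \<phi> (\<lambda>y. dd \<phi> y (?X y) + ?n y) x a"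
      by (rule cov_deriv_cong[OF src.open_S x]) (simp_all add: sff_eq hess_def)
    also have "\<dots> = cov_deriv g' \<phi> (\<lambda>y. dd \<phi> y (?X y)) x a + cov_deriv g' \<phi> ?n x a"
    proof (rule f.cov_deriv_add[OF _ smooth_sff x])
      show "smooth_on S (\<lambda>y. dd \<phi> y (?X y))"
        using smooth_on_dd_compose[OF src.open_S src.open_S _ smooth_on_id smooth_\<phi> src.smooth_christoffel]
        by simp
    qed
    also have "cov_deriv g' \<phi> (\<lambda>y. dd \<phi> y (?X y)) x a
      = dd \<phi> x (cov_deriv g (\<lambda>y. y) ?X x a) + sff g' \<phi> x a (?X x)"
      using gauss_formula[OF src.open_S _ smooth_on_id src.smooth_christoffel x] by simp
    finally have "g' (\<phi> x) (cov_deriv g' \<phi> (\<lambda>y. cov_deriv g' \<phi> (\<lambda>y. dd \<phi> y v) y b) x a) (dd \<phi> x u)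
      = g x (cov_deriv g (\<lambda>y. y) ?X x a) u + g' (\<phi> x) (cov_deriv g' \<phi> ?n x a) (dd \<phi> x u)"
      by (simp add: tgt.lin \<phi>x sff_normal x iso)
    moreover have "cov_deriv g (\<lambda>y. y) ?X x a = cov_deriv g id (\<lambda>y. cov_deriv g id (\<lambda>_. v) y b) x a"
      by (simp add: cov_deriv_def id_def)
    \<comment> \<open>Weingarten relation, by differentiating the orthogonality of \<open>?n\<close>
      to the pushed field \<open>u\<close>.\<close>
    moreover have "g' (\<phi> x) (cov_deriv g' \<phi> ?n x a) (dd \<phi> x u) = - g' (\<phi> x) (?n x) (sff g' \<phi> x a u)"
    proof -
      have "dd (\<lambda>y. g' (\<phi> y) (?n y) (dd \<phi> y u)) x = dd (\<lambda>y. 0) x"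
        by (rule dd_cong[OF src.open_S x]) (rule sff_normal)
      then have "g' (\<phi> x) (cov_deriv g' \<phi> ?n x a) (dd \<phi> x u) + g' (\<phi> x) (?n x) (hess x a u) = 0"
        using f.metric_compat[OF smooth_sff smooth_on_dd[OF smooth_\<phi>] x, of b v u a] by (simp add: hess_def)
      then show ?thesis by (simp add: sff_eq[of x a u] x tgt.lin \<phi>x sff_normal')
        (simp add: sff_normal x tgt.lin \<phi>x)
    qed
    ultimately show ?thesis by simp
  qed
  show ?thesis
    unfolding f.curv_commutator[OF smooth_on_dd[OF smooth_\<phi>] x, of v v u, symmetric] curv_def[of g]
    using sff_sym[OF x, of v u] tgt.sym[OF \<phi>x, of "sff g' \<phi> x u u"]
    by (simp add: tgt.lin \<phi>x src.lin x 1)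
qed

end

section \<open>Determinants and orthonormal frames\<close>

lemma transpose_mult_rows:
  fixes A :: "real^'n^'n"
  shows "transpose A *v c = (\<Sum>i\<in>UNIV. c $ i *\<^sub>R A $ i)"
  by (simp add: vec_eq_iff matrix_vector_mult_def transpose_def mult.commute)

lemma det_nonzero_combination:
  fixes A :: "real^'n^'n"
  assumes "det A \<noteq> 0"
  obtains c where "w = (\<Sum>i\<in>UNIV. c i *\<^sub>R A $ i)"
proof -
  have "invertible (transpose A)" using assms by (simp add: invertible_det_nz det_transpose)
  then obtain B where "transpose A ** B = mat 1" unfolding invertible_def by blast
  then have "w = transpose A *v (B *v w)" by (simp add: matrix_vector_mul_assoc)
  then have "w = (\<Sum>i\<in>UNIV. (B *v w) $ i *\<^sub>R A $ i)" by (simp only: transpose_mult_rows[symmetric])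
  then show ?thesis by (rule that)
qed

lemma det_zero_combination:
  fixes A :: "real^'n^'n"
  assumes "det A = 0"
  obtains c where "\<exists>i. c i \<noteq> 0" "(\<Sum>i\<in>UNIV. c i *\<^sub>R A $ i) = 0"
proof -
  have "\<not> (\<exists>B. B ** transpose A = mat 1)"
    using assms by (metis det_transpose invertible_det_nz invertible_left_inverse)
  then obtain c where c: "transpose A *v c = 0" "c \<noteq> 0" unfolding matrix_left_invertible_ker by blast
  show ?thesis
  proof (rule that)
    show "\<exists>i. c $ i \<noteq> 0" using c(2) by (simp add: vec_eq_iff)
    show "(\<Sum>i\<in>UNIV. c $ i *\<^sub>R A $ i) = 0" using c(1) unfolding transpose_mult_rows .
  qed
qed

lemma vector_4 [simp]:
  fixes a b c d :: "'a::zero"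
  shows "(vector [a, b, c, d] :: 'a^4) $ 1 = a" "(vector [a, b, c, d] :: 'a^4) $ 2 = b"
    "(vector [a, b, c, d] :: 'a^4) $ 3 = c" "(vector [a, b, c, d] :: 'a^4) $ 4 = d"
  unfolding vector_def by auto

definition det2 :: "real^2 \<Rightarrow> real^2 \<Rightarrow> real" where "det2 u v = det (vector [u, v] :: real^2^2)"
definition det3 :: "real^3 \<Rightarrow> real^3 \<Rightarrow> real^3 \<Rightarrow> real" where
  "det3 u v w = det (vector [u, v, w] :: real^3^3)"
definition det4 :: "real^4 \<Rightarrow> real^4 \<Rightarrow> real^4 \<Rightarrow> real^4 \<Rightarrow> real" where
  "det4 u v w z = det (vector [u, v, w, z] :: real^4^4)"

lemma det2_rotate: "det2 (a *\<^sub>R u + b *\<^sub>R v) (c *\<^sub>R u + d *\<^sub>R v) = (a * d - b * c) * det2 u v"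
  by (simp add: det2_def det_2 algebra_simps)

lemma det2_axis: "det2 (axis 1 1) (axis 2 1) = 1"
  by (simp add: det2_def det_2 axis_def)

lemma linear_det3: "linear (det3 u v)"
  by (rule linearI) (simp_all add: det3_def det_3 algebra_simps)

lemma det3_same: "det3 u v u = 0" "det3 u v v = 0"
  by (simp_all add: det3_def det_3 algebra_simps)

text \<open>The first two slots will hold the pushed coordinate vectors, so only the last two need
  to vary. Each is presented as a replaced row, the shape in which the row rules for determinants
  are stated.\<close>

lemma bilinear_det4: "bilinear (det4 u v)"
proof -
  have "vector [u, v, w, z] = (\<chi> i. if i = 4 then z else (vector [u, v, w, 0] :: real^4^4) $ i)"
    "vector [u, v, w, z] = (\<chi> i. if i = 3 then w else (vector [u, v, 0, z] :: real^4^4) $ i)" for w z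
    by (simp_all add: vec_eq_iff forall_4)
  from this[THEN arg_cong[of _ _ det]]
  have e: "det4 u v w z = det (\<chi> i. if i = 4 then z else (vector [u, v, w, 0] :: real^4^4) $ i)"
    "det4 u v w z = det (\<chi> i. if i = 3 then w else (vector [u, v, 0, z] :: real^4^4) $ i)" for w z
    by (simp_all only: det4_def)
  have "det4 u v w (z + z') = det4 u v w z + det4 u v w z'" for w z z'
    unfolding e(1) by (rule det_row_add)
  moreover have "det4 u v w (r *\<^sub>R z) = r *\<^sub>R det4 u v w z" for w z r
    unfolding e(1) using det_row_mul[of 4 r "\<lambda>i. z"] by (simp only: scalar_mult_eq_scaleR real_scaleR_def)
  moreover have "det4 u v (w + w') z = det4 u v w z + det4 u v w' z" for w z w'
    unfolding e(2) by (rule det_row_add)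
  moreover have "det4 u v (r *\<^sub>R w) z = r *\<^sub>R det4 u v w z" for w z r
    unfolding e(2) using det_row_mul[of 3 r "\<lambda>i. w"] by (simp only: scalar_mult_eq_scaleR real_scaleR_def)
  ultimately show ?thesis by (auto simp: bilinear_def intro!: linearI)
qed

lemma det4_same: "det4 u v w u = 0" "det4 u v w v = 0" "det4 u v w w = 0"
  unfolding det4_def
  by (rule det_identical_rows[of 1 4] det_identical_rows[of 2 4] det_identical_rows[of 3 4];
      simp add: row_def vec_eq_iff)+

lemma det4_rotate: "det4 u v (a *\<^sub>R w + b *\<^sub>R z) (c *\<^sub>R w + d *\<^sub>R z) = (a * d - b * c) * det4 u v w z"
proof -
  note l = bilinear_ladd[OF bilinear_det4] bilinear_radd[OF bilinear_det4]
    bilinear_lmul[OF bilinear_det4] bilinear_rmul[OF bilinear_det4]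
  have "det4 u v z w = - det4 u v w z"
    using det4_same(3)[of u v "w + z"] det4_same(3)[of u v w] det4_same(3)[of u v z] by (simp add: l)
  then show ?thesis by (simp add: l det4_same algebra_simps)
qed

text \<open>Orthogonal plane vectors of equal length, positively oriented, differ by a quarter turn.
  Lagrange's identity gives ad - bc = r, and then (c + b)^2 + (d - a)^2 = 2r - 2r = 0. Used for
  tangent frames and for the uniqueness of \<open>J_perp\<close>.\<close>

lemma real_pair_rotation:
  fixes a b c d :: real
  assumes "a\<^sup>2 + b\<^sup>2 = r" "c\<^sup>2 + d\<^sup>2 = r" "a * c + b * d = 0" "a * d - b * c > 0"
  shows "c = - b" "d = a"
proof -
  have "r \<ge> 0" using assms(1) by (metis sum_power2_ge_zero)
  have "(a * d - b * c)\<^sup>2 = (a\<^sup>2 + b\<^sup>2) * (c\<^sup>2 + d\<^sup>2) - (a * c + b * d)\<^sup>2"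
    by (simp add: power2_eq_square algebra_simps)
  then have "(a * d - b * c)\<^sup>2 = r\<^sup>2" using assms by (simp add: power2_eq_square)
  then have "a * d - b * c = r" using assms(4) \<open>r \<ge> 0\<close> by (simp add: power2_eq_iff_nonneg)
  then have "(c + b)\<^sup>2 + (d - a)\<^sup>2 = 0"
    using assms(1,2) by (simp add: power2_eq_square algebra_simps)
  then show "c = - b" "d = a" by (simp_all add: sum_power2_eq_zero_iff)
qed

section \<open>Positive orthonormal frames of a surface\<close>

locale surface_patch = riem_patch g S for g :: "(real^2) cmetric" and S
begin

text \<open>Gram-Schmidt on the coordinate fields. The change of basis is triangular with positive
  diagonal, so orientation is preserved.\<close>

lemma exists_pos_frame: obtains e1 e2 where "pos_frame g S e1 e2"
proof -
  define n1 where "n1 x = sqrt (g x (axis 1 1) (axis 1 1))" for x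
  define e1 :: "real^2 \<Rightarrow> real^2" where "e1 x = inverse (n1 x) *\<^sub>R axis 1 1" for x
  define w where "w x = axis 2 1 - g x (axis 2 1) (e1 x) *\<^sub>R e1 x" for x
  define n2 where "n2 x = sqrt (g x (w x) (w x))" for x
  define e2 where "e2 x = inverse (n2 x) *\<^sub>R w x" for x
  have ax: "axis i (1::real) \<noteq> 0" for i :: 2 by (simp add: axis_eq_0_iff)
  have p1: "g x (axis 1 1) (axis 1 1) > 0" if "x \<in> S" for x by (rule pos[OF that ax])
  have n1: "n1 x > 0" if "x \<in> S" for x using p1[OF that] by (simp add: n1_def)
  \<comment> \<open>Since \<open>e1\<close> is a multiple of the first coordinate vector, the second
    component of \<open>w\<close> is 1 whatever the metric.\<close>
  have w0: "w x \<noteq> 0" for x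
  proof
    assume "w x = 0"
    then have "w x $ 2 = 0" by simp
    then show False by (simp add: w_def e1_def axis_def)
  qed
  have p2: "g x (w x) (w x) > 0" if "x \<in> S" for x by (rule pos[OF that w0])
  have n2: "n2 x > 0" if "x \<in> S" for x using p2[OF that] by (simp add: n2_def)
  have id: "(\<lambda>x. x) ` S \<subseteq> S" by simp
  note gs = g.smooth[OF open_S id smooth_on_id]
  have s1: "smooth_on S e1"
    unfolding e1_def n1_def
    by (rule smooth_on_scaleR[OF open_S smooth_on_inverse[OF open_S smooth_on_sqrt[OF open_S smooth_g p1] n1[unfolded n1_def, THEN less_imp_neq, symmetric]] smooth_on_const])
  have sw: "smooth_on S w"
    unfolding w_def
    by (rule smooth_on_diff[OF open_S smooth_on_const smooth_on_scaleR[OF open_S gs[OF smooth_on_const s1] s1]])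
  have s2: "smooth_on S e2"
    unfolding e2_def n2_def
    by (rule smooth_on_scaleR[OF open_S smooth_on_inverse[OF open_S smooth_on_sqrt[OF open_S gs[OF sw sw] p2] n2[unfolded n2_def, THEN less_imp_neq, symmetric]] sw])
  have "pos_onb g x (e1 x) (e2 x)" if x: "x \<in> S" for x
  proof -
    have 11: "g x (e1 x) (e1 x) = 1"
      using p1[OF x] n1[OF x] by (simp add: e1_def n1_def lin x field_simps)
    have "g x (e1 x) (w x) = 0"
      by (simp add: w_def lin x 11 sym[of x "e1 x"])
    then have 12: "g x (e1 x) (e2 x) = 0" by (simp add: e2_def lin x)
    have 22: "g x (e2 x) (e2 x) = 1"
      using p2[OF x] n2[OF x] by (simp add: e2_def n2_def lin x field_simps)
    have e2': "e2 x = (- (inverse (n2 x) * g x (axis 2 1) (e1 x) * inverse (n1 x))) *\<^sub>R axis 1 1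
      + inverse (n2 x) *\<^sub>R axis 2 1"
      by (simp add: e2_def w_def e1_def algebra_simps)
    have "det2 (e1 x) (e2 x) = inverse (n1 x) * inverse (n2 x)"
      unfolding e2' using det2_rotate[of "inverse (n1 x)" "axis 1 1" 0 "axis 2 1"
          "- (inverse (n2 x) * g x (axis 2 1) (e1 x) * inverse (n1 x))" "inverse (n2 x)"]
      by (simp only: e1_def det2_axis scaleR_zero_left add_0_right mult_zero_left diff_0_right mult_1_right)
    then show ?thesis using n1[OF x] n2[OF x] 11 12 22 by (simp add: pos_onb_def det2_def[symmetric])
  qed
  then have "pos_frame g S e1 e2"
    using s1 s2 open_S by (simp add: pos_frame_def)
  then show ?thesis by (rule that)
qed

lemma pos_onb_expand:
  assumes x: "x \<in> S" and e: "pos_onb g x e1 e2"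
  shows "u = g x u e1 *\<^sub>R e1 + g x u e2 *\<^sub>R e2"
proof -
  have "det (vector [e1, e2] :: real^2^2) \<noteq> 0" using e by (simp add: pos_onb_def)
  then obtain c :: "2 \<Rightarrow> real" where u: "u = c 1 *\<^sub>R e1 + c 2 *\<^sub>R e2"
    using det_nonzero_combination[of "vector [e1, e2]" u] by (auto simp: sum_2)
  have "g x u e1 = c 1" "g x u e2 = c 2"
    using e sym[OF x, of e2 e1] by (simp_all add: u lin x pos_onb_def)
  then show ?thesis using u by simp
qed

text \<open>The pair (a, b) stands for cosine and sine of the angle between the frames. Being given
  by the metric, it varies smoothly with smooth frames, whereas an angle would have to be
  chosen.\<close>

lemma pos_onb_rotation:
  assumes x: "x \<in> S" and e: "pos_onb g x e1 e2" and u: "pos_onb g x u v"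
  defines "a \<equiv> g x u e1" and "b \<equiv> g x u e2"
  shows "u = a *\<^sub>R e1 + b *\<^sub>R e2" "v = (- b) *\<^sub>R e1 + a *\<^sub>R e2" "a\<^sup>2 + b\<^sup>2 = 1"
proof -
  define c where "c = g x v e1"
  define d where "d = g x v e2"
  have e': "g x e1 e1 = 1" "g x e2 e2 = 1" "g x e1 e2 = 0" "g x e2 e1 = 0" "det2 e1 e2 > 0"
    using e sym[OF x, of e2 e1] by (simp_all add: pos_onb_def det2_def)
  have uu: "u = a *\<^sub>R e1 + b *\<^sub>R e2" unfolding a_def b_def by (rule pos_onb_expand[OF x e])
  have vv: "v = c *\<^sub>R e1 + d *\<^sub>R e2" unfolding c_def d_def by (rule pos_onb_expand[OF x e])
  have "g x u u = a\<^sup>2 + b\<^sup>2" "g x v v = c\<^sup>2 + d\<^sup>2" "g x u v = a * c + b * d"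
    by (subst (1 2) uu vv, simp add: lin x e' power2_eq_square)
      (subst (1 2) vv, simp add: lin x e' power2_eq_square,
       subst uu, subst vv, simp add: lin x e')
  then have "a\<^sup>2 + b\<^sup>2 = 1" "c\<^sup>2 + d\<^sup>2 = 1" "a * c + b * d = 0" using u by (simp_all add: pos_onb_def)
  moreover have "(a * d - b * c) * det2 e1 e2 > 0"
    using u unfolding det2_rotate[symmetric] uu[symmetric] vv[symmetric] by (simp add: pos_onb_def det2_def)
  then have "a * d - b * c > 0" using e'(5) by (simp add: zero_less_mult_iff)
  ultimately have "c = - b" "d = a" using real_pair_rotation by blast+
  with uu vv \<open>a\<^sup>2 + b\<^sup>2 = 1\<close> show "u = a *\<^sub>R e1 + b *\<^sub>R e2" "v = (- b) *\<^sub>R e1 + a *\<^sub>R e2" "a\<^sup>2 + b\<^sup>2 = 1"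
    by simp_all
qed

lemma pos_onb_rotate:
  assumes x: "x \<in> S" and e: "pos_onb g x e1 e2" and ab: "a\<^sup>2 + b\<^sup>2 = 1"
  shows "pos_onb g x (a *\<^sub>R e1 + b *\<^sub>R e2) ((- b) *\<^sub>R e1 + a *\<^sub>R e2)"
proof -
  have e': "g x e1 e1 = 1" "g x e2 e2 = 1" "g x e1 e2 = 0" "g x e2 e1 = 0" "det2 e1 e2 > 0"
    using e sym[OF x, of e2 e1] by (simp_all add: pos_onb_def det2_def)
  show ?thesis
    using det2_rotate[of a e1 b e2 "- b" a] e'(5) ab
    by (simp add: pos_onb_def det2_def lin x e' power2_eq_square)
qed

end

lemma (in riem_patch) smooth_g_fields:
  assumes "open W" "W \<subseteq> S" "smooth_on W X" "smooth_on W Y"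
  shows "smooth_on W (\<lambda>y. g y (X y) (Y y))"
  using g.smooth[OF assms(1) _ smooth_on_id assms(3,4)] assms(2) by simp

text \<open>Here a db - b da is the differential of the rotation angle. The field \<open>f1\<close>
  is differentiated and must be known near \<open>x\<close>; \<open>f2\<close> enters only by its
  value there.\<close>

lemma (in surface_patch) conn_form_rotation:
  assumes W: "W \<subseteq> S" "pos_frame g W e1 e2" and x: "x \<in> W"
    and ab: "smooth_on W a" "smooth_on W b" "a x ^ 2 + b x ^ 2 = 1"
    and f1: "\<And>y. y \<in> W \<Longrightarrow> f1 y = a y *\<^sub>R e1 y + b y *\<^sub>R e2 y"
    and f2: "f2 x = (- b x) *\<^sub>R e1 x + a x *\<^sub>R e2 x"
  shows "conn_form g f1 f2 x v = conn_form g e1 e2 x v + (a x * dd b x v - b x * dd a x v)"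
proof -
  have e: "open W" "smooth_on W e1" "smooth_on W e2" "\<And>y. y \<in> W \<Longrightarrow> pos_onb g y (e1 y) (e2 y)"
    using W(2) by (auto simp: pos_frame_def)
  interpret field_along g S W id using field_along_id[OF e(1) W(1)] .
  have xS: "x \<in> S" using x W by auto
  have onb: "g x (e1 x) (e1 x) = 1" "g x (e2 x) (e2 x) = 1" "g x (e1 x) (e2 x) = 0" "g x (e2 x) (e1 x) = 0"
    using e(4)[OF x] sym[OF xS, of "e2 x" "e1 x"] by (auto simp: pos_onb_def)
  let ?D = "\<lambda>X. cov_deriv g id X x v"
  \<comment> \<open>Products of frame fields are constant, so their derivatives vanish and the
    connection matrix in the frame is skew.\<close>
  have c: "dd (\<lambda>y. g y (X y) (Y y)) x v = 0"
    if "\<And>y. y \<in> W \<Longrightarrow> g y (X y) (Y y) = k" for X Y k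
    using dd_cong[OF e(1) x, of "\<lambda>y. g y (X y) (Y y)" "\<lambda>y. k"] that by simp
  have "g x (?D e1) (e1 x) + g x (e1 x) (?D e1) = 0"
    using metric_compat[OF e(2) e(2) x, of v] c[of e1 e1 1] e(4) by (auto simp: pos_onb_def)
  then have d11: "g x (?D e1) (e1 x) = 0" using sym[OF xS, of "e1 x" "?D e1"] by simp
  have "g x (?D e2) (e2 x) + g x (e2 x) (?D e2) = 0"
    using metric_compat[OF e(3) e(3) x, of v] c[of e2 e2 1] e(4) by (auto simp: pos_onb_def)
  then have d22: "g x (?D e2) (e2 x) = 0" using sym[OF xS, of "e2 x" "?D e2"] by simp
  have "g x (?D e1) (e2 x) + g x (e1 x) (?D e2) = 0"
    using metric_compat[OF e(2) e(3) x, of v] c[of e1 e2 0] e(4) by (auto simp: pos_onb_def)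
  then have d12: "g x (?D e2) (e1 x) = - g x (?D e1) (e2 x)" using sym[OF xS, of "e1 x" "?D e2"] by simp
  have "?D f1 = ?D (\<lambda>y. a y *\<^sub>R e1 y + b y *\<^sub>R e2 y)"
    by (rule cov_deriv_cong[OF e(1) x f1]) auto
  also have "\<dots> = dd a x v *\<^sub>R e1 x + a x *\<^sub>R ?D e1 + (dd b x v *\<^sub>R e2 x + b x *\<^sub>R ?D e2)"
    using cov_deriv_add[OF smooth_on_scaleR[OF e(1) ab(1) e(2)] smooth_on_scaleR[OF e(1) ab(2) e(3)] x]
      cov_deriv_scaleR[OF ab(1) e(2) x] cov_deriv_scaleR[OF ab(2) e(3) x] by simp
  finally have "conn_form g f1 f2 x v = (a x * dd b x v - b x * dd a x v) + (a x ^ 2 + b x ^ 2) * g x (?D e1) (e2 x)"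
    unfolding conn_form_def f2
    by (simp add: lin xS onb d11 d22 d12 algebra_simps power2_eq_square)
  then show ?thesis using ab(3) by (simp add: conn_form_def)
qed

section \<open>Surfaces with a parallel normal frame\<close>

lemma (in isometric_patch) field_along_restrict:
  "open W \<Longrightarrow> W \<subseteq> S \<Longrightarrow> field_along g' T W \<phi>"
  using \<phi>S smooth_on_subset[OF smooth_\<phi>] by unfold_locales auto

lemma dd_mult:
  fixes f h :: "'a::real_normed_vector \<Rightarrow> real"
  assumes "smooth_on W f" "smooth_on W h" "x \<in> W"
  shows "dd (\<lambda>y. f y * h y) x v = f x * dd h x v + dd f x v * h x"
  using dd_eqI[OF has_derivative_mult[OF smooth_on_dd_works[OF assms(1,3)] smooth_on_dd_works[OF assms(2,3)]]]
  by simp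

lemma dd_diff:
  assumes "smooth_on W f" "smooth_on W h" "x \<in> W"
  shows "dd (\<lambda>y. f y - h y) x v = dd f x v - dd h x v"
  using dd_eqI[OF has_derivative_diff[OF smooth_on_dd_works[OF assms(1,3)] smooth_on_dd_works[OF assms(2,3)]]]
  by simp

section \<open>Surfaces in a 4-manifold with an oriented orthonormal normal frame\<close>

locale normal_frame_patch = isometric_patch g S g' T \<phi>
  for g :: "(real^2) cmetric" and S and g' :: "(real^4) cmetric" and T and \<phi> +
  fixes \<nu> \<zeta> :: "real^2 \<Rightarrow> real^4"
  assumes smooth_\<nu>: "smooth_on S \<nu>" and smooth_\<zeta>: "smooth_on S \<zeta>"
    and frame: "\<And>x. x \<in> S \<Longrightarrow> pos_normal_onb g' \<phi> x (\<nu> x) (\<zeta> x)"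
begin

sublocale sp: surface_patch g S ..

lemma normal_onb:
  assumes x: "x \<in> S"
  shows "g' (\<phi> x) (\<nu> x) (\<nu> x) = 1" "g' (\<phi> x) (\<zeta> x) (\<zeta> x) = 1"
    "g' (\<phi> x) (\<nu> x) (\<zeta> x) = 0" "g' (\<phi> x) (\<zeta> x) (\<nu> x) = 0"
    "g' (\<phi> x) (\<nu> x) (dd \<phi> x u) = 0" "g' (\<phi> x) (\<zeta> x) (dd \<phi> x u) = 0"
    "g' (\<phi> x) (dd \<phi> x u) (\<nu> x) = 0" "g' (\<phi> x) (dd \<phi> x u) (\<zeta> x) = 0"
  using frame[OF x] tgt.sym[OF f.h_in[OF x]] by (auto simp: pos_normal_onb_def normal_space_def)

lemma det4_frame: "x \<in> S \<Longrightarrow> det4 (dd \<phi> x (axis 1 1)) (dd \<phi> x (axis 2 1)) (\<nu> x) (\<zeta> x) > 0"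
  using frame by (simp add: pos_normal_onb_def det4_def)

lemma decompose:
  assumes x: "x \<in> S"
  obtains t where "z = dd \<phi> x t + (g' (\<phi> x) z (\<nu> x) *\<^sub>R \<nu> x + g' (\<phi> x) z (\<zeta> x) *\<^sub>R \<zeta> x)"
proof -
  let ?A = "vector [dd \<phi> x (axis 1 1), dd \<phi> x (axis 2 1), \<nu> x, \<zeta> x] :: real^4^4"
  have "det ?A \<noteq> 0" using det4_frame[OF x] by (simp add: det4_def)
  then obtain c where z: "z = (\<Sum>i\<in>UNIV. c i *\<^sub>R ?A $ i)" by (rule det_nonzero_combination)
  have z': "z = dd \<phi> x (c 1 *\<^sub>R axis 1 1 + c 2 *\<^sub>R axis 2 1) + (c 3 *\<^sub>R \<nu> x + c 4 *\<^sub>R \<zeta> x)"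
    unfolding z by (simp add: sum_4 linear_add[OF linear_dd[OF x]] linear_cmul[OF linear_dd[OF x]])
  have "g' (\<phi> x) z (\<nu> x) = c 3" "g' (\<phi> x) z (\<zeta> x) = c 4"
    unfolding z' by (simp_all add: tgt.lin f.h_in[OF x] normal_onb[OF x])
  with z' show ?thesis using that by metis
qed

lemma normal_expand:
  assumes x: "x \<in> S" and "\<xi> \<in> normal_space g' \<phi> x"
  shows "\<xi> = g' (\<phi> x) \<xi> (\<nu> x) *\<^sub>R \<nu> x + g' (\<phi> x) \<xi> (\<zeta> x) *\<^sub>R \<zeta> x"
proof -
  obtain t where t: "\<xi> = dd \<phi> x t + (g' (\<phi> x) \<xi> (\<nu> x) *\<^sub>R \<nu> x + g' (\<phi> x) \<xi> (\<zeta> x) *\<^sub>R \<zeta> x)"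
    using decompose[OF x] .
  have "g' (\<phi> x) \<xi> (dd \<phi> x t) = 0" using assms by (simp add: normal_space_def)
  then have "g' (\<phi> x) (dd \<phi> x t) (dd \<phi> x t) = 0"
    by (subst (asm) t) (simp add: tgt.lin f.h_in[OF x] normal_onb[OF x])
  then have "dd \<phi> x t = 0" using tgt.g_zero_iff[OF f.h_in[OF x]] by simp
  with t show ?thesis by simp
qed

lemma combination_normal:
  "x \<in> S \<Longrightarrow> a *\<^sub>R \<nu> x + b *\<^sub>R \<zeta> x \<in> normal_space g' \<phi> x"
  by (simp add: normal_space_def tgt.lin f.h_in normal_onb)

lemma g_combination:
  "x \<in> S \<Longrightarrow> g' (\<phi> x) (a *\<^sub>R \<nu> x + b *\<^sub>R \<zeta> x) (c *\<^sub>R \<nu> x + d *\<^sub>R \<zeta> x) = a * c + b * d"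
  by (simp add: tgt.lin f.h_in normal_onb)

text \<open>In the frame the normal plane becomes the complex plane and \<open>J_perp\<close>
  multiplication by i. For the zero vector the orientation clause is void and the length condition
  fixes the value.\<close>

lemma J_perp_combination:
  assumes x: "x \<in> S"
  shows "J_perp g' \<phi> x (a *\<^sub>R \<nu> x + b *\<^sub>R \<zeta> x) = (- b) *\<^sub>R \<nu> x + a *\<^sub>R \<zeta> x"
  unfolding J_perp_def det4_def[symmetric]
proof (rule the_equality, intro conjI impI)
  let ?\<xi> = "a *\<^sub>R \<nu> x + b *\<^sub>R \<zeta> x" and ?D = "det4 (dd \<phi> x (axis 1 1)) (dd \<phi> x (axis 2 1))"
  show "(- b) *\<^sub>R \<nu> x + a *\<^sub>R \<zeta> x \<in> normal_space g' \<phi> x" by (rule combination_normal[OF x])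
  show "g' (\<phi> x) ?\<xi> ((- b) *\<^sub>R \<nu> x + a *\<^sub>R \<zeta> x) = 0" unfolding g_combination[OF x] by simp
  show "g' (\<phi> x) ((- b) *\<^sub>R \<nu> x + a *\<^sub>R \<zeta> x) ((- b) *\<^sub>R \<nu> x + a *\<^sub>R \<zeta> x) = g' (\<phi> x) ?\<xi> ?\<xi>"
    unfolding g_combination[OF x] by simp
  show "?D ?\<xi> ((- b) *\<^sub>R \<nu> x + a *\<^sub>R \<zeta> x) > 0" if "?\<xi> \<noteq> 0"
  proof -
    have "a \<noteq> 0 \<or> b \<noteq> 0" using that by auto
    then have "a * a - b * (- b) > 0" by (simp add: sum_squares_gt_zero_iff)
    then show ?thesis unfolding det4_rotate using det4_frame[OF x] by (rule mult_pos_pos)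
  qed
  fix \<xi>'
  assume *: "\<xi>' \<in> normal_space g' \<phi> x \<and> g' (\<phi> x) ?\<xi> \<xi>' = 0 \<and> g' (\<phi> x) \<xi>' \<xi>' = g' (\<phi> x) ?\<xi> ?\<xi>
    \<and> (?\<xi> \<noteq> 0 \<longrightarrow> 0 < ?D ?\<xi> \<xi>')"
  obtain c d where \<xi>': "\<xi>' = c *\<^sub>R \<nu> x + d *\<^sub>R \<zeta> x" using normal_expand[OF x] * by metis
  have n: "a * c + b * d = 0" "c\<^sup>2 + d\<^sup>2 = a\<^sup>2 + b\<^sup>2"
    using * unfolding \<xi>' g_combination[OF x] by (simp_all add: power2_eq_square)
  show "\<xi>' = (- b) *\<^sub>R \<nu> x + a *\<^sub>R \<zeta> x"
  proof (cases "?\<xi> = 0")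
    case True
    then have "a * a + b * b = 0" using g_combination[OF x, of a b a b] tgt.lin(7)[OF f.h_in[OF x]] by simp
    then have "a = 0" "b = 0" by (simp_all add: sum_squares_eq_zero_iff)
    then show ?thesis using n(2) unfolding \<xi>' by (simp add: sum_power2_eq_zero_iff)
  next
    case False
    then have "(a * d - b * c) * ?D (\<nu> x) (\<zeta> x) > 0" using * unfolding \<xi>' det4_rotate by simp
    then have "a * d - b * c > 0" using det4_frame[OF x] by (simp add: zero_less_mult_iff)
    then have "c = - b" "d = a" using real_pair_rotation[OF refl n(2) n(1)] by blast+
    then show ?thesis by (simp add: \<xi>')
  qed
qed

end

text \<open>In the application \<open>\<nu>\<close> is the image under \<open>j\<close> of the unit normal of \<open>F\<close>, and \<open>\<eta>\<close> is the umbilicity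
  vector of \<open>j\<close>.\<close>

locale flat_surface = normal_frame_patch +
  fixes c :: real
  assumes parallel_\<nu>: "\<And>x u. x \<in> S \<Longrightarrow> \<exists>t. cov_deriv g' \<phi> \<nu> x u = dd \<phi> x t"
    and sff_form: "\<And>x. x \<in> S \<Longrightarrow> \<exists>\<eta>. g' (\<phi> x) (\<nu> x) \<eta> = 0 \<and>
      (\<forall>u v. sff g' \<phi> x u v = g' (\<phi> x) (sff g' \<phi> x u v) (\<nu> x) *\<^sub>R \<nu> x + g x u v *\<^sub>R \<eta>)"
    and not_umbilic: "\<And>x. x \<in> S \<Longrightarrow> \<not> (\<exists>k. \<forall>u v. g' (\<phi> x) (sff g' \<phi> x u v) (\<nu> x) = k * g x u v)"
    and const_curv: "\<And>y u v. y \<in> T \<Longrightarrow> u \<noteq> v \<Longrightarrow> independent {u, v} \<Longrightarrow> sec_curv g' y u v = c"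
begin

text \<open>The scalar second fundamental form in the direction of \<open>\<nu>\<close>; in the
  application it is that of \<open>F\<close>.\<close>

definition II :: "real^2 \<Rightarrow> real^2 \<Rightarrow> real^2 \<Rightarrow> real" where
  "II x u v = g' (\<phi> x) (sff g' \<phi> x u v) (\<nu> x)"

lemma II_lin:
  assumes x: "x \<in> S"
  shows "II x (u + u') v = II x u v + II x u' v" "II x u (v + v') = II x u v + II x u v'"
    "II x (r *\<^sub>R u) v = r * II x u v" "II x u (r *\<^sub>R v) = r * II x u v"
  by (simp_all add: II_def sff_lin x tgt.lin f.h_in[OF x])

lemma II_sym: "x \<in> S \<Longrightarrow> II x u v = II x v u"
  by (simp add: II_def sff_sym)

lemma sff_II:
  assumes "x \<in> S"
  obtains \<eta> where "g' (\<phi> x) (\<nu> x) \<eta> = 0" "g' (\<phi> x) \<eta> (\<nu> x) = 0"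
    "\<And>u v. sff g' \<phi> x u v = II x u v *\<^sub>R \<nu> x + g x u v *\<^sub>R \<eta>"
proof -
  obtain \<eta> where "g' (\<phi> x) (\<nu> x) \<eta> = 0" "\<forall>u v. sff g' \<phi> x u v = II x u v *\<^sub>R \<nu> x + g x u v *\<^sub>R \<eta>"
    using sff_form[OF assms] unfolding II_def by auto
  then show ?thesis using that tgt.sym[OF f.h_in[OF assms], of "\<nu> x" \<eta>] by simp
qed

lemma smooth_II:
  assumes W: "open W" "W \<subseteq> S" and "smooth_on W X" "smooth_on W Y"
  shows "smooth_on W (\<lambda>y. II y (X y) (Y y))"
proof -
  have "smooth_on W (\<lambda>y. sff g' \<phi> y (X y) (Y y))"
    using II.smooth[OF W(1) _ smooth_on_id assms(3,4)] W(2) by simp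
  from tgt.g.smooth[OF W(1) _ smooth_on_subset[OF smooth_\<phi> W(2)] this smooth_on_subset[OF smooth_\<nu> W(2)]]
  show ?thesis using W(2) \<phi>S by (auto simp: II_def)
qed

lemma cov_deriv_tangential:
  assumes x: "x \<in> S"
  obtains t where "cov_deriv g' \<phi> \<nu> x u = dd \<phi> x t"
  using parallel_\<nu>[OF x] by blast

text \<open>In a normal plane one parallel unit field forces the other: the \<open>\<zeta>\<close>
  component of the derivative vanishes by constant length, the \<open>\<nu>\<close> component by
  orthogonality and the parallelism of \<open>\<nu>\<close>.\<close>

lemma parallel_\<zeta>:
  assumes x: "x \<in> S"
  obtains t where "cov_deriv g' \<phi> \<zeta> x u = dd \<phi> x t"
proof -
  have c: "dd (\<lambda>y. g' (\<phi> y) (X y) (Y y)) x u = 0"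
    if "\<And>y. y \<in> S \<Longrightarrow> g' (\<phi> y) (X y) (Y y) = k" for X Y k
    using dd_cong[OF src.open_S x, of "\<lambda>y. g' (\<phi> y) (X y) (Y y)" "\<lambda>y. k"] that by simp
  let ?D = "\<lambda>X. cov_deriv g' \<phi> X x u"
  obtain s where s: "?D \<nu> = dd \<phi> x s" using cov_deriv_tangential[OF x] .
  have "g' (\<phi> x) (?D \<zeta>) (\<zeta> x) + g' (\<phi> x) (\<zeta> x) (?D \<zeta>) = 0"
    using f.metric_compat[OF smooth_\<zeta> smooth_\<zeta> x, of u] c[of \<zeta> \<zeta> 1] by (simp add: normal_onb)
  then have 1: "g' (\<phi> x) (?D \<zeta>) (\<zeta> x) = 0"
    using tgt.sym[OF f.h_in[OF x], of "\<zeta> x" "?D \<zeta>"] by simp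
  have 2: "g' (\<phi> x) (?D \<zeta>) (\<nu> x) = 0"
    using f.metric_compat[OF smooth_\<zeta> smooth_\<nu> x, of u] c[of \<zeta> \<nu> 0] by (simp add: normal_onb s x)
  obtain t where "?D \<zeta> = dd \<phi> x t + (g' (\<phi> x) (?D \<zeta>) (\<nu> x) *\<^sub>R \<nu> x + g' (\<phi> x) (?D \<zeta>) (\<zeta> x) *\<^sub>R \<zeta> x)"
    using decompose[OF x] .
  then show ?thesis using that by (simp add: 1 2)
qed

text \<open>In a parallel frame the normal connection merely differentiates coefficients. The open
  subset \<open>W\<close> is allowed because coefficients arise later only on the domain of some
  frame.\<close>

lemma normal_conn_combination:
  assumes W: "open W" "W \<subseteq> S" and x: "x \<in> W" and ab: "smooth_on W a" "smooth_on W b"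
    and \<xi>: "\<And>y. y \<in> W \<Longrightarrow> \<xi> y = a y *\<^sub>R \<nu> y + b y *\<^sub>R \<zeta> y"
  shows "normal_conn g' \<phi> \<xi> x u = dd a x u *\<^sub>R \<nu> x + dd b x u *\<^sub>R \<zeta> x"
proof -
  interpret w: field_along g' T W \<phi> by (rule field_along_restrict[OF W])
  have xS: "x \<in> S" using x W by auto
  note s = smooth_on_subset[OF smooth_\<nu> W(2)] smooth_on_subset[OF smooth_\<zeta> W(2)]
  obtain t1 where t1: "cov_deriv g' \<phi> \<nu> x u = dd \<phi> x t1" using cov_deriv_tangential[OF xS] .
  obtain t2 where t2: "cov_deriv g' \<phi> \<zeta> x u = dd \<phi> x t2" using parallel_\<zeta>[OF xS] .
  have "cov_deriv g' \<phi> \<xi> x u = cov_deriv g' \<phi> (\<lambda>y. a y *\<^sub>R \<nu> y + b y *\<^sub>R \<zeta> y) x u"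
    by (rule cov_deriv_cong[OF W(1) x \<xi>]) auto
  also have "\<dots> = (dd a x u *\<^sub>R \<nu> x + a x *\<^sub>R dd \<phi> x t1) + (dd b x u *\<^sub>R \<zeta> x + b x *\<^sub>R dd \<phi> x t2)"
    using w.cov_deriv_add[OF smooth_on_scaleR[OF W(1) ab(1) s(1)] smooth_on_scaleR[OF W(1) ab(2) s(2)] x]
      w.cov_deriv_scaleR[OF ab(1) s(1) x] w.cov_deriv_scaleR[OF ab(2) s(2) x] by (simp add: t1 t2)
  also have "\<dots> = dd \<phi> x (a x *\<^sub>R t1 + b x *\<^sub>R t2) + (dd a x u *\<^sub>R \<nu> x + dd b x u *\<^sub>R \<zeta> x)"
    by (simp add: linear_add[OF linear_dd[OF xS]] linear_cmul[OF linear_dd[OF xS]])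
  finally show ?thesis
    unfolding normal_conn_def by (simp only: normal_part_eq[OF xS combination_normal[OF xS]])
qed

text \<open>Coefficients in the parallel frame have symmetric second derivatives. The frame in the
  description of \<open>normal_curv\<close> may extend beyond \<open>S\<close>, hence the
  restriction to the intersection.\<close>

lemma normal_curv_op_zero:
  assumes e: "pos_normal_frame g' \<phi> W e3 e4" and x: "x \<in> W" "x \<in> S"
  shows "normal_curv_op g' \<phi> e4 x u v = 0"
proof -
  define V where "V = W \<inter> S"
  have V: "open V" "V \<subseteq> S" "x \<in> V" "V \<subseteq> W"
    using e x src.open_S by (auto simp: V_def pos_normal_frame_def)
  define a where "a y = g' (\<phi> y) (e4 y) (\<nu> y)" for y
  define b where "b y = g' (\<phi> y) (e4 y) (\<zeta> y)" for y
  have "smooth_on V e4" using e V smooth_on_subset by (auto simp: pos_normal_frame_def)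
  note sm = tgt.g.smooth[OF V(1) _ smooth_on_subset[OF smooth_\<phi> V(2)] this smooth_on_subset[OF _ V(2)]]
  have \<phi>V: "\<phi> ` V \<subseteq> T" using \<phi>S V by auto
  have ab: "smooth_on V a" "smooth_on V b"
    unfolding a_def b_def by (rule sm[OF \<phi>V smooth_\<nu>] sm[OF \<phi>V smooth_\<zeta>])+
  have e4: "e4 y = a y *\<^sub>R \<nu> y + b y *\<^sub>R \<zeta> y" if "y \<in> V" for y
    unfolding a_def b_def using e that V
    by (intro normal_expand) (auto simp: pos_normal_frame_def pos_normal_onb_def)
  have 1: "normal_conn g' \<phi> e4 y w = dd a y w *\<^sub>R \<nu> y + dd b y w *\<^sub>R \<zeta> y" if "y \<in> V" for y w
    by (rule normal_conn_combination[OF V(1,2) that ab e4])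
  have 2: "normal_conn g' \<phi> (\<lambda>y. normal_conn g' \<phi> e4 y w) x w'
    = dd (\<lambda>y. dd a y w) x w' *\<^sub>R \<nu> x + dd (\<lambda>y. dd b y w) x w' *\<^sub>R \<zeta> x" for w w'
    by (rule normal_conn_combination[OF V(1,2,3) smooth_on_dd[OF ab(1)] smooth_on_dd[OF ab(2)] 1])
  show ?thesis
    unfolding normal_curv_op_def 2
    using symmetric_second_derivative[OF V(1,3) ab(1), of u v] symmetric_second_derivative[OF V(1,3) ab(2), of u v]
    by simp
qed

lemma normal_curv_zero:
  assumes x: "x \<in> S"
  shows "normal_curv g g' \<phi> x = 0"
  unfolding normal_curv_def
proof (rule the_equality)
  show "\<forall>u v W e3 e4. pos_onb g x u v \<and> pos_normal_frame g' \<phi> W e3 e4 \<and> x \<in> W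
      \<longrightarrow> 0 = g' (\<phi> x) (normal_curv_op g' \<phi> e4 x u v) (e3 x)"
    by (auto simp: normal_curv_op_zero[OF _ _ x] tgt.lin f.h_in[OF x])
  fix r assume r: "\<forall>u v W e3 e4. pos_onb g x u v \<and> pos_normal_frame g' \<phi> W e3 e4 \<and> x \<in> W
      \<longrightarrow> r = g' (\<phi> x) (normal_curv_op g' \<phi> e4 x u v) (e3 x)"
  \<comment> \<open>One tangent and one normal frame must be exhibited; without them the description
    would admit every real number.\<close>
  obtain e1 e2 where e: "pos_frame g S e1 e2" by (rule sp.exists_pos_frame)
  have n: "pos_normal_frame g' \<phi> S \<nu> \<zeta>"
    by (simp add: pos_normal_frame_def src.open_S smooth_\<nu> smooth_\<zeta> frame)
  have "r = g' (\<phi> x) (normal_curv_op g' \<phi> \<zeta> x (e1 x) (e2 x)) (\<nu> x)"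
    using r e n x by (auto simp: pos_frame_def)
  then show "r = 0" by (simp add: normal_curv_op_zero[OF n x x] tgt.lin f.h_in[OF x])
qed

text \<open>The diagonal entry of the trace-free part of \<open>II\<close> in the frame u, v, that
  is the p of p + iq.\<close>

definition half_diff :: "real^2 \<Rightarrow> real^2 \<Rightarrow> real^2 \<Rightarrow> real" where
  "half_diff x u v = (II x u u - II x v v) / 2"

text \<open>If both components of the trace-free part vanish in one frame, \<open>II\<close> is a
  multiple of the metric, against \<open>not_umbilic\<close>.\<close>

lemma umbilic_discriminant:
  assumes x: "x \<in> S" and e: "pos_onb g x e1 e2"
  shows "(half_diff x e1 e2)\<^sup>2 + (II x e1 e2)\<^sup>2 > 0"
proof (rule ccontr)
  assume "\<not> ?thesis"
  then have z: "half_diff x e1 e2 = 0" "II x e1 e2 = 0"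
    by (auto simp: not_less sum_power2_le_zero_iff)
  then have z': "II x e2 e2 = II x e1 e1" "II x e2 e1 = 0" by (auto simp: half_diff_def II_sym[OF x, of e2 e1])
  have "II x u v = II x e1 e1 * g x u v" for u v
  proof -
    define a b c d where "a = g x u e1" "b = g x u e2" "c = g x v e1" "d = g x v e2"
    have u: "u = a *\<^sub>R e1 + b *\<^sub>R e2" "v = c *\<^sub>R e1 + d *\<^sub>R e2"
      unfolding a_b_c_d_def by (rule sp.pos_onb_expand[OF x e])+
    show ?thesis
      unfolding u using e src.sym[OF x, of e2 e1]
      by (simp add: II_lin[OF x] src.lin x z z' pos_onb_def algebra_simps)
  qed
  then show False using not_umbilic[OF x] unfolding II_def by metis
qed

text \<open>Rotating the frame leaves the trace unchanged: the mixed terms cancel and a^2 + b^2 = 1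
  remains as a factor.\<close>

lemma mean_curv_eq:
  assumes x: "x \<in> S" and e: "pos_onb g x e1 e2"
  shows "mean_curv g g' \<phi> x = (1/2) *\<^sub>R (sff g' \<phi> x e1 e1 + sff g' \<phi> x e2 e2)"
  unfolding mean_curv_def
proof (rule the_equality)
  show "\<forall>u v. pos_onb g x u v \<longrightarrow>
    (1/2) *\<^sub>R (sff g' \<phi> x e1 e1 + sff g' \<phi> x e2 e2) = (1/2) *\<^sub>R (sff g' \<phi> x u u + sff g' \<phi> x v v)"
  proof (intro allI impI)
    fix u v assume u: "pos_onb g x u v"
    define a b where "a = g x u e1" "b = g x u e2"
    have r: "u = a *\<^sub>R e1 + b *\<^sub>R e2" "v = (- b) *\<^sub>R e1 + a *\<^sub>R e2" "a\<^sup>2 + b\<^sup>2 = 1"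
      unfolding a_b_def by (rule sp.pos_onb_rotation[OF x e u])+
    have "sff g' \<phi> x u u + sff g' \<phi> x v v = (a\<^sup>2 + b\<^sup>2) *\<^sub>R (sff g' \<phi> x e1 e1 + sff g' \<phi> x e2 e2)"
      unfolding r(1,2)
      by (simp add: sff_lin bilinear_lsub[OF sff_bilinear] bilinear_rsub[OF sff_bilinear] x sff_sym[OF x, of e2 e1]
          power2_eq_square algebra_simps)
    then show "(1/2) *\<^sub>R (sff g' \<phi> x e1 e1 + sff g' \<phi> x e2 e2) = (1/2) *\<^sub>R (sff g' \<phi> x u u + sff g' \<phi> x v v)"
      by (simp add: r(3))
  qed
qed (use e in auto)

text \<open>\<open>gauss_curv\<close> is computed on coordinate vectors, while \<open>II\<close> is
  wanted in an orthonormal frame; the determinants of both forms scale by the same factor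
  \<open>G\<close>. The vector \<open>\<eta>\<close> is delivered with the value because
  \<open>sff_form\<close> only asserts its existence.\<close>

lemma gauss_curv_eq:
  assumes x: "x \<in> S" and e: "pos_onb g x e1 e2"
  obtains \<eta> where "g' (\<phi> x) (\<nu> x) \<eta> = 0" "g' (\<phi> x) \<eta> (\<nu> x) = 0"
    "\<And>u v. sff g' \<phi> x u v = II x u v *\<^sub>R \<nu> x + g x u v *\<^sub>R \<eta>"
    "gauss_curv g x = c + g' (\<phi> x) \<eta> \<eta> + (II x e1 e1 * II x e2 e2 - (II x e1 e2)\<^sup>2)"
proof -
  obtain \<eta> where \<eta>: "g' (\<phi> x) (\<nu> x) \<eta> = 0" "g' (\<phi> x) \<eta> (\<nu> x) = 0"
    "\<And>u v. sff g' \<phi> x u v = II x u v *\<^sub>R \<nu> x + g x u v *\<^sub>R \<eta>"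
    using sff_II[OF x] by metis
  let ?u = "axis 1 1 :: real^2" and ?v = "axis 2 1 :: real^2"
  define G where "G = g x ?u ?u * g x ?v ?v - (g x ?u ?v)\<^sup>2"
  define k where "k = II x e1 e1 * II x e2 e2 - (II x e1 e2)\<^sup>2"
  define a1 b1 a2 b2 where "a1 = g x ?u e1" "b1 = g x ?u e2" "a2 = g x ?v e1" "b2 = g x ?v e2"
  have uv: "?u = a1 *\<^sub>R e1 + b1 *\<^sub>R e2" "?v = a2 *\<^sub>R e1 + b2 *\<^sub>R e2"
    unfolding a1_b1_a2_b2_def by (rule sp.pos_onb_expand[OF x e])+
  have onb: "g x e1 e1 = 1" "g x e2 e2 = 1" "g x e1 e2 = 0" "g x e2 e1 = 0"
    using e src.sym[OF x, of e2 e1] by (simp_all add: pos_onb_def)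
  have G: "G = (a1 * b2 - b1 * a2)\<^sup>2"
    unfolding G_def uv by (simp add: src.lin x onb power2_eq_square algebra_simps)
  have detII: "II x ?u ?u * II x ?v ?v - (II x ?u ?v)\<^sup>2 = k * G"
    unfolding G k_def uv by (simp add: II_lin[OF x] II_sym[OF x, of e2 e1] power2_eq_square algebra_simps)
  have "G > 0"
  proof -
    have "det2 ?u ?v = (a1 * b2 - b1 * a2) * det2 e1 e2"
      by (subst uv(1), subst uv(2)) (rule det2_rotate)
    then have "a1 * b2 - b1 * a2 \<noteq> 0" by (auto simp: det2_axis)
    then show ?thesis unfolding G by simp
  qed
  \<comment> \<open>The curvature hypothesis concerns distinct, independent vectors, so injectivity
    of the differential enters here.\<close>
  have ne: "dd \<phi> x ?u \<noteq> dd \<phi> x ?v"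
    by (simp add: dd_inj[OF x] axis_eq_axis)
  have ind: "independent {dd \<phi> x ?u, dd \<phi> x ?v}"
  proof -
    have "independent {?u, ?v}"
      by (rule independent_mono[OF independent_Basis]) (auto simp: Basis_vec_def)
    then have "independent (dd \<phi> x ` {?u, ?v})"
      by (rule linear_independent_injective_image[OF linear_dd[OF x]])
        (simp add: inj_on_def dd_inj[OF x])
    then show ?thesis by simp
  qed
  have "sec_curv g' (\<phi> x) (dd \<phi> x ?u) (dd \<phi> x ?v) = c"
    by (rule const_curv[OF f.h_in[OF x] ne ind])
  then have "g' (\<phi> x) (curv g' (\<phi> x) (dd \<phi> x ?u) (dd \<phi> x ?v) (dd \<phi> x ?v)) (dd \<phi> x ?u) = c * G"
    using \<open>G > 0\<close> by (simp add: sec_curv_def G_def iso[OF x, symmetric] field_simps)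
  then have "g x (curv g x ?u ?v ?v) ?u = c * G
    + g' (\<phi> x) (sff g' \<phi> x ?u ?u) (sff g' \<phi> x ?v ?v) - g' (\<phi> x) (sff g' \<phi> x ?u ?v) (sff g' \<phi> x ?u ?v)"
    unfolding gauss_equation[OF x] by simp
  also have "\<dots> = c * G + (II x ?u ?u * II x ?v ?v - (II x ?u ?v)\<^sup>2) + g' (\<phi> x) \<eta> \<eta> * G"
    unfolding \<eta>(3) G_def
    by (simp add: tgt.lin f.h_in[OF x] \<eta>(1,2) normal_onb[OF x] power2_eq_square algebra_simps)
  finally have "gauss_curv g x = c + g' (\<phi> x) \<eta> \<eta> + k"
    using \<open>G > 0\<close> unfolding detII gauss_curv_def sec_curv_def G_def[symmetric]
    by (simp add: field_simps)
  then show ?thesis using that \<eta> unfolding k_def by blast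
qed

text \<open>With t the mean of the diagonal entries of \<open>II\<close>, t^2 minus its determinant
  is p^2 + q^2, and the squared length of \<open>\<eta>\<close> occurs both in the mean curvature
  and in K - c, so it cancels.\<close>

lemma M0_empty:
  assumes x: "x \<in> S"
  shows "\<not> M0_at c s g g' \<phi> x"
proof -
  obtain e1 e2 where "pos_frame g S e1 e2" by (rule sp.exists_pos_frame)
  then have e: "pos_onb g x (e1 x) (e2 x)" using x by (simp add: pos_frame_def)
  obtain \<eta> where \<eta>: "g' (\<phi> x) (\<nu> x) \<eta> = 0" "g' (\<phi> x) \<eta> (\<nu> x) = 0"
    "\<And>u v. sff g' \<phi> x u v = II x u v *\<^sub>R \<nu> x + g x u v *\<^sub>R \<eta>"
    "gauss_curv g x = c + g' (\<phi> x) \<eta> \<eta>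
      + (II x (e1 x) (e1 x) * II x (e2 x) (e2 x) - (II x (e1 x) (e2 x))\<^sup>2)"
    using gauss_curv_eq[OF x e] by metis
  have "mean_curv g g' \<phi> x = ((II x (e1 x) (e1 x) + II x (e2 x) (e2 x)) / 2) *\<^sub>R \<nu> x + \<eta>"
    unfolding mean_curv_eq[OF x e] \<eta>(3) using e
    by (simp add: pos_onb_def scaleR_add_left scaleR_add_right add_divide_distrib flip: scaleR_2 add: scaleR_half_double)
  then have "g' (\<phi> x) (mean_curv g g' \<phi> x) (mean_curv g g' \<phi> x)
    = ((II x (e1 x) (e1 x) + II x (e2 x) (e2 x)) / 2)\<^sup>2 + g' (\<phi> x) \<eta> \<eta>"
    by (simp add: tgt.lin f.h_in[OF x] \<eta>(1,2) normal_onb[OF x] power2_eq_square)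
  then have "g' (\<phi> x) (mean_curv g g' \<phi> x) (mean_curv g g' \<phi> x) - (gauss_curv g x - c)
    = (half_diff x (e1 x) (e2 x))\<^sup>2 + (II x (e1 x) (e2 x))\<^sup>2"
    unfolding \<eta>(4) half_diff_def by (simp add: power2_eq_square field_simps)
  then show ?thesis
    using umbilic_discriminant[OF x e] unfolding M0_at_def normal_curv_zero[OF x] by linarith
qed

text \<open>The right-hand side is the differential of the argument of p + iq. The
  \<open>\<zeta>\<close> component of the normalized field carries \<open>s\<close>, so its
  connection form does too, and the factor in front removes it.\<close>

lemma mixed_normal_conn_form:
  assumes W: "W \<subseteq> S" "pos_frame g W e1 e2" and x: "x \<in> W" and s: "s\<^sup>2 = 1"
  defines "p \<equiv> \<lambda>y. half_diff y (e1 y) (e2 y)" and "q \<equiv> \<lambda>y. II y (e1 y) (e2 y)"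
  shows "s * normal_conn_form g' \<phi> (mixed_e3 s g' \<phi> e1 e2) (mixed_e4 s g' \<phi> e1 e2) x v
    = (p x * dd q x v - q x * dd p x v) / (p x ^ 2 + q x ^ 2)"
proof -
  have e: "open W" "smooth_on W e1" "smooth_on W e2" "\<And>y. y \<in> W \<Longrightarrow> pos_onb g y (e1 y) (e2 y)"
    using W(2) by (auto simp: pos_frame_def)
  have xS: "x \<in> S" using x W by auto
  have sq: "smooth_on W q" unfolding q_def by (rule smooth_II[OF e(1) W(1) e(2,3)])
  have sp: "smooth_on W p"
    unfolding p_def half_diff_def
    by (rule smooth_on_divide[OF e(1) smooth_on_diff[OF e(1) smooth_II[OF e(1) W(1) e(2,2)]
            smooth_II[OF e(1) W(1) e(3,3)]] smooth_on_const]) simp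
  define r where "r y = sqrt (p y ^ 2 + q y ^ 2)" for y
  have disc: "p y ^ 2 + q y ^ 2 > 0" if "y \<in> W" for y
    using umbilic_discriminant[OF _ e(4)[OF that]] that W by (auto simp: p_def q_def)
  then have r: "r y > 0" "r y * r y = p y ^ 2 + q y ^ 2" if "y \<in> W" for y
    using that by (auto simp: r_def less_imp_le)
  have sr: "smooth_on W r"
    unfolding r_def
    by (rule smooth_on_sqrt[OF e(1) smooth_on_add[OF e(1) smooth_on_power[OF e(1) sp] smooth_on_power[OF e(1) sq]] disc])
  define a where "a y = p y / r y" for y
  define b where "b y = s * q y / r y" for y
  have sa: "smooth_on W a"
    unfolding a_def by (rule smooth_on_divide[OF e(1) sp sr r(1)[THEN less_imp_neq, symmetric]])
  have sb: "smooth_on W b"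
    unfolding b_def
    by (rule smooth_on_divide[OF e(1) smooth_on_mult[OF e(1) smooth_on_const sq] sr r(1)[THEN less_imp_neq, symmetric]])
  have ss: "s * s = 1" using s by (simp add: power2_eq_square)
  have field: "mixed_field s g' \<phi> e1 e2 y = p y *\<^sub>R \<nu> y + (s * q y) *\<^sub>R \<zeta> y" if y: "y \<in> W" for y
  proof -
    have yS: "y \<in> S" using y W by auto
    obtain \<eta> where \<eta>: "\<And>u v. sff g' \<phi> y u v = II y u v *\<^sub>R \<nu> y + g y u v *\<^sub>R \<eta>"
      using sff_II[OF yS] by metis
    \<comment> \<open>The \<open>\<eta>\<close> part drops out because the frame is orthogonal; the
      zero multiple of \<open>\<zeta>\<close> matches the shape of
      \<open>J_perp_combination\<close>.\<close>
    have "sff g' \<phi> y (e1 y) (e2 y) = q y *\<^sub>R \<nu> y + 0 *\<^sub>R \<zeta> y"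
      unfolding \<eta> using e(4)[OF y] by (simp add: pos_onb_def q_def)
    then have "J_perp g' \<phi> y (sff g' \<phi> y (e1 y) (e2 y)) = q y *\<^sub>R \<zeta> y"
      using J_perp_combination[OF yS, of "q y" 0] by simp
    moreover have "sff g' \<phi> y (e1 y) (e1 y) - sff g' \<phi> y (e2 y) (e2 y) = (2 * p y) *\<^sub>R \<nu> y"
    proof -
      have "2 * p y = II y (e1 y) (e1 y) - II y (e2 y) (e2 y)" by (simp add: p_def half_diff_def)
      then show ?thesis
        unfolding \<eta> using e(4)[OF y] by (simp add: pos_onb_def scaleR_diff_left)
    qed
    ultimately show ?thesis by (simp add: mixed_field_def)
  qed
  have e3: "mixed_e3 s g' \<phi> e1 e2 y = a y *\<^sub>R \<nu> y + b y *\<^sub>R \<zeta> y" if y: "y \<in> W" for y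
  proof -
    have yS: "y \<in> S" using y W by auto
    have "p y * p y + s * q y * (s * q y) = p y ^ 2 + q y ^ 2"
      using ss by (simp add: power2_eq_square algebra_simps)
    then show ?thesis
      unfolding mixed_e3_def field[OF y] g_combination[OF yS]
      by (simp add: r_def[symmetric] a_def b_def divide_inverse scaleR_add_right mult.commute)
  qed
  have e4: "mixed_e4 s g' \<phi> e1 e2 x = (- b x) *\<^sub>R \<nu> x + a x *\<^sub>R \<zeta> x"
    unfolding mixed_e4_def e3[OF x] by (rule J_perp_combination[OF xS])
  have nc: "normal_conn_form g' \<phi> (mixed_e3 s g' \<phi> e1 e2) (mixed_e4 s g' \<phi> e1 e2) x v
    = dd a x v * (- b x) + dd b x v * a x"
  proof -
    have "normal_conn g' \<phi> (mixed_e3 s g' \<phi> e1 e2) x v = dd a x v *\<^sub>R \<nu> x + dd b x v *\<^sub>R \<zeta> x"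
      by (rule normal_conn_combination[OF e(1) W(1) x sa sb]) (rule e3)
    then show ?thesis
      unfolding normal_conn_form_def e4 by (simp only: g_combination[OF xS])
  qed
  \<comment> \<open>Differentiating p = r a and q = s r b avoids derivatives of roots and quotients;
    the terms with the derivative of \<open>r\<close> cancel in p dq - q dp.\<close>
  have dp: "dd p x v = r x * dd a x v + dd r x v * a x"
  proof -
    have "dd p x = dd (\<lambda>y. r y * a y) x"
      by (rule dd_cong[OF e(1) x]) (use r in \<open>force simp: a_def\<close>)
    then show ?thesis
      using dd_eqI[OF has_derivative_mult[OF smooth_on_dd_works[OF sr x] smooth_on_dd_works[OF sa x]]] by simp
  qed
  have dq: "dd q x v = s * (r x * dd b x v + dd r x v * b x)"
  proof -
    have "dd q x = dd (\<lambda>y. s * (r y * b y)) x"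
      by (rule dd_cong[OF e(1) x]) (use r ss in \<open>force simp: b_def mult.assoc[symmetric]\<close>)
    then show ?thesis
      using dd_eqI[OF has_derivative_mult_right[OF has_derivative_mult[OF smooth_on_dd_works[OF sr x]
              smooth_on_dd_works[OF sb x]]], of s] by simp
  qed
  have rx: "r x \<noteq> 0" using r[OF x] by simp
  have px: "p x = r x * a x" "q x = s * (r x * b x)"
    using rx ss by (simp_all add: a_def b_def mult.assoc[symmetric])
  have "p x * dd q x v - q x * dd p x v = (r x * r x) * (s * (a x * dd b x v - b x * dd a x v))"
    unfolding dp dq px by (simp add: algebra_simps)
  then show ?thesis
    unfolding nc r(2)[OF x, symmetric] using rx by (simp add: field_simps)
qed

text \<open>Double-angle formulas: with (a, b) the cosine and sine of an angle, p + iq is multiplied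
  by (a - ib)^2.\<close>

lemma II_rotation:
  assumes x: "x \<in> S"
  shows "half_diff x (a *\<^sub>R u + b *\<^sub>R v) ((- b) *\<^sub>R u + a *\<^sub>R v)
      = (a * a - b * b) * half_diff x u v + 2 * (a * b) * II x u v"
    "II x (a *\<^sub>R u + b *\<^sub>R v) ((- b) *\<^sub>R u + a *\<^sub>R v)
      = (a * a - b * b) * II x u v - 2 * (a * b) * half_diff x u v"
  unfolding half_diff_def II_lin[OF x] II_sym[OF x, of v u] by (simp_all add: field_simps)

text \<open>Rotating a frame by the angle \<open>\<theta>\<close>, encoded by \<open>a = cos \<theta>\<close> and \<open>b = sin \<theta>\<close>, adds \<open>d\<theta>\<close> to
  \<open>\<omega>\<^sub>1\<^sub>2\<close> and \<open>-2\<theta>\<close> to the argument of \<open>p + iq\<close>.\<close>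

lemma mixed_conn_form_eq:
  assumes W: "W \<subseteq> S" "pos_frame g W e1 e2" "x \<in> W"
    and W': "W' \<subseteq> S" "pos_frame g W' E1 E2" "x \<in> W'"
    and pr: "\<And>y. y \<in> W' \<Longrightarrow> II y (E1 y) (E2 y) = 0" and s: "s\<^sup>2 = 1"
  shows "2 * conn_form g e1 e2 x v
    + s * normal_conn_form g' \<phi> (mixed_e3 s g' \<phi> e1 e2) (mixed_e4 s g' \<phi> e1 e2) x v
    = 2 * conn_form g E1 E2 x v"
proof -
  define V where "V = W \<inter> W'"
  have V: "open V" "V \<subseteq> S" "x \<in> V" "V \<subseteq> W" "V \<subseteq> W'"
    using W W' by (auto simp: V_def pos_frame_def)
  have sm: "smooth_on V e1" "smooth_on V e2" "smooth_on V E1" "smooth_on V E2"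
    using W W' smooth_on_subset[OF _ V(4)] smooth_on_subset[OF _ V(5)] by (auto simp: pos_frame_def)
  have onb: "pos_onb g y (e1 y) (e2 y)" "pos_onb g y (E1 y) (E2 y)" "y \<in> S" if "y \<in> V" for y
    using that V W W' by (auto simp: pos_frame_def)
  have VE: "pos_frame g V E1 E2" using V(1) sm onb by (simp add: pos_frame_def)
  define a where "a y = g y (e1 y) (E1 y)" for y
  define b where "b y = g y (e1 y) (E2 y)" for y
  have ab: "smooth_on V a" "smooth_on V b"
    unfolding a_def b_def by (rule src.smooth_g_fields[OF V(1,2)], fact sm, fact sm)+
  have e: "e1 y = a y *\<^sub>R E1 y + b y *\<^sub>R E2 y" "e2 y = (- b y) *\<^sub>R E1 y + a y *\<^sub>R E2 y"
    "a y ^ 2 + b y ^ 2 = 1" if "y \<in> V" for y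
    unfolding a_def b_def by (rule sp.pos_onb_rotation[OF onb(3,2,1)[OF that]])+
  \<comment> \<open>Not the angle itself but its differential evaluated at \<open>v\<close>.\<close>
  define \<theta> where "\<theta> = a x * dd b x v - b x * dd a x v"
  have conn: "conn_form g e1 e2 x v = conn_form g E1 E2 x v + \<theta>"
    unfolding \<theta>_def 
    by (rule sp.conn_form_rotation[OF V(2) VE V(3) ab e(3)[OF V(3)]], rule e(1), assumption, rule e(2)[OF V(3)])
  define P where "P y = half_diff y (E1 y) (E2 y)" for y
  define p where "p y = half_diff y (e1 y) (e2 y)" for y
  define q where "q y = II y (e1 y) (e2 y)" for y
  have sP: "smooth_on V P"
    unfolding P_def half_diff_def
    by (rule smooth_on_divide[OF V(1) smooth_on_diff[OF V(1) smooth_II[OF V(1,2) sm(3,3)]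
            smooth_II[OF V(1,2) sm(4,4)]] smooth_on_const]) simp
  \<comment> \<open>The factor for \<open>q\<close> is written as a difference with 0 so that
    \<open>dd_diff\<close> and \<open>dd_mult\<close> differentiate both products alike.\<close>
  have pq: "p y = (a y * a y - b y * b y) * P y" "q y = (0 - 2 * (a y * b y)) * P y" if "y \<in> V" for y
    using pr[of y] that V(5) II_rotation[OF onb(3)[OF that], of "a y" "E1 y" "b y" "E2 y"]
    unfolding p_def q_def P_def e(1,2)[OF that] by auto
  note aa = smooth_on_mult[OF V(1) ab(1,1)] and bb = smooth_on_mult[OF V(1) ab(2,2)]
    and ab2 = smooth_on_mult[OF V(1) smooth_on_const smooth_on_mult[OF V(1) ab]]
  have dp: "dd p x v = (a x * a x - b x * b x) * dd P x v
      + (2 * a x * dd a x v - 2 * b x * dd b x v) * P x"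
    using dd_cong[OF V(1,3) pq(1)] dd_mult[OF smooth_on_diff[OF V(1) aa bb] sP V(3), of v]
      dd_diff[OF aa bb V(3), of v] dd_mult[OF ab(1,1) V(3), of v] dd_mult[OF ab(2,2) V(3), of v]
    by (simp add: algebra_simps)
  have dq: "dd q x v = - (2 * (a x * b x)) * dd P x v
      - 2 * (a x * dd b x v + dd a x v * b x) * P x"
    using dd_cong[OF V(1,3) pq(2)]
      dd_mult[OF smooth_on_diff[OF V(1) smooth_on_const ab2] sP V(3), of 0 2 v]
      dd_diff[OF smooth_on_const ab2 V(3), of 0 2 v]
      dd_mult[OF smooth_on_const smooth_on_mult[OF V(1) ab] V(3), of 2 v] dd_mult[OF ab V(3), of v]
    by (simp add: algebra_simps)
  have ab1: "a x * a x + b x * b x = 1" using e(3)[OF V(3)] by (simp add: power2_eq_square)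
  have "p x ^ 2 + q x ^ 2 = (a x * a x + b x * b x) ^ 2 * P x ^ 2"
    unfolding pq[OF V(3)] by (simp add: power2_eq_square algebra_simps)
  then have n: "p x ^ 2 + q x ^ 2 = P x ^ 2" by (simp add: ab1)
  \<comment> \<open>The derivative of \<open>P\<close> cancels. What remains offsets the
    \<open>2 * \<theta>\<close> coming from the tangential connection forms.\<close>
  have "p x * dd q x v - q x * dd p x v = - 2 * (a x * a x + b x * b x) * \<theta> * P x ^ 2"
    unfolding dp dq pq[OF V(3)] \<theta>_def by (simp add: power2_eq_square algebra_simps)
  moreover have "P x ^ 2 > 0"
    using umbilic_discriminant[OF onb(3,1)[OF V(3)]] n by (simp add: p_def q_def)
  ultimately have "(p x * dd q x v - q x * dd p x v) / (p x ^ 2 + q x ^ 2) = - 2 * \<theta>"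
    unfolding n ab1 by (simp add: field_simps)
  then show ?thesis
    using mixed_normal_conn_form[OF W s, of v] conn unfolding p_def q_def by simp
qed

text \<open>The rotation by half the argument of \<open>p + iq\<close> is the direction of \<open>(r + p) + iq\<close>, where
  \<open>r = |p + iq|\<close>; a preliminary quarter turn ensures \<open>p \<ge> 0\<close> at the given point, so that this is nonzero
  nearby.\<close>

lemma exists_principal:
  assumes x: "x \<in> S"
  obtains W E1 E2 where "x \<in> W" "W \<subseteq> S" "pos_frame g W E1 E2"
    "\<And>y. y \<in> W \<Longrightarrow> II y (E1 y) (E2 y) = 0" "\<And>y. y \<in> W \<Longrightarrow> half_diff y (E1 y) (E2 y) > 0"
proof -
  obtain d1 d2 where d: "pos_frame g S d1 d2" by (rule sp.exists_pos_frame)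
  obtain e1 e2 where e: "pos_frame g S e1 e2" "half_diff x (e1 x) (e2 x) \<ge> 0"
  proof (cases "half_diff x (d1 x) (d2 x) \<ge> 0")
    case False
    \<comment> \<open>A quarter turn exchanges the diagonal entries of \<open>II\<close> and so
      changes the sign of \<open>half_diff\<close>.\<close>
    have "pos_frame g S (\<lambda>y. 0 *\<^sub>R d1 y + 1 *\<^sub>R d2 y) (\<lambda>y. (-1) *\<^sub>R d1 y + 0 *\<^sub>R d2 y)"
      using d sp.pos_onb_rotate[of _ _ _ 0 1] smooth_on_minus[OF src.open_S]
      by (auto simp: pos_frame_def)
    moreover have "half_diff x (0 *\<^sub>R d1 x + 1 *\<^sub>R d2 x) ((-1) *\<^sub>R d1 x + 0 *\<^sub>R d2 x) \<ge> 0"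
      unfolding II_rotation(1)[OF x, of 0 _ 1] using False by simp
    ultimately show ?thesis using that by blast
  qed (use that d in blast)
  have sm: "smooth_on S e1" "smooth_on S e2" and onb: "\<And>y. y \<in> S \<Longrightarrow> pos_onb g y (e1 y) (e2 y)"
    using e(1) by (auto simp: pos_frame_def)
  note O = src.open_S
  define p where "p y = half_diff y (e1 y) (e2 y)" for y
  define q where "q y = II y (e1 y) (e2 y)" for y
  define r where "r y = sqrt (p y ^ 2 + q y ^ 2)" for y
  define m where "m y = sqrt ((r y + p y) ^ 2 + q y ^ 2)" for y
  have sp: "smooth_on S p"
    unfolding p_def half_diff_def
    by (rule smooth_on_divide[OF O smooth_on_diff[OF O smooth_II[OF O subset_refl sm(1,1)]
            smooth_II[OF O subset_refl sm(2,2)]] smooth_on_const]) simp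
  have sq: "smooth_on S q" unfolding q_def by (rule smooth_II[OF O subset_refl sm])
  have disc: "p y ^ 2 + q y ^ 2 > 0" if "y \<in> S" for y
    using umbilic_discriminant[OF that onb[OF that]] by (simp add: p_def q_def)
  have r: "r y > 0" "r y * r y = p y ^ 2 + q y ^ 2" if "y \<in> S" for y
    using disc[OF that] by (auto simp: r_def less_imp_le)
  have sr: "smooth_on S r"
    unfolding r_def
    by (rule smooth_on_sqrt[OF O smooth_on_add[OF O smooth_on_power[OF O sp] smooth_on_power[OF O sq]] disc])
  \<comment> \<open>This removes the points where p + iq lies on the negative real axis; there the
    half-angle vector (r + p) + iq vanishes.\<close>
  define W where "W = {y \<in> S. r y + p y > 0}"
  have W: "open W" "W \<subseteq> S"
  proof -
    have "W = S \<inter> (\<lambda>y. r y + p y) -` {0<..}" by (auto simp: W_def)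
    then show "open W"
      using continuous_open_preimage[OF smooth_on_continuous[OF smooth_on_add[OF O sr sp]] O open_greaterThan]
      by simp
  qed (auto simp: W_def)
  have xW: "x \<in> W" using x e(2) r(1)[OF x] by (simp add: W_def p_def)
  note sW = smooth_on_subset[OF _ W(2)]
  have t: "(r y + p y) ^ 2 + q y ^ 2 > 0" if "y \<in> W" for y
    using that by (simp add: W_def add_pos_nonneg)
  have m: "m y > 0" "m y * m y = (r y + p y) ^ 2 + q y ^ 2" if "y \<in> W" for y
    using t[OF that] by (auto simp: m_def less_imp_le)
  note srp = sW[OF smooth_on_add[OF O sr sp]]
  have sm': "smooth_on W m"
    unfolding m_def
    by (rule smooth_on_sqrt[OF W(1) smooth_on_add[OF W(1) smooth_on_power[OF W(1) srp]
            smooth_on_power[OF W(1) sW[OF sq]]] t])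
  define a where "a y = (r y + p y) / m y" for y
  define b where "b y = q y / m y" for y
  have sa: "smooth_on W a" unfolding a_def
    by (rule smooth_on_divide[OF W(1) srp sm' m(1)[THEN less_imp_neq, symmetric]])
  have sb: "smooth_on W b" unfolding b_def
    by (rule smooth_on_divide[OF W(1) sW[OF sq] sm' m(1)[THEN less_imp_neq, symmetric]])
  have ab: "r y + p y = m y * a y" "q y = m y * b y" if "y \<in> W" for y
    using m(1)[OF that] by (simp_all add: a_def b_def)
  have ab1: "a y ^ 2 + b y ^ 2 = 1" if "y \<in> W" for y
  proof -
    have "(m y * m y) * (a y ^ 2 + b y ^ 2) = (m y * m y) * 1"
      using m(2)[OF that] unfolding ab[OF that] by (simp add: power2_eq_square algebra_simps)
    then show ?thesis using m(1)[OF that] by simp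
  qed
  define E1 where "E1 y = a y *\<^sub>R e1 y + b y *\<^sub>R e2 y" for y
  define E2 where "E2 y = (- b y) *\<^sub>R e1 y + a y *\<^sub>R e2 y" for y
  have sE: "smooth_on W E1" "smooth_on W E2"
    unfolding E1_def E2_def
    by (rule smooth_on_add[OF W(1) smooth_on_scaleR[OF W(1) sa sW[OF sm(1)]] smooth_on_scaleR[OF W(1) sb sW[OF sm(2)]]])
      (rule smooth_on_add[OF W(1) smooth_on_scaleR[OF W(1) smooth_on_minus[OF W(1) sb] sW[OF sm(1)]]
          smooth_on_scaleR[OF W(1) sa sW[OF sm(2)]]])
  have F: "pos_frame g W E1 E2"
    using W sE sp.pos_onb_rotate[OF _ onb ab1] by (auto simp: pos_frame_def E1_def E2_def)
  have eqs: "II y (E1 y) (E2 y) = 0" "half_diff y (E1 y) (E2 y) > 0" if y: "y \<in> W" for y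
  proof -
    have yS: "y \<in> S" using y W by auto
    have rr: "r y * r y = p y * p y + q y * q y" using r(2)[OF yS] by (simp add: power2_eq_square)
    \<comment> \<open>Both identities are multiplied by m^2, which clears the denominators of
      \<open>a\<close> and \<open>b\<close>, so that r^2 = p^2 + q^2 can be inserted.\<close>
    have "(m y * m y) * II y (E1 y) (E2 y)
        = ((m y * a y) * (m y * a y) - (m y * b y) * (m y * b y)) * q y - 2 * ((m y * a y) * (m y * b y)) * p y"
      unfolding E1_def E2_def II_rotation(2)[OF yS] p_def[symmetric] q_def[symmetric]
      by (simp add: algebra_simps)
    also have "\<dots> = q y * (r y * r y - (p y * p y + q y * q y))"
      unfolding ab[OF y, symmetric] by (simp add: algebra_simps)
    finally show "II y (E1 y) (E2 y) = 0" using m(1)[OF y] by (simp add: rr)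
    have "(m y * m y) * half_diff y (E1 y) (E2 y)
        = ((m y * a y) * (m y * a y) - (m y * b y) * (m y * b y)) * p y + 2 * ((m y * a y) * (m y * b y)) * q y"
      unfolding E1_def E2_def II_rotation(1)[OF yS] p_def[symmetric] q_def[symmetric]
      by (simp add: algebra_simps)
    also have "\<dots> = (r y * r y - (p y * p y + q y * q y)) * p y
        + 2 * (r y + p y) * (p y ^ 2 + q y ^ 2)"
      unfolding ab[OF y, symmetric] by (simp add: power2_eq_square algebra_simps)
    also have "\<dots> > 0" using disc[OF yS] y by (simp add: rr W_def)
    finally have "(m y * m y) * half_diff y (E1 y) (E2 y) > 0" .
    then show "half_diff y (E1 y) (E2 y) > 0" using m(1)[OF y] by (simp add: zero_less_mult_iff)
  qed
  show ?thesis by (rule that[OF xW W(2) F eqs])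
qed

end

section \<open>Surfaces in umbilical hypersurfaces\<close>

text \<open>Supplies a vector outside the span of the other rows, on which a determinant functional
  is nonzero.\<close>

lemma ex_notin_span:
  fixes B :: "'a::euclidean_space set"
  assumes "finite B" "card B < DIM('a)"
  obtains w where "w \<notin> span B"
proof -
  have "dim (span B) \<le> card B" using assms(1) by (simp add: dim_le_card')
  then have "span B \<noteq> UNIV" using assms(2) by (metis dim_UNIV not_less)
  then show ?thesis using that by blast
qed

section \<open>Unit normal and shape operator of a surface in a 3-manifold\<close>

locale hypersurface_patch = isometric_patch g S g' T \<phi>
  for g :: "(real^2) cmetric" and S and g' :: "(real^3) cmetric" and T and \<phi>
begin

sublocale sp: surface_patch g S ..

abbreviation "N \<equiv> unit_normal g' \<phi>"

text \<open>A cross product for a general metric: the determinant with the tangent basis in the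
  first two rows is a functional of the third row, and \<open>smooth_riesz\<close> represents it by
  a normal field. On this field the functional equals the squared length, so the orientation is
  positive.\<close>

lemma exists_unit_normal:
  obtains n where "smooth_on S n"
    "\<And>x. x \<in> S \<Longrightarrow> n x \<in> normal_space g' \<phi> x \<and> g' (\<phi> x) (n x) (n x) = 1
      \<and> det3 (dd \<phi> x (axis 1 1)) (dd \<phi> x (axis 2 1)) (n x) > 0"
proof -
  define L where "L x = det3 (dd \<phi> x (axis 1 1)) (dd \<phi> x (axis 2 1))" for x
  have linL: "linear (L x)" for x by (simp add: L_def linear_det3)
  have sL: "smooth_on S (\<lambda>x. L x z)" for z
    unfolding L_def det3_def
  proof (rule smooth_on_det[OF src.open_S])
    show "smooth_on S (\<lambda>x. (vector [dd \<phi> x (axis 1 1), dd \<phi> x (axis 2 1), z] :: real^3^3) $ i $ k)" for i k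
      using exhaust_3[of i] smooth_on_vec_nth[OF src.open_S smooth_on_dd[OF smooth_\<phi>]]
      by (auto intro: smooth_on_const)
  qed
  have sg: "smooth_on S (\<lambda>x. g' (\<phi> x) u v)" for u v
    by (rule smooth_on_compose[OF src.open_S tgt.open_S \<phi>S smooth_\<phi> tgt.smooth_g])
  have "\<exists>w. smooth_on S w \<and> (\<forall>x\<in>S. \<forall>z. g' (\<phi> x) (w x) z = L x z)"
    by (rule smooth_riesz[where A = "\<lambda>x. g' (\<phi> x)" and L = L,
          OF src.open_S tgt.bil[OF f.h_in] tgt.pos[OF f.h_in] sg linL sL])
  then obtain n0 where n0: "smooth_on S n0" "\<And>x z. x \<in> S \<Longrightarrow> g' (\<phi> x) (n0 x) z = L x z"
    by blast
  have p: "g' (\<phi> x) (n0 x) (n0 x) > 0" if x: "x \<in> S" for x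
  proof (rule tgt.pos[OF f.h_in[OF x]])
    let ?u = "dd \<phi> x (axis 1 1)" and ?v = "dd \<phi> x (axis 2 1)"
    obtain w where w: "w \<notin> span {?u, ?v}"
      by (rule ex_notin_span[of "{?u, ?v}"]) (auto simp: card_insert_if)
    \<comment> \<open>A vanishing determinant gives a relation among the rows; its coefficient at
      \<open>w\<close> is zero by the choice of \<open>w\<close>, the others by injectivity of the
      differential.\<close>
    have "L x w \<noteq> 0"
    proof
      assume "L x w = 0"
      then obtain k where k: "\<exists>i. k i \<noteq> 0" "(\<Sum>i\<in>UNIV. k i *\<^sub>R (vector [?u, ?v, w] :: real^3^3) $ i) = 0"
        unfolding L_def det3_def using det_zero_combination by blast
      have k0: "k 3 *\<^sub>R w = - (k 1 *\<^sub>R ?u + k 2 *\<^sub>R ?v)"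
        unfolding eq_neg_iff_add_eq_0 using k(2) by (simp add: sum_3 add_ac)
      have "k 3 = 0"
      proof (rule ccontr)
        assume "k 3 \<noteq> 0"
        then have "w = inverse (k 3) *\<^sub>R (- (k 1 *\<^sub>R ?u + k 2 *\<^sub>R ?v))"
          unfolding k0[symmetric] by simp
        moreover have "\<dots> \<in> span {?u, ?v}"
          by (intro span_scale span_neg span_add span_base) auto
        ultimately show False using w by simp
      qed
      then have "dd \<phi> x (k 1 *\<^sub>R axis 1 1 + k 2 *\<^sub>R axis 2 1) = dd \<phi> x 0"
        using k(2) by (simp add: sum_3 linear_add[OF linear_dd[OF x]] linear_cmul[OF linear_dd[OF x]] linear_0[OF linear_dd[OF x]])
      then have *: "k 1 *\<^sub>R axis 1 1 + k 2 *\<^sub>R axis 2 1 = (0 :: real^2)" by (simp only: dd_inj[OF x])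
      have "k 1 = 0" "k 2 = 0"
        using arg_cong[OF *, of "\<lambda>v. v $ 1"] arg_cong[OF *, of "\<lambda>v. v $ 2"] by (simp_all add: axis_def)
      with \<open>k 3 = 0\<close> k(1) exhaust_3 show False by metis
    qed
    then show "n0 x \<noteq> 0" using n0(2)[OF x, of w] by (auto simp: tgt.lin f.h_in[OF x])
  qed
  define m where "m x = sqrt (g' (\<phi> x) (n0 x) (n0 x))" for x
  have sm: "smooth_on S m"
    unfolding m_def
    by (rule smooth_on_sqrt[OF src.open_S tgt.g.smooth[OF src.open_S \<phi>S smooth_\<phi> n0(1,1)] p])
  have m: "m x > 0" "m x * m x = g' (\<phi> x) (n0 x) (n0 x)" if "x \<in> S" for x
    using p[OF that] by (auto simp: m_def less_imp_le)
  show ?thesis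
  proof (rule that)
    show "smooth_on S (\<lambda>x. inverse (m x) *\<^sub>R n0 x)"
      by (rule smooth_on_scaleR[OF src.open_S smooth_on_inverse[OF src.open_S sm m(1)[THEN less_imp_neq, symmetric]] n0(1)])
    fix x assume x: "x \<in> S"
    have u: "inverse (m x) * (inverse (m x) * g' (\<phi> x) (n0 x) (n0 x)) = 1"
      unfolding m(2)[OF x, symmetric] using m(1)[OF x] by (simp add: field_simps)
    have "g' (\<phi> x) (n0 x) (dd \<phi> x w) = 0" for w
    proof -
      have w: "w = w $ 1 *\<^sub>R axis 1 1 + w $ 2 *\<^sub>R axis 2 1"
        by (simp add: vec_eq_iff forall_2 axis_def)
      have "dd \<phi> x w = w $ 1 *\<^sub>R dd \<phi> x (axis 1 1) + w $ 2 *\<^sub>R dd \<phi> x (axis 2 1)"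
        by (subst w) (simp only: linear_add[OF linear_dd[OF x]] linear_cmul[OF linear_dd[OF x]])
      then show ?thesis
        by (simp add: n0(2)[OF x] L_def linear_add[OF linear_det3] linear_cmul[OF linear_det3] det3_same)
    qed
    moreover have "det3 (dd \<phi> x (axis 1 1)) (dd \<phi> x (axis 2 1)) (inverse (m x) *\<^sub>R n0 x)
      = inverse (m x) * g' (\<phi> x) (n0 x) (n0 x)"
      by (simp add: n0(2)[OF x] L_def linear_cmul[OF linear_det3])
    ultimately show "inverse (m x) *\<^sub>R n0 x \<in> normal_space g' \<phi> x
      \<and> g' (\<phi> x) (inverse (m x) *\<^sub>R n0 x) (inverse (m x) *\<^sub>R n0 x) = 1
      \<and> det3 (dd \<phi> x (axis 1 1)) (dd \<phi> x (axis 2 1)) (inverse (m x) *\<^sub>R n0 x) > 0"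
      using u m(1)[OF x] p[OF x] by (simp add: normal_space_def tgt.lin f.h_in[OF x])
  qed
qed

text \<open>Stated for any \<open>n\<close> with the properties of the unit normal, since the
  uniqueness required by the description in \<open>unit_normal\<close> is derived from it.\<close>

lemma decompose_unit_normal:
  assumes x: "x \<in> S" and n: "n \<in> normal_space g' \<phi> x" "g' (\<phi> x) n n = 1"
    "det3 (dd \<phi> x (axis 1 1)) (dd \<phi> x (axis 2 1)) n > 0"
  obtains t where "z = dd \<phi> x t + g' (\<phi> x) z n *\<^sub>R n"
proof -
  let ?A = "vector [dd \<phi> x (axis 1 1), dd \<phi> x (axis 2 1), n] :: real^3^3"
  have "det ?A \<noteq> 0" using n(3) by (simp add: det3_def)
  then obtain k where z: "z = (\<Sum>i\<in>UNIV. k i *\<^sub>R ?A $ i)" by (rule det_nonzero_combination)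
  have z': "z = dd \<phi> x (k 1 *\<^sub>R axis 1 1 + k 2 *\<^sub>R axis 2 1) + k 3 *\<^sub>R n"
    unfolding z by (simp add: sum_3 linear_add[OF linear_dd[OF x]] linear_cmul[OF linear_dd[OF x]])
  have "g' (\<phi> x) (dd \<phi> x t) n = 0" for t
    using n(1) tgt.sym[OF f.h_in[OF x]] by (simp add: normal_space_def)
  then have "g' (\<phi> x) z n = k 3"
    unfolding z' by (simp add: tgt.lin f.h_in[OF x] n(2))
  with z' show ?thesis using that by metis
qed

lemma normal_expand_unit:
  assumes x: "x \<in> S" and n: "n \<in> normal_space g' \<phi> x" "g' (\<phi> x) n n = 1"
    "det3 (dd \<phi> x (axis 1 1)) (dd \<phi> x (axis 2 1)) n > 0" and \<xi>: "\<xi> \<in> normal_space g' \<phi> x"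
  shows "\<xi> = g' (\<phi> x) \<xi> n *\<^sub>R n"
proof -
  obtain t where t: "\<xi> = dd \<phi> x t + g' (\<phi> x) \<xi> n *\<^sub>R n"
    using decompose_unit_normal[OF x n] .
  have "g' (\<phi> x) \<xi> (dd \<phi> x t) = 0" using \<xi> by (simp add: normal_space_def)
  then have "g' (\<phi> x) (dd \<phi> x t) (dd \<phi> x t) = 0"
    using n(1) by (subst (asm) t) (simp add: tgt.lin f.h_in[OF x] normal_space_def)
  then have "dd \<phi> x t = 0" using tgt.g_zero_iff[OF f.h_in[OF x]] by simp
  with t show ?thesis by simp
qed

lemma unit_normal_smooth_props:
  shows smooth_N: "smooth_on S N"
    and N_props: "x \<in> S \<Longrightarrow> N x \<in> normal_space g' \<phi> x" "x \<in> S \<Longrightarrow> g' (\<phi> x) (N x) (N x) = 1"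
      "x \<in> S \<Longrightarrow> det3 (dd \<phi> x (axis 1 1)) (dd \<phi> x (axis 2 1)) (N x) > 0"
proof -
  obtain n where n: "smooth_on S n"
    "\<And>x. x \<in> S \<Longrightarrow> n x \<in> normal_space g' \<phi> x \<and> g' (\<phi> x) (n x) (n x) = 1
      \<and> det3 (dd \<phi> x (axis 1 1)) (dd \<phi> x (axis 2 1)) (n x) > 0"
    by (rule exists_unit_normal) blast
  have eq: "N x = n x" if x: "x \<in> S" for x
    unfolding unit_normal_def det3_def[symmetric]
  proof (rule the_equality)
    show "n x \<in> normal_space g' \<phi> x \<and> g' (\<phi> x) (n x) (n x) = 1
      \<and> det3 (dd \<phi> x (axis 1 1)) (dd \<phi> x (axis 2 1)) (n x) > 0" by (rule n(2)[OF x])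
    fix \<nu> assume *: "\<nu> \<in> normal_space g' \<phi> x \<and> g' (\<phi> x) \<nu> \<nu> = 1
      \<and> det3 (dd \<phi> x (axis 1 1)) (dd \<phi> x (axis 2 1)) \<nu> > 0"
    define k where "k = g' (\<phi> x) \<nu> (n x)"
    have \<nu>: "\<nu> = k *\<^sub>R n x"
      unfolding k_def using normal_expand_unit[OF x] n(2)[OF x] * by blast
    have "k * k = 1" using * n(2)[OF x] unfolding \<nu> by (simp add: tgt.lin f.h_in[OF x])
    moreover have "k > 0"
      using * n(2)[OF x] unfolding \<nu> by (simp add: linear_cmul[OF linear_det3] zero_less_mult_iff)
    ultimately have "k = 1" by (simp add: square_eq_1_iff)
    then show "\<nu> = n x" by (simp add: \<nu>)
  qed
  show "smooth_on S N" by (rule smooth_on_cong[OF src.open_S _ n(1)]) (simp add: eq)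
  show "x \<in> S \<Longrightarrow> N x \<in> normal_space g' \<phi> x" "x \<in> S \<Longrightarrow> g' (\<phi> x) (N x) (N x) = 1"
      "x \<in> S \<Longrightarrow> det3 (dd \<phi> x (axis 1 1)) (dd \<phi> x (axis 2 1)) (N x) > 0"
    using n(2) eq by auto
qed

lemmas decompose = decompose_unit_normal[OF _ N_props]

definition II :: "real^2 \<Rightarrow> real^2 \<Rightarrow> real^2 \<Rightarrow> real" where
  "II x u v = g' (\<phi> x) (sff g' \<phi> x u v) (N x)"

lemma sff_II: "x \<in> S \<Longrightarrow> sff g' \<phi> x u v = II x u v *\<^sub>R N x"
  unfolding II_def
  by (rule normal_expand_unit[OF _ N_props]) (auto simp: normal_space_def sff_normal)

text \<open>Constant length makes the derivative orthogonal to \<open>N\<close>, which in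
  codimension one already means tangent.\<close>

lemma cov_deriv_N:
  assumes x: "x \<in> S"
  obtains t where "cov_deriv g' \<phi> N x u = dd \<phi> x t"
proof -
  let ?D = "cov_deriv g' \<phi> N x u"
  have "dd (\<lambda>y. g' (\<phi> y) (N y) (N y)) x = dd (\<lambda>y. 1) x"
    by (rule dd_cong[OF src.open_S x]) (rule N_props)
  then have "g' (\<phi> x) ?D (N x) + g' (\<phi> x) (N x) ?D = 0"
    using f.metric_compat[OF smooth_N smooth_N x, of u] by simp
  then have 0: "g' (\<phi> x) ?D (N x) = 0"
    using tgt.sym[OF f.h_in[OF x], of "N x" ?D] by simp
  obtain t where "?D = dd \<phi> x t + g' (\<phi> x) ?D (N x) *\<^sub>R N x"
    using decompose[OF x x x x] .
  then show ?thesis using that by (simp add: 0)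
qed

lemma shape_op_eqI:
  assumes x: "x \<in> S" and w: "\<And>v. g x w v = II x u v"
  shows "shape_op g g' \<phi> x u = w"
  unfolding shape_op_def II_def[symmetric]
  by (rule the_equality) (use w src.nondegenerate[OF x] in auto)

lemma shape_op:
  assumes x: "x \<in> S"
  shows "g x (shape_op g g' \<phi> x u) v = II x u v"
proof -
  obtain e1 e2 where "pos_frame g S e1 e2" by (rule sp.exists_pos_frame)
  then have e: "pos_onb g x (e1 x) (e2 x)" using x by (simp add: pos_frame_def)
  define w where "w = II x u (e1 x) *\<^sub>R e1 x + II x u (e2 x) *\<^sub>R e2 x"
  have w: "g x w v = II x u v" for v
  proof -
    have "II x u (a *\<^sub>R v + b *\<^sub>R v') = a * II x u v + b * II x u v'" for a b v v'
      by (simp add: II_def sff_lin x tgt.lin f.h_in[OF x])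
    then have "II x u v = g x v (e1 x) * II x u (e1 x) + g x v (e2 x) * II x u (e2 x)"
      using sp.pos_onb_expand[OF x e, of v] by metis
    then show ?thesis
      by (simp add: w_def src.lin x src.sym[OF x, of _ v] mult.commute)
  qed
  then show ?thesis using shape_op_eqI[OF x w] by simp
qed

lemma principal_frame_sff:
  assumes "principal_frame g g' \<phi> W e1 e2" and x: "x \<in> W" "x \<in> S"
  shows "sff g' \<phi> x (e1 x) (e2 x) = 0"
proof -
  have e: "pos_onb g x (e1 x) (e2 x)" and "\<exists>k. shape_op g g' \<phi> x (e1 x) = k *\<^sub>R e1 x"
    using assms by (auto simp: principal_frame_def pos_frame_def)
  then obtain k where "shape_op g g' \<phi> x (e1 x) = k *\<^sub>R e1 x" by blast
  then have "II x (e1 x) (e2 x) = 0"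
    using shape_op[OF x(2), of "e1 x" "e2 x"] e by (simp add: src.lin x pos_onb_def)
  then show ?thesis by (simp add: sff_II x)
qed

text \<open>A frame that is orthogonal also for \<open>II\<close> consists of eigenvectors of the
  shape operator, with the diagonal entries as principal curvatures.\<close>

lemma principal_frameI:
  assumes W: "W \<subseteq> S" "pos_frame g W e1 e2"
    and 0: "\<And>x. x \<in> W \<Longrightarrow> II x (e1 x) (e2 x) = 0"
    and less: "\<And>x. x \<in> W \<Longrightarrow> II x (e2 x) (e2 x) < II x (e1 x) (e1 x)"
  shows "principal_frame g g' \<phi> W e1 e2"
proof -
  have "shape_op g g' \<phi> x (e1 x) = II x (e1 x) (e1 x) *\<^sub>R e1 x \<and>
    shape_op g g' \<phi> x (e2 x) = II x (e2 x) (e2 x) *\<^sub>R e2 x" if xW: "x \<in> W" for x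
  proof -
    have x: "x \<in> S" using xW W by auto
    have e: "pos_onb g x (e1 x) (e2 x)" using xW W by (auto simp: pos_frame_def)
    have 21: "II x (e2 x) (e1 x) = 0" using 0[OF xW] by (simp add: II_def sff_sym[OF x, of "e2 x"])
    have ex: "II x u v = g x v (e1 x) * II x u (e1 x) + g x v (e2 x) * II x u (e2 x)" for u v
    proof -
      have "II x u (a *\<^sub>R v + b *\<^sub>R v') = a * II x u v + b * II x u v'" for a b v v'
        by (simp add: II_def sff_lin x tgt.lin f.h_in[OF x])
      then show ?thesis using sp.pos_onb_expand[OF x e, of v] by metis
    qed
    have "g x (II x (e1 x) (e1 x) *\<^sub>R e1 x) v = II x (e1 x) v"
      "g x (II x (e2 x) (e2 x) *\<^sub>R e2 x) v = II x (e2 x) v" for v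
      using 0[OF xW] 21 ex[of "e1 x" v] ex[of "e2 x" v] src.sym[OF x, of "e1 x" v] src.sym[OF x, of "e2 x" v]
      by (simp_all add: src.lin x)
    then show ?thesis by (intro conjI shape_op_eqI[OF x])
  qed
  then show ?thesis using W less unfolding principal_frame_def by blast
qed

end


text \<open>\<open>\<phi>\<close> is a parameter of its own because the coordinate expression of
  \<open>f\<close> is tied to those of \<open>F\<close> and \<open>j\<close> only on the common
  domain \<open>U\<close>.\<close>

locale composed_patch = h: hypersurface_patch gM U g3 V h + psi: isometric_patch g3 V g4 T \<psi>
  for gM :: "(real^2) cmetric" and U and g3 :: "(real^3) cmetric" and V and h
    and g4 :: "(real^4) cmetric" and T and \<psi> +
  fixes \<phi> :: "real^2 \<Rightarrow> real^4" and c :: real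
  assumes \<phi>_eq: "\<And>x. x \<in> U \<Longrightarrow> \<phi> x = \<psi> (h x)"
    and umb: "\<And>y. y \<in> V \<Longrightarrow> umbilic_at g3 g4 \<psi> y"
    and not_umb: "\<And>x. x \<in> U \<Longrightarrow> \<not> umbilic_at gM g3 h x"
    and curv_c: "\<And>y u v. y \<in> T \<Longrightarrow> u \<noteq> v \<Longrightarrow> independent {u, v} \<Longrightarrow> sec_curv g4 y u v = c"
begin

lemma dd_\<phi>: "x \<in> U \<Longrightarrow> dd \<phi> x u = dd \<psi> (h x) (dd h x u)"
proof -
  assume x: "x \<in> U"
  have "dd \<phi> x = dd (\<lambda>y. \<psi> (h y)) x" by (rule dd_cong[OF h.src.open_S x \<phi>_eq])
  also have "\<dots> = (\<lambda>u. dd \<psi> (h x) (dd h x u))"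
    using dd_eqI[OF has_derivative_compose[OF smooth_on_dd_works[OF h.smooth_\<phi> x]
        smooth_on_dd_works[OF psi.smooth_\<phi> h.f.h_in[OF x]]]] by simp
  finally show ?thesis by simp
qed

sublocale phi: isometric_patch gM U g4 T \<phi>
proof
  show "smooth_on U \<phi>"
    by (rule smooth_on_cong[OF h.src.open_S \<phi>_eq[symmetric]
          smooth_on_compose[OF h.src.open_S h.tgt.open_S h.\<phi>S h.smooth_\<phi> psi.smooth_\<phi>]])
  show "\<phi> ` U \<subseteq> T" using \<phi>_eq h.f.h_in psi.f.h_in by auto
  show "gM x u v = g4 (\<phi> x) (dd \<phi> x u) (dd \<phi> x v)" if "x \<in> U" for x u v
    using that by (simp add: dd_\<phi> \<phi>_eq h.iso psi.iso h.f.h_in)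
qed

definition \<nu> :: "real^2 \<Rightarrow> real^4" where "\<nu> x = dd \<psi> (h x) (h.N x)"

lemma smooth_\<nu>: "smooth_on U \<nu>"
  unfolding \<nu>_def
  by (rule smooth_on_dd_compose[OF h.src.open_S h.tgt.open_S h.\<phi>S h.smooth_\<phi> psi.smooth_\<phi> h.smooth_N])

lemma cov_deriv_push:
  assumes x: "x \<in> U" and X: "smooth_on U X"
  shows "cov_deriv g4 \<phi> (\<lambda>y. dd \<psi> (h y) (X y)) x u
    = dd \<psi> (h x) (cov_deriv g3 h X x u) + sff g4 \<psi> (h x) (dd h x u) (X x)"
proof -
  have "cov_deriv g4 \<phi> (\<lambda>y. dd \<psi> (h y) (X y)) x u
    = cov_deriv g4 (\<lambda>y. \<psi> (h y)) (\<lambda>y. dd \<psi> (h y) (X y)) x u"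
    by (rule cov_deriv_cong[OF h.src.open_S x _ \<phi>_eq]) auto
  then show ?thesis
    using psi.gauss_formula[OF h.src.open_S h.\<phi>S h.smooth_\<phi> X x] by simp
qed

text \<open>\<open>umbilic_at\<close> does not say that its vector is normal; evaluation on the unit
  vector \<open>h.N\<close> exhibits it as a value of \<open>sff\<close>, hence as normal to
  \<open>\<psi>\<close>.\<close>

lemma umbilic_vector:
  assumes x: "x \<in> U"
  obtains \<eta> where "\<And>u v. sff g4 \<psi> (h x) u v = g3 (h x) u v *\<^sub>R \<eta>"
    "\<And>w. g4 (\<phi> x) (dd \<psi> (h x) w) \<eta> = 0"
proof -
  have hx: "h x \<in> V" by (rule h.f.h_in[OF x])
  obtain \<eta> where \<eta>: "\<And>u v. sff g4 \<psi> (h x) u v = g3 (h x) u v *\<^sub>R \<eta>"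
    using umb[OF hx] by (auto simp: umbilic_at_def)
  have "sff g4 \<psi> (h x) (h.N x) (h.N x) = \<eta>" using \<eta> h.N_props(2)[OF x] by simp
  then have "g4 (\<phi> x) (dd \<psi> (h x) w) \<eta> = 0" for w
    using psi.sff_normal'[OF hx, of w "h.N x" "h.N x"] by (simp add: \<phi>_eq[OF x])
  with \<eta> show ?thesis using that by blast
qed

lemma g4_push: "x \<in> U \<Longrightarrow> g4 (\<phi> x) (dd \<psi> (h x) u) (dd \<psi> (h x) v) = g3 (h x) u v"
  by (simp add: psi.iso h.f.h_in \<phi>_eq)

lemma \<nu>_unit: "x \<in> U \<Longrightarrow> g4 (\<phi> x) (\<nu> x) (\<nu> x) = 1"
  by (simp add: \<nu>_def g4_push h.N_props)

lemma \<nu>_normal: "x \<in> U \<Longrightarrow> g4 (\<phi> x) (\<nu> x) (dd \<phi> x w) = 0"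
  using h.N_props(1) by (simp add: \<nu>_def dd_\<phi> g4_push normal_space_def)

text \<open>The normal contribution of \<open>\<psi>\<close> is the product of a tangent vector of
  the surface with \<open>h.N\<close>, times the umbilicity vector, hence zero; the rest is the push
  of a tangent derivative of \<open>h.N\<close>.\<close>

lemma \<nu>_parallel:
  assumes x: "x \<in> U"
  shows "\<exists>t. cov_deriv g4 \<phi> \<nu> x u = dd \<phi> x t"
proof -
  obtain \<eta> where \<eta>: "\<And>u v. sff g4 \<psi> (h x) u v = g3 (h x) u v *\<^sub>R \<eta>"
    using umbilic_vector[OF x] by metis
  have "g3 (h x) (dd h x u) (h.N x) = 0"
    using h.N_props(1)[OF x] h.tgt.sym[OF h.f.h_in[OF x]] by (simp add: normal_space_def)
  moreover obtain t where "cov_deriv g3 h h.N x u = dd h x t" using h.cov_deriv_N[OF x] .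
  ultimately have "cov_deriv g4 \<phi> \<nu> x u = dd \<phi> x t"
    unfolding \<nu>_def cov_deriv_push[OF x h.smooth_N] \<eta> by (simp add: dd_\<phi>[OF x])
  then show ?thesis by blast
qed

text \<open>Composition formula: the form of \<open>h\<close> is pushed by \<open>\<psi>\<close> and
  the form of \<open>\<psi>\<close> is added. Umbilicity and the isometry turn the latter into the
  metric of the surface times \<open>\<eta>\<close>.\<close>

lemma sff_push:
  assumes x: "x \<in> U"
  obtains \<eta> where "g4 (\<phi> x) (\<nu> x) \<eta> = 0"
    "\<And>u v. sff g4 \<phi> x u v = dd \<psi> (h x) (sff g3 h x u v) + gM x u v *\<^sub>R \<eta>"
proof -
  have hx: "h x \<in> V" by (rule h.f.h_in[OF x])
  obtain \<eta> where \<eta>: "\<And>u v. sff g4 \<psi> (h x) u v = g3 (h x) u v *\<^sub>R \<eta>"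
    "\<And>w. g4 (\<phi> x) (dd \<psi> (h x) w) \<eta> = 0"
    using umbilic_vector[OF x] by metis
  have "sff g4 \<phi> x u v = dd \<psi> (h x) (sff g3 h x u v) + gM x u v *\<^sub>R \<eta>" for u v
  proof -
    have "phi.hess x u v = cov_deriv g4 \<phi> (\<lambda>y. dd \<psi> (h y) (dd h y v)) x u"
      unfolding phi.hess_def by (rule cov_deriv_cong[OF h.src.open_S x dd_\<phi>]) auto
    also have "\<dots> = dd \<psi> (h x) (h.hess x u v) + gM x u v *\<^sub>R \<eta>"
      unfolding cov_deriv_push[OF x smooth_on_dd[OF h.smooth_\<phi>]] \<eta>(1) h.hess_def[symmetric] h.iso[OF x] ..
    finally show ?thesis
      by (simp add: phi.sff_eq[OF x] h.sff_eq[OF x] dd_\<phi>[OF x] linear_diff[OF psi.linear_dd[OF hx]])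
  qed
  moreover have "g4 (\<phi> x) (\<nu> x) \<eta> = 0" unfolding \<nu>_def by (rule \<eta>(2))
  ultimately show ?thesis using that by blast
qed

lemma sff_\<phi>:
  assumes x: "x \<in> U"
  obtains \<eta> where "g4 (\<phi> x) (\<nu> x) \<eta> = 0"
    "\<And>u v. sff g4 \<phi> x u v = h.II x u v *\<^sub>R \<nu> x + gM x u v *\<^sub>R \<eta>"
    "\<And>u v. g4 (\<phi> x) (sff g4 \<phi> x u v) (\<nu> x) = h.II x u v"
proof -
  obtain \<eta> where \<eta>: "g4 (\<phi> x) (\<nu> x) \<eta> = 0"
    "\<And>u v. sff g4 \<phi> x u v = dd \<psi> (h x) (sff g3 h x u v) + gM x u v *\<^sub>R \<eta>"
    using sff_push[OF x] by metis
  have 1: "sff g4 \<phi> x u v = h.II x u v *\<^sub>R \<nu> x + gM x u v *\<^sub>R \<eta>" for u v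
    by (simp add: \<eta>(2) \<nu>_def h.sff_II[OF x] linear_cmul[OF psi.linear_dd[OF h.f.h_in[OF x]]])
  have "g4 (\<phi> x) \<eta> (\<nu> x) = 0" using \<eta>(1) psi.tgt.sym[OF phi.f.h_in[OF x], of \<eta>] by simp
  then have 2: "g4 (\<phi> x) (sff g4 \<phi> x u v) (\<nu> x) = h.II x u v" for u v
    unfolding 1 by (simp add: psi.tgt.lin phi.f.h_in[OF x] \<nu>_unit[OF x])
  show ?thesis using that[OF \<eta>(1) 1 2] .
qed

text \<open>Triple product in dimension four: the determinant functional now has
  \<open>\<nu>\<close> as third row, so its representing vector is normal to the surface and to
  \<open>\<nu>\<close>.\<close>

lemma exists_binormal:
  obtains \<zeta> where "smooth_on U \<zeta>" "\<And>x. x \<in> U \<Longrightarrow> pos_normal_onb g4 \<phi> x (\<nu> x) (\<zeta> x)"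
proof -
  let ?u = "\<lambda>x. dd \<phi> x (axis 1 1)" and ?v = "\<lambda>x. dd \<phi> x (axis 2 1)"
  define L where "L x = det4 (?u x) (?v x) (\<nu> x)" for x
  have linL: "linear (L x)" for x
    using bilinear_det4[of "?u x" "?v x"] by (simp add: L_def bilinear_def)
  note O = h.src.open_S
  have sL: "smooth_on U (\<lambda>x. L x z)" for z
    unfolding L_def det4_def
  proof (rule smooth_on_det[OF O])
    show "smooth_on U (\<lambda>x. (vector [?u x, ?v x, \<nu> x, z] :: real^4^4) $ i $ k)" for i k
      using exhaust_4[of i] smooth_on_vec_nth[OF O smooth_on_dd[OF phi.smooth_\<phi>]]
        smooth_on_vec_nth[OF O smooth_\<nu>]
      by (auto intro: smooth_on_const)
  qed
  have sg: "smooth_on U (\<lambda>x. g4 (\<phi> x) u v)" for u v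
    by (rule smooth_on_compose[OF O psi.tgt.open_S phi.\<phi>S phi.smooth_\<phi> psi.tgt.smooth_g])
  have "\<exists>w. smooth_on U w \<and> (\<forall>x\<in>U. \<forall>z. g4 (\<phi> x) (w x) z = L x z)"
    by (rule smooth_riesz[where A = "\<lambda>x. g4 (\<phi> x)" and L = L,
          OF O psi.tgt.bil[OF phi.f.h_in] psi.tgt.pos[OF phi.f.h_in] sg linL sL])
  then obtain n0 where n0: "smooth_on U n0" "\<And>x z. x \<in> U \<Longrightarrow> g4 (\<phi> x) (n0 x) z = L x z"
    by blast
  have p: "g4 (\<phi> x) (n0 x) (n0 x) > 0" if x: "x \<in> U" for x
  proof (rule psi.tgt.pos[OF phi.f.h_in[OF x]])
    note lin = linear_add[OF phi.linear_dd[OF x]] linear_cmul[OF phi.linear_dd[OF x]]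
    obtain w where w: "w \<notin> span {?u x, ?v x, \<nu> x}"
      by (rule ex_notin_span[of "{?u x, ?v x, \<nu> x}"]) (auto simp: card_insert_if)
    have "L x w \<noteq> 0"
    proof
      assume "L x w = 0"
      then obtain k where k: "\<exists>i. k i \<noteq> 0"
        "(\<Sum>i\<in>UNIV. k i *\<^sub>R (vector [?u x, ?v x, \<nu> x, w] :: real^4^4) $ i) = 0"
        unfolding L_def det4_def using det_zero_combination by blast
      have k0: "k 4 *\<^sub>R w = - (k 1 *\<^sub>R ?u x + k 2 *\<^sub>R ?v x + k 3 *\<^sub>R \<nu> x)"
        unfolding eq_neg_iff_add_eq_0 using k(2) by (simp add: sum_4 add_ac)
      have k4: "k 4 = 0"
      proof (rule ccontr)
        assume "k 4 \<noteq> 0"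
        then have "w = inverse (k 4) *\<^sub>R (- (k 1 *\<^sub>R ?u x + k 2 *\<^sub>R ?v x + k 3 *\<^sub>R \<nu> x))"
          unfolding k0[symmetric] by simp
        moreover have "\<dots> \<in> span {?u x, ?v x, \<nu> x}"
          by (intro span_scale span_neg span_add span_base) auto
        ultimately show False using w by simp
      qed
      let ?t = "k 1 *\<^sub>R axis 1 1 + k 2 *\<^sub>R axis 2 1 :: real^2"
      have t: "dd \<phi> x ?t + k 3 *\<^sub>R \<nu> x = 0"
        using k(2) by (simp add: sum_4 k4 lin)
      \<comment> \<open>Pairing the relation with \<open>\<nu>\<close> isolates its
        coefficient.\<close>
      then have "g4 (\<phi> x) (\<nu> x) (dd \<phi> x ?t + k 3 *\<^sub>R \<nu> x) = 0"
        by (simp add: psi.tgt.lin phi.f.h_in[OF x])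
      then have k3: "k 3 = 0"
        by (simp add: psi.tgt.lin phi.f.h_in[OF x] \<nu>_normal[OF x] \<nu>_unit[OF x])
      then have "dd \<phi> x ?t = dd \<phi> x 0" using t by (simp add: linear_0[OF phi.linear_dd[OF x]])
      then have *: "?t = 0" by (simp only: phi.dd_inj[OF x])
      have "k 1 = 0" "k 2 = 0"
        using arg_cong[OF *, of "\<lambda>v. v $ 1"] arg_cong[OF *, of "\<lambda>v. v $ 2"] by (simp_all add: axis_def)
      with k3 k4 k(1) exhaust_4 show False by metis
    qed
    then show "n0 x \<noteq> 0" using n0(2)[OF x, of w] by (auto simp: psi.tgt.lin phi.f.h_in[OF x])
  qed
  define m where "m x = sqrt (g4 (\<phi> x) (n0 x) (n0 x))" for x
  have sm: "smooth_on U m"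
    unfolding m_def
    by (rule smooth_on_sqrt[OF O psi.tgt.g.smooth[OF O phi.\<phi>S phi.smooth_\<phi> n0(1,1)] p])
  have m: "m x > 0" "m x * m x = g4 (\<phi> x) (n0 x) (n0 x)" if "x \<in> U" for x
    using p[OF that] by (auto simp: m_def less_imp_le)
  show ?thesis
  proof (rule that)
    show "smooth_on U (\<lambda>x. inverse (m x) *\<^sub>R n0 x)"
      by (rule smooth_on_scaleR[OF O smooth_on_inverse[OF O sm m(1)[THEN less_imp_neq, symmetric]] n0(1)])
    fix x assume x: "x \<in> U"
    have u: "inverse (m x) * (inverse (m x) * g4 (\<phi> x) (n0 x) (n0 x)) = 1"
      unfolding m(2)[OF x, symmetric] using m(1)[OF x] by (simp add: field_simps)
    have "g4 (\<phi> x) (n0 x) (dd \<phi> x w) = 0" for w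
    proof -
      have w: "w = w $ 1 *\<^sub>R axis 1 1 + w $ 2 *\<^sub>R axis 2 1"
        by (simp add: vec_eq_iff forall_2 axis_def)
      have "dd \<phi> x w = w $ 1 *\<^sub>R ?u x + w $ 2 *\<^sub>R ?v x"
        by (subst w) (simp only: linear_add[OF phi.linear_dd[OF x]] linear_cmul[OF phi.linear_dd[OF x]])
      then show ?thesis
        by (simp add: n0(2)[OF x] linear_add[OF linL] linear_cmul[OF linL]) (simp add: L_def det4_same)
    qed
    moreover have "g4 (\<phi> x) (n0 x) (\<nu> x) = 0" by (simp add: n0(2)[OF x] L_def det4_same)
    then have "g4 (\<phi> x) (\<nu> x) (n0 x) = 0" using psi.tgt.sym[OF phi.f.h_in[OF x], of "\<nu> x"] by simp
    moreover have "det4 (?u x) (?v x) (\<nu> x) (inverse (m x) *\<^sub>R n0 x)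
      = inverse (m x) * g4 (\<phi> x) (n0 x) (n0 x)"
      using linear_cmul[OF linL[of x], of "inverse (m x)" "n0 x"] by (simp add: n0(2)[OF x] L_def)
    ultimately show "pos_normal_onb g4 \<phi> x (\<nu> x) (inverse (m x) *\<^sub>R n0 x)"
      using u m(1)[OF x] p[OF x]
      by (simp add: pos_normal_onb_def det4_def[symmetric] normal_space_def psi.tgt.lin phi.f.h_in[OF x]
          \<nu>_normal[OF x] \<nu>_unit[OF x])
  qed
qed

lemma exists_flat_surface:
  obtains \<zeta> where "flat_surface gM U g4 T \<phi> \<nu> \<zeta> c"
proof -
  obtain \<zeta> where \<zeta>: "smooth_on U \<zeta>" "\<And>x. x \<in> U \<Longrightarrow> pos_normal_onb g4 \<phi> x (\<nu> x) (\<zeta> x)"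
    by (rule exists_binormal) blast
  have "flat_surface gM U g4 T \<phi> \<nu> \<zeta> c"
  proof
    fix x assume x: "x \<in> U"
    show "\<exists>t. cov_deriv g4 \<phi> \<nu> x u = dd \<phi> x t" for u by (rule \<nu>_parallel[OF x])
    obtain \<eta> where \<eta>: "g4 (\<phi> x) (\<nu> x) \<eta> = 0"
      "\<And>u v. sff g4 \<phi> x u v = h.II x u v *\<^sub>R \<nu> x + gM x u v *\<^sub>R \<eta>"
      "\<And>u v. g4 (\<phi> x) (sff g4 \<phi> x u v) (\<nu> x) = h.II x u v"
      using sff_\<phi>[OF x] by metis
    show "\<exists>\<eta>. g4 (\<phi> x) (\<nu> x) \<eta> = 0 \<and>
      (\<forall>u v. sff g4 \<phi> x u v = g4 (\<phi> x) (sff g4 \<phi> x u v) (\<nu> x) *\<^sub>R \<nu> x + gM x u v *\<^sub>R \<eta>)"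
      unfolding \<eta>(3) using \<eta>(1,2) by blast
    show "\<not> (\<exists>k. \<forall>u v. g4 (\<phi> x) (sff g4 \<phi> x u v) (\<nu> x) = k * gM x u v)"
    proof
      assume "\<exists>k. \<forall>u v. g4 (\<phi> x) (sff g4 \<phi> x u v) (\<nu> x) = k * gM x u v"
      then obtain k where k: "\<And>u v. h.II x u v = gM x u v * k" unfolding \<eta>(3) by (metis mult.commute)
      have "umbilic_at gM g3 h x"
        unfolding umbilic_at_def
        by (rule exI[of _ "k *\<^sub>R h.N x"]) (simp add: h.sff_II[OF x] k)
      then show False using not_umb[OF x] by simp
    qed
  qed (use smooth_\<nu> \<zeta> curv_c in auto)
  then show ?thesis by (rule that)
qed

lemma M0_at_false: "x \<in> U \<Longrightarrow> \<not> M0_at c s gM g4 \<phi> x"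
proof -
  obtain \<zeta> where "flat_surface gM U g4 T \<phi> \<nu> \<zeta> c" using exists_flat_surface .
  then show "x \<in> U \<Longrightarrow> \<not> M0_at c s gM g4 \<phi> x" by (rule flat_surface.M0_empty)
qed

text \<open>The form of \<open>\<phi>\<close> in the direction of \<open>\<nu>\<close> is that of
  \<open>h\<close>, so the frame diagonalizing the former is principal for \<open>h\<close>; the
  positive half difference orders the principal curvatures.\<close>

lemma exists_principal_frame:
  assumes x: "x \<in> U"
  obtains W E1 E2 where "x \<in> W" "W \<subseteq> U" "principal_frame gM g3 h W E1 E2"
proof -
  obtain \<zeta> where "flat_surface gM U g4 T \<phi> \<nu> \<zeta> c" using exists_flat_surface .
  then interpret f: flat_surface gM U g4 T \<phi> \<nu> \<zeta> c .
  have II: "f.II y u v = h.II y u v" if "y \<in> U" for y u v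
    unfolding f.II_def using sff_\<phi>[OF that] by metis
  obtain W E1 E2 where W: "x \<in> W" "W \<subseteq> U" "pos_frame gM W E1 E2"
    "\<And>y. y \<in> W \<Longrightarrow> f.II y (E1 y) (E2 y) = 0" "\<And>y. y \<in> W \<Longrightarrow> f.half_diff y (E1 y) (E2 y) > 0"
    using f.exists_principal[OF x] by metis
  have "principal_frame gM g3 h W E1 E2"
    using W(2,4,5) II by (intro h.principal_frameI[OF W(2,3)]) (auto simp: f.half_diff_def subset_iff)
  with W show ?thesis using that by blast
qed

text \<open>An arbitrary principal frame may leave the common domain \<open>U\<close>, so its domain
  is first cut down to \<open>U\<close>.\<close>

lemma mixed_principal:
  assumes W: "W \<subseteq> U" "pos_frame gM W e1 e2" "x \<in> W"
    and W': "principal_frame gM g3 h W' E1 E2" "x \<in> W'" and s: "s\<^sup>2 = 1"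
  shows "2 * conn_form gM e1 e2 x v
    + s * normal_conn_form g4 \<phi> (mixed_e3 s g4 \<phi> e1 e2) (mixed_e4 s g4 \<phi> e1 e2) x v
    = 2 * conn_form gM E1 E2 x v"
proof -
  obtain \<zeta> where "flat_surface gM U g4 T \<phi> \<nu> \<zeta> c" using exists_flat_surface .
  then interpret f: flat_surface gM U g4 T \<phi> \<nu> \<zeta> c .
  have E: "open W'" "pos_frame gM W' E1 E2" using W'(1) by (auto simp: principal_frame_def pos_frame_def)
  have E': "pos_frame gM (W' \<inter> U) E1 E2"
    using E h.src.open_S smooth_on_subset[OF _ Int_lower1] by (auto simp: pos_frame_def)
  have "f.II y (E1 y) (E2 y) = 0" if "y \<in> W' \<inter> U" for y
  proof -
    have y: "y \<in> U" "y \<in> W'" using that by auto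
    have "f.II y (E1 y) (E2 y) = h.II y (E1 y) (E2 y)"
      unfolding f.II_def using sff_\<phi>[OF y(1)] by metis
    then show ?thesis
      using h.principal_frame_sff[OF W'(1) y(2,1)] by (simp add: h.II_def h.tgt.lin h.f.h_in[OF y(1)])
  qed
  then show ?thesis using W W'(2) by (intro f.mixed_conn_form_eq[OF W _ E' _ _ s]) auto
qed

end

section \<open>Passage to charts\<close>

lemma (in riem_patch) riem_patch_subset:
  "open W \<Longrightarrow> W \<subseteq> S \<Longrightarrow> riem_patch g W"
  using bil sym pos smooth_on_subset[OF smooth_g] by unfold_locales auto

lemma pos_frame_restrict:
  "pos_frame g W e1 e2 \<Longrightarrow> open V \<Longrightarrow> pos_frame g (W \<inter> V) e1 e2"
  using smooth_on_subset[OF _ Int_lower1] by (auto simp: pos_frame_def)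

lemma chart_props:
  fixes A :: "('m::topological_space, 'n::finite) chart set"
  assumes A: "oriented_atlas A" and \<kappa>: "\<kappa> \<in> A"
  shows chart_inj: "inj_on (snd \<kappa>) (fst \<kappa>)"
    and chart_open_image: "open B \<Longrightarrow> open (snd \<kappa> ` (fst \<kappa> \<inter> B))"
proof -
  have o: "open (snd \<kappa> ` fst \<kappa>)"
    and h: "homeomorphism (fst \<kappa>) (snd \<kappa> ` fst \<kappa>) (snd \<kappa>) (inv_into (fst \<kappa>) (snd \<kappa>))"
    using A \<kappa> unfolding oriented_atlas_def by (auto simp: case_prod_beta)
  show inj: "inj_on (snd \<kappa>) (fst \<kappa>)"
    using h by (metis homeomorphism_def inj_on_inverseI)
  assume B: "open B"
  have "snd \<kappa> ` (fst \<kappa> \<inter> B) = snd \<kappa> ` fst \<kappa> \<inter> inv_into (fst \<kappa>) (snd \<kappa>) -` B"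
    using inj by (auto simp: inv_into_f_f)
  then show "open (snd \<kappa> ` (fst \<kappa> \<inter> B))"
    using continuous_open_preimage[OF homeomorphism_cont2[OF h] o B] by simp
qed

lemma riem_patch_chart:
  assumes M: "oriented_riemannian M" and \<kappa>: "\<kappa> \<in> atlas M"
  shows "riem_patch (riem_metric M \<kappa>) (snd \<kappa> ` fst \<kappa>)"
proof
  show "open (snd \<kappa> ` fst \<kappa>)"
    using chart_open_image[of "atlas M" \<kappa> UNIV] assms by (simp add: oriented_riemannian_def)
qed (use assms in \<open>auto simp: oriented_riemannian_def\<close>)

lemma chart_cover:
  assumes "oriented_riemannian M"
  obtains \<kappa> where "\<kappa> \<in> atlas M" "p \<in> fst \<kappa>"
proof -
  have "p \<in> \<Union> (fst ` atlas M)" using assms by (simp add: oriented_riemannian_def oriented_atlas_def)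
  then show ?thesis using that by auto
qed

text \<open>Coordinates of the points where all three charts are usable at once. Frames in the
  definitions of the two connection forms live on overlaps containing it and have to be
  restricted.\<close>

definition common_domain ::
  "('m, 2) chart \<Rightarrow> ('p, 3) chart \<Rightarrow> ('q, 4) chart \<Rightarrow> ('m \<Rightarrow> 'p) \<Rightarrow> ('m \<Rightarrow> 'q) \<Rightarrow> (real^2) set" where
  "common_domain \<kappa> \<mu> \<tau> F f = snd \<kappa> ` (fst \<kappa> \<inter> (F -` fst \<mu> \<inter> f -` fst \<tau>))"

text \<open>Translates the global hypotheses into \<open>composed_patch\<close> for an arbitrary
  triple of charts; injectivity of the charts lets the expression of \<open>f\<close> factor through
  those of \<open>F\<close> and \<open>j\<close>.\<close>

lemma composed_patch_charts:
  fixes M :: "('m::{t2_space,second_countable_topology}, 2) riem"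
    and Q3 :: "('p::{t2_space,second_countable_topology}, 3) riem"
    and Q4 :: "('q::{t2_space,second_countable_topology}, 4) riem"
  assumes M: "oriented_riemannian M" and Q3: "oriented_riemannian Q3" and Q4: "oriented_riemannian Q4"
    and c: "constant_curvature c Q4"
    and F: "isometric_immersion M Q3 F" "umbilic_free M Q3 F"
    and j: "isometric_immersion Q3 Q4 j" "totally_umbilical Q3 Q4 j"
    and f: "f = j \<circ> F"
    and charts: "\<kappa> \<in> atlas M" "\<mu> \<in> atlas Q3" "\<tau> \<in> atlas Q4"
  shows "composed_patch (riem_metric M \<kappa>) (common_domain \<kappa> \<mu> \<tau> F f)
    (riem_metric Q3 \<mu>) (overlap \<mu> \<tau> j) (loc_rep \<kappa> \<mu> F)
    (riem_metric Q4 \<tau>) (snd \<tau> ` fst \<tau>) (loc_rep \<mu> \<tau> j) (loc_rep \<kappa> \<tau> f) c"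
proof -
  let ?U = "common_domain \<kappa> \<mu> \<tau> F f" and ?V = "overlap \<mu> \<tau> j" and ?T = "snd \<tau> ` fst \<tau>"
  have atl: "oriented_atlas (atlas M)" "oriented_atlas (atlas Q3)" "oriented_atlas (atlas Q4)"
    using M Q3 Q4 by (auto simp: oriented_riemannian_def)
  have opn: "open (fst \<mu>)" "open (fst \<tau>)"
    using atl charts by (auto simp: oriented_atlas_def case_prod_beta)
  have cont: "continuous_on UNIV F" "continuous_on UNIV j"
    using F j by (auto simp: isometric_immersion_def)
  have cf: "continuous_on UNIV f"
    unfolding f by (rule continuous_on_compose[OF cont(1) continuous_on_subset[OF cont(2)]]) simp
  have oU: "open ?U"
    unfolding common_domain_def
    by (rule chart_open_image[OF atl(1) charts(1) open_Int[OF open_vimage[OF opn(1) cont(1)] open_vimage[OF opn(2) cf]]])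
  have oV: "open ?V"
    unfolding overlap_def by (rule chart_open_image[OF atl(2) charts(2) open_vimage[OF opn(2) cont(2)]])
  have UF: "?U \<subseteq> overlap \<kappa> \<mu> F" and UM: "?U \<subseteq> snd \<kappa> ` fst \<kappa>"
    by (auto simp: common_domain_def overlap_def)
  have VQ: "?V \<subseteq> snd \<mu> ` fst \<mu>" by (auto simp: overlap_def)
  have inj: "inj_on (snd \<kappa>) (fst \<kappa>)" "inj_on (snd \<mu>) (fst \<mu>)"
    using chart_inj[OF atl(1) charts(1)] chart_inj[OF atl(2) charts(2)] .
  have hU: "loc_rep \<kappa> \<mu> F x \<in> ?V \<and> loc_rep \<kappa> \<tau> f x = loc_rep \<mu> \<tau> j (loc_rep \<kappa> \<mu> F x)"
    if x: "x \<in> ?U" for x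
  proof -
    obtain q where "x = snd \<kappa> q" "q \<in> fst \<kappa>" "F q \<in> fst \<mu>" "f q \<in> fst \<tau>"
      using x by (auto simp: common_domain_def)
    then show ?thesis using inj by (auto simp: loc_rep_def overlap_def f inv_into_f_f)
  qed
  interpret M: riem_patch "riem_metric M \<kappa>" ?U
    by (rule riem_patch.riem_patch_subset[OF riem_patch_chart[OF M charts(1)] oU UM])
  interpret Q3: riem_patch "riem_metric Q3 \<mu>" ?V
    by (rule riem_patch.riem_patch_subset[OF riem_patch_chart[OF Q3 charts(2)] oV VQ])
  interpret Q4: riem_patch "riem_metric Q4 \<tau>" ?T
    by (rule riem_patch_chart[OF Q4 charts(3)])
  show ?thesis
  proof
    show "smooth_on ?U (loc_rep \<kappa> \<mu> F)"
      using F(1) charts by (intro smooth_on_subset[OF _ UF]) (auto simp: isometric_immersion_def)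
    show "smooth_on ?V (loc_rep \<mu> \<tau> j)"
      using j(1) charts by (auto simp: isometric_immersion_def)
    show "loc_rep \<kappa> \<mu> F ` ?U \<subseteq> ?V" using hU by auto
    show "loc_rep \<mu> \<tau> j ` ?V \<subseteq> ?T"
      using inj(2) by (auto simp: loc_rep_def overlap_def inv_into_f_f)
    show "riem_metric M \<kappa> x u v = riem_metric Q3 \<mu> (loc_rep \<kappa> \<mu> F x)
        (dd (loc_rep \<kappa> \<mu> F) x u) (dd (loc_rep \<kappa> \<mu> F) x v)" if "x \<in> ?U" for x u v
      using F(1) charts that UF unfolding isometric_immersion_def by blast
    show "riem_metric Q3 \<mu> x u v = riem_metric Q4 \<tau> (loc_rep \<mu> \<tau> j x)
        (dd (loc_rep \<mu> \<tau> j) x u) (dd (loc_rep \<mu> \<tau> j) x v)" if "x \<in> ?V" for x u v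
      using j(1) charts that unfolding isometric_immersion_def by blast
    show "loc_rep \<kappa> \<tau> f x = loc_rep \<mu> \<tau> j (loc_rep \<kappa> \<mu> F x)" if "x \<in> ?U" for x
      using hU[OF that] by simp
    show "umbilic_at (riem_metric Q3 \<mu>) (riem_metric Q4 \<tau>) (loc_rep \<mu> \<tau> j) y" if "y \<in> ?V" for y
      using j(2) charts that unfolding totally_umbilical_def by blast
    show "\<not> umbilic_at (riem_metric M \<kappa>) (riem_metric Q3 \<mu>) (loc_rep \<kappa> \<mu> F) x" if "x \<in> ?U" for x
      using F(2) charts that UF unfolding umbilic_free_def by blast
    show "sec_curv (riem_metric Q4 \<tau>) y u v = c" if "y \<in> ?T" "u \<noteq> v" "independent {u, v}" for y u v
      using c charts that unfolding constant_curvature_def by blast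
  qed
qed

theorem proposition19:
  fixes M :: "('m::{t2_space,second_countable_topology}, 2) riem"
    and Q3 :: "('p::{t2_space,second_countable_topology}, 3) riem"
    and Q4 :: "('q::{t2_space,second_countable_topology}, 4) riem"
    and c c' :: real
    and F :: "'m \<Rightarrow> 'p" and j :: "'p \<Rightarrow> 'q" and f :: "'m \<Rightarrow> 'q"
  assumes "oriented_riemannian M" and "connected (UNIV :: 'm set)"
    and "space_form c' Q3" and "space_form c Q4" and "c' \<ge> c"
    and "isometric_immersion M Q3 F" and "umbilic_free M Q3 F"
    and "isometric_immersion Q3 Q4 j" and "inj j" and "totally_umbilical Q3 Q4 j"
    and "f = j \<circ> F"
  shows "\<forall>\<kappa>\<in>atlas M. \<forall>p\<in>fst \<kappa>. \<forall>v.
    mixed_conn_form c (-1) M Q4 f \<kappa> p v = mixed_conn_form c 1 M Q4 f \<kappa> p v \<and>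
    mixed_conn_form c 1 M Q4 f \<kappa> p v = 2 * principal_conn_form M Q3 F \<kappa> p v"
proof (intro ballI allI)
  fix \<kappa> p v assume \<kappa>: "\<kappa> \<in> atlas M" and p: "p \<in> fst \<kappa>"
  have Q: "oriented_riemannian Q3" "oriented_riemannian Q4" "constant_curvature c Q4"
    using assms by (auto simp: space_form_def)
  note comp = composed_patch_charts[OF \<open>oriented_riemannian M\<close> Q
      \<open>isometric_immersion M Q3 F\<close> \<open>umbilic_free M Q3 F\<close> \<open>isometric_immersion Q3 Q4 j\<close>
      \<open>totally_umbilical Q3 Q4 j\<close> \<open>f = j \<circ> F\<close>]
  let ?U = "\<lambda>\<kappa> \<mu> \<tau>. common_domain \<kappa> \<mu> \<tau> F f"
  have oU: "open (?U \<kappa> \<mu> \<tau>)" if "\<mu> \<in> atlas Q3" "\<tau> \<in> atlas Q4" for \<mu> \<tau>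
  proof -
    interpret composed_patch "riem_metric M \<kappa>" "?U \<kappa> \<mu> \<tau>" "riem_metric Q3 \<mu>" "overlap \<mu> \<tau> j"
      "loc_rep \<kappa> \<mu> F" "riem_metric Q4 \<tau>" "snd \<tau> ` fst \<tau>" "loc_rep \<mu> \<tau> j" "loc_rep \<kappa> \<tau> f" c
      by (rule comp[OF \<kappa> that])
    show ?thesis by (rule h.src.open_S)
  qed
  have M0: "M0 c s M Q4 f = {}" for s
  proof -
    have False if q: "\<kappa> \<in> atlas M" "\<tau> \<in> atlas Q4" "q \<in> fst \<kappa>" "f q \<in> fst \<tau>"
      "M0_at c s (riem_metric M \<kappa>) (riem_metric Q4 \<tau>) (loc_rep \<kappa> \<tau> f) (snd \<kappa> q)" for q \<kappa> \<tau>
    proof -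
      \<comment> \<open>\<open>M0\<close> mentions only charts of \<open>M\<close> and
        \<open>Q4\<close>; a chart of \<open>Q3\<close> is inserted to reach the composed
        situation.\<close>
      obtain \<mu> where \<mu>: "\<mu> \<in> atlas Q3" "F q \<in> fst \<mu>" using chart_cover[OF Q(1)] .
      have "snd \<kappa> q \<in> ?U \<kappa> \<mu> \<tau>" using q \<mu> by (auto simp: common_domain_def)
      with composed_patch.M0_at_false[OF comp[OF q(1) \<mu>(1) q(2)]] q(5) show False by blast
    qed
    then show ?thesis unfolding M0_def by blast
  qed
  define x where "x = snd \<kappa> p"
  have inj: "inj_on (snd \<kappa>) (fst \<kappa>)"
    using chart_inj[OF _ \<kappa>] \<open>oriented_riemannian M\<close> by (auto simp: oriented_riemannian_def)
  obtain \<mu>0 where \<mu>0: "\<mu>0 \<in> atlas Q3" "F p \<in> fst \<mu>0" using chart_cover[OF Q(1)] .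
  obtain \<tau>0 where \<tau>0: "\<tau>0 \<in> atlas Q4" "f p \<in> fst \<tau>0" using chart_cover[OF Q(2)] .
  have xU: "x \<in> ?U \<kappa> \<mu> \<tau>" if "F p \<in> fst \<mu>" "f p \<in> fst \<tau>" for \<mu> \<tau>
    using that p by (auto simp: x_def common_domain_def)
  \<comment> \<open>Membership of the coordinates in \<open>overlap\<close> yields some point of the
    chart domain; injectivity of the chart identifies it with \<open>p\<close>.\<close>
  have xF: "F p \<in> fst \<mu>" if "x \<in> overlap \<kappa> \<mu> F" for \<mu> :: "('p, 3) chart"
    using that p inj by (auto simp: x_def overlap_def dest: inj_onD)
  have xf: "f p \<in> fst \<tau>" if "x \<in> overlap \<kappa> \<tau> f" for \<tau> :: "('q, 4) chart"
    using that p inj by (auto simp: x_def overlap_def dest: inj_onD)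
  \<comment> \<open>The reference frame supplies the common value of both forms and makes both
    descriptions non-vacuous.\<close>
  obtain W0 E1 E2 where W0: "x \<in> W0" "W0 \<subseteq> ?U \<kappa> \<mu>0 \<tau>0"
    "principal_frame (riem_metric M \<kappa>) (riem_metric Q3 \<mu>0) (loc_rep \<kappa> \<mu>0 F) W0 E1 E2"
    by (rule composed_patch.exists_principal_frame[OF comp[OF \<kappa> \<mu>0(1) \<tau>0(1)] xU[OF \<mu>0(2) \<tau>0(2)]])
  have E: "pos_frame (riem_metric M \<kappa>) W0 E1 E2" using W0(3) by (simp add: principal_frame_def)
  have W0F: "W0 \<subseteq> overlap \<kappa> \<mu>0 F" "W0 \<subseteq> overlap \<kappa> \<tau>0 f"
    using W0(2) by (auto simp: common_domain_def overlap_def)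
  let ?conn = "\<lambda>e1 e2. conn_form (riem_metric M \<kappa>) e1 e2 x v"
  let ?mix = "\<lambda>s \<tau> e1 e2. 2 * ?conn e1 e2 + s * normal_conn_form (riem_metric Q4 \<tau>) (loc_rep \<kappa> \<tau> f)
      (mixed_e3 s (riem_metric Q4 \<tau>) (loc_rep \<kappa> \<tau> f) e1 e2)
      (mixed_e4 s (riem_metric Q4 \<tau>) (loc_rep \<kappa> \<tau> f) e1 e2) x v"
  \<comment> \<open>The left side involves \<open>\<tau>\<close> and the positive frame, the right
    side \<open>\<mu>\<close> and the principal frame. As these vary independently, each side is
    constant.\<close>
  have mix: "?mix s \<tau> e1 e2 = 2 * ?conn e1' e2'"
    if "\<mu> \<in> atlas Q3" "F p \<in> fst \<mu>" "\<tau> \<in> atlas Q4" "f p \<in> fst \<tau>" "s\<^sup>2 = 1"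
      "pos_frame (riem_metric M \<kappa>) W e1 e2" "x \<in> W"
      "principal_frame (riem_metric M \<kappa>) (riem_metric Q3 \<mu>) (loc_rep \<kappa> \<mu> F) W' e1' e2'" "x \<in> W'"
    for s \<mu> \<tau> W e1 e2 W' e1' e2'
    using composed_patch.mixed_principal[OF comp[OF \<kappa> that(1,3)] Int_lower2
        pos_frame_restrict[OF that(6) oU[OF that(1,3)]] _ that(8,9,5)] that(7) xU[OF that(2,4)]
    by blast
  have principal: "principal_conn_form M Q3 F \<kappa> p v = ?conn E1 E2"
    unfolding principal_conn_form_def x_def[symmetric]
  proof (rule the_equality, intro ballI allI impI)
    fix \<mu> W e1 e2 assume \<mu>: "\<mu> \<in> atlas Q3" and e: "W \<subseteq> overlap \<kappa> \<mu> F \<and> x \<in> W \<and>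
      principal_frame (riem_metric M \<kappa>) (riem_metric Q3 \<mu>) (loc_rep \<kappa> \<mu> F) W e1 e2"
    then have "F p \<in> fst \<mu>" using xF by blast
    \<comment> \<open>Two principal frames, possibly from different charts of \<open>Q3\<close>, are
      compared through the same mixed expression; the sign 1 is an arbitrary choice.\<close>
    then have "?mix 1 \<tau>0 E1 E2 = 2 * ?conn e1 e2"
      using e by (intro mix[OF \<mu> _ \<tau>0 _ E W0(1)]) auto
    moreover have "?mix 1 \<tau>0 E1 E2 = 2 * ?conn E1 E2"
      by (rule mix[OF \<mu>0 \<tau>0 _ E W0(1) W0(3,1)]) simp
    ultimately show "?conn E1 E2 = ?conn e1 e2" by linarith
  next
    fix r assume "\<forall>\<mu>\<in>atlas Q3. \<forall>W e1 e2. W \<subseteq> overlap \<kappa> \<mu> F \<and> x \<in> W \<and>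
      principal_frame (riem_metric M \<kappa>) (riem_metric Q3 \<mu>) (loc_rep \<kappa> \<mu> F) W e1 e2 \<longrightarrow> r = ?conn e1 e2"
    then show "r = ?conn E1 E2" using \<mu>0(1) W0 W0F by blast
  qed
  have mixed: "mixed_conn_form c s M Q4 f \<kappa> p v = 2 * ?conn E1 E2" if s: "s\<^sup>2 = 1" for s
    unfolding mixed_conn_form_def x_def[symmetric] M0
  proof (rule the_equality, intro ballI allI impI)
    fix \<tau> W e1 e2 assume \<tau>: "\<tau> \<in> atlas Q4" and e: "W \<subseteq> overlap \<kappa> \<tau> f \<and>
      W \<inter> snd \<kappa> ` (fst \<kappa> \<inter> {}) = {} \<and> x \<in> W \<and> pos_frame (riem_metric M \<kappa>) W e1 e2"
    then have \<tau>': "f p \<in> fst \<tau>" using xf by blast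
    have W: "pos_frame (riem_metric M \<kappa>) W e1 e2" "x \<in> W" using e by auto
    show "2 * ?conn E1 E2 = ?mix s \<tau> e1 e2"
      by (rule mix[OF \<mu>0 \<tau> \<tau>' s W W0(3,1), symmetric])
  next
    fix r assume r: "\<forall>\<tau>\<in>atlas Q4. \<forall>W e1 e2. W \<subseteq> overlap \<kappa> \<tau> f \<and>
      W \<inter> snd \<kappa> ` (fst \<kappa> \<inter> {}) = {} \<and> x \<in> W \<and> pos_frame (riem_metric M \<kappa>) W e1 e2
      \<longrightarrow> r = ?mix s \<tau> e1 e2"
    \<comment> \<open>The principal reference frame is itself an admissible positive frame, so it
      pins down the value.\<close>
    have "r = ?mix s \<tau>0 E1 E2"
      by (rule r[rule_format, OF \<tau>0(1), of W0]) (use W0 W0F E in auto)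
    also have "\<dots> = 2 * ?conn E1 E2" by (rule mix[OF \<mu>0 \<tau>0 s E W0(1) W0(3,1)])
    finally show "r = 2 * ?conn E1 E2" .
  qed
  show "mixed_conn_form c (-1) M Q4 f \<kappa> p v = mixed_conn_form c 1 M Q4 f \<kappa> p v \<and>
    mixed_conn_form c 1 M Q4 f \<kappa> p v = 2 * principal_conn_form M Q3 F \<kappa> p v"
    by (simp add: mixed principal)
qed

end
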